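(* There is a randomized algorithm which, given a matrix $A\in\mathbb{R}^{n\times d}$ with $n\ge d$, a relative error tolerance $\epsilon\in(0,1)$ and a failure probability $\delta\in(0,1)$, runs in time $O(\mathrm{nnz}(A)+\tau)$, where $$\tau=O\left(\min\left\{\frac{\mathrm{nnz}(A)}{\epsilon}\log\left(\frac{d}{\epsilon\delta}\right),\ \frac{d^2}{\epsilon^3}\log^2\left(\frac{d}{\epsilon\delta}\right)\right\}\right),$$ and outputs an estimate $\tilde\sigma^2$ which, with probability at least $1-\delta$, satisfies $$(1-\epsilon)\|A\|^2\le\tilde\sigma^2\le(1+\epsilon)\|A\|^2.$$
   Context: $\|A\|=\max_{\|x\|=1}\|Ax\|$ is the spectral norm of $A$ (with Euclidean vector norms), and $\mathrm{nnz}(A)$ is the number of non-zero entries of $A$. The constants in the $O(\cdot)$ are absolute (independent of $A,n,d,\epsilon,\delta$). Running time is counted in arithmetic operations, where the algorithm may draw independent random samples (e.g. uniform and standard normal variates) and $A$ is given by its list of non-zero entries. The probability is over the internal randomness of the algorithm.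
   Formalization: In the running time, nnz(A) is replaced by max(1, nnz(A)); this matters only for A = 0, where the stated bound O(nnz(A)+τ) is literally 0 and O(1) is proved instead. *)

theory Defs
  imports "HOL-Probability.Probability" "Jordan_Normal_Form.Matrix"
begin

section \<open>Matrices\<close>

definition eucl_norm :: "real vec \<Rightarrow> real" where
  "eucl_norm v = sqrt (scalar_prod v v)"

text \<open>The supremum is a maximum, since the unit sphere is compact; it is meaningful for matrices
  with at least one column.\<close>

definition spectral_norm :: "real mat \<Rightarrow> real" where
  "spectral_norm A =
     (SUP x \<in> {x \<in> carrier_vec (dim_col A). eucl_norm x = 1}. eucl_norm (A *\<^sub>v x))"

definition nnz :: "real mat \<Rightarrow> nat" where
  "nnz A = card {(i, j). i < dim_row A \<and> j < dim_col A \<and> A $$ (i, j) \<noteq> 0}"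

text \<open>A sparse representation lists every non-zero entry exactly once, in an arbitrary order.\<close>

definition entry_list :: "real mat \<Rightarrow> (nat \<times> nat \<times> real) list \<Rightarrow> bool" where
  "entry_list A es \<longleftrightarrow> distinct es \<and>
     set es = {(i, j, A $$ (i, j)) | i j. i < dim_row A \<and> j < dim_col A \<and> A $$ (i, j) \<noteq> 0}"

lemma length_entry_list:
  assumes "entry_list A es"
  shows "length es = nnz A"
proof -
  let ?S = "{(i, j). i < dim_row A \<and> j < dim_col A \<and> A $$ (i, j) \<noteq> 0}"
  have "set es = (\<lambda>(i, j). (i, j, A $$ (i, j))) ` ?S"
    using assms unfolding entry_list_def by force
  moreover have "inj_on (\<lambda>(i, j). (i, j, A $$ (i, j))) ?S"
    by (auto simp: inj_on_def)
  ultimately have "card (set es) = nnz A"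
    unfolding nnz_def by (simp add: card_image)
  moreover have "distinct es"
    using assms by (simp add: entry_list_def)
  ultimately show ?thesis
    using distinct_card by metis
qed


section \<open>A randomized real RAM\<close>

text \<open>
  Programs are finite and work on finitely many named arrays of natural numbers and of exact real
  numbers (a scalar variable is cell 0 of an array).  The natural numbers serve as addresses and
  counters.  Two features that would make the model unreasonably strong are left out: there are
  no real constants other than natural numbers (an arbitrary real constant can encode an infinite
  table), and there is no rounding from reals to naturals.  There are also no built-in square
  roots or logarithms.
\<close>

datatype nexp =
    NConst nat
  | NCell string nexp
  | NAdd nexp nexp
  | NSub nexp nexp
  | NMul nexp nexp

datatype rexp =
    RNat nexp
  | RCell string nexp
  | RAdd rexp rexp
  | RSub rexp rexp
  | RMul rexp rexp
  | RDiv rexp rexp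

datatype bexp =
    NLess nexp nexp
  | RLess rexp rexp
  | BNot bexp
  | BAnd bexp bexp

datatype com =
    Skip
  | NAssign string nexp nexp
  | RAssign string nexp rexp
  | SampleUniform string nexp
  | SampleNormal string nexp
  | Seq com com
  | If bexp com com
  | While bexp com

text \<open>The counters \<open>upos\<close> and \<open>gpos\<close> are the numbers of uniform and of normal
  variates drawn so far.\<close>

record state =
  nmem :: "string \<Rightarrow> nat \<Rightarrow> nat"
  rmem :: "string \<Rightarrow> nat \<Rightarrow> real"
  upos :: nat
  gpos :: nat

text \<open>Subtraction of naturals is truncated, and division by zero yields zero.\<close>

primrec nval :: "state \<Rightarrow> nexp \<Rightarrow> nat" where
  "nval s (NConst k) = k"
| "nval s (NCell x e) = nmem s x (nval s e)"
| "nval s (NAdd e f) = nval s e + nval s f"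
| "nval s (NSub e f) = nval s e - nval s f"
| "nval s (NMul e f) = nval s e * nval s f"

primrec rval :: "state \<Rightarrow> rexp \<Rightarrow> real" where
  "rval s (RNat e) = real (nval s e)"
| "rval s (RCell x e) = rmem s x (nval s e)"
| "rval s (RAdd e f) = rval s e + rval s f"
| "rval s (RSub e f) = rval s e - rval s f"
| "rval s (RMul e f) = rval s e * rval s f"
| "rval s (RDiv e f) = rval s e / rval s f"

primrec bval :: "state \<Rightarrow> bexp \<Rightarrow> bool" where
  "bval s (NLess e f) \<longleftrightarrow> nval s e < nval s f"
| "bval s (RLess e f) \<longleftrightarrow> rval s e < rval s f"
| "bval s (BNot b) \<longleftrightarrow> \<not> bval s b"
| "bval s (BAnd b c) \<longleftrightarrow> bval s b \<and> bval s c"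

text \<open>Every constant, memory access, arithmetic or logical operation, comparison, assignment,
  sample and branch takes one unit of time.\<close>

primrec ncost :: "nexp \<Rightarrow> nat" where
  "ncost (NConst k) = 1"
| "ncost (NCell x e) = 1 + ncost e"
| "ncost (NAdd e f) = 1 + ncost e + ncost f"
| "ncost (NSub e f) = 1 + ncost e + ncost f"
| "ncost (NMul e f) = 1 + ncost e + ncost f"

primrec rcost :: "rexp \<Rightarrow> nat" where
  "rcost (RNat e) = 1 + ncost e"
| "rcost (RCell x e) = 1 + ncost e"
| "rcost (RAdd e f) = 1 + rcost e + rcost f"
| "rcost (RSub e f) = 1 + rcost e + rcost f"
| "rcost (RMul e f) = 1 + rcost e + rcost f"
| "rcost (RDiv e f) = 1 + rcost e + rcost f"

primrec bcost :: "bexp \<Rightarrow> nat" where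
  "bcost (NLess e f) = 1 + ncost e + ncost f"
| "bcost (RLess e f) = 1 + rcost e + rcost f"
| "bcost (BNot b) = 1 + bcost b"
| "bcost (BAnd b c) = 1 + bcost b + bcost c"

definition nstore :: "string \<Rightarrow> nat \<Rightarrow> nat \<Rightarrow> state \<Rightarrow> state" where
  "nstore x i k s = s\<lparr>nmem := (nmem s)(x := (nmem s x)(i := k))\<rparr>"

definition rstore :: "string \<Rightarrow> nat \<Rightarrow> real \<Rightarrow> state \<Rightarrow> state" where
  "rstore x i r s = s\<lparr>rmem := (rmem s)(x := (rmem s x)(i := r))\<rparr>"

text \<open>All randomness is fixed in advance: the \<open>k\<close>-th uniform and the \<open>k\<close>-th normal variate that
  are drawn are the \<open>k\<close>-th elements of the two sequences.\<close>

type_synonym tape = "(nat \<Rightarrow> real) \<times> (nat \<Rightarrow> real)"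

definition tape_space :: "tape measure" where
  "tape_space = (\<Pi>\<^sub>M k \<in> UNIV. uniform_measure lborel {0..1}) \<Otimes>\<^sub>M
                (\<Pi>\<^sub>M k \<in> UNIV. std_normal_distribution)"

text \<open>\<open>exec \<omega> c s t s'\<close>: on tape \<open>\<omega>\<close>, program \<open>c\<close> started in \<open>s\<close> halts after \<open>t\<close> steps
  in \<open>s'\<close>.\<close>

inductive exec :: "tape \<Rightarrow> com \<Rightarrow> state \<Rightarrow> nat \<Rightarrow> state \<Rightarrow> bool" for \<omega> where
  Skip: "exec \<omega> Skip s 1 s"
| NAssign: "exec \<omega> (NAssign x i e) s (1 + ncost i + ncost e) (nstore x (nval s i) (nval s e) s)"
| RAssign: "exec \<omega> (RAssign x i e) s (1 + ncost i + rcost e) (rstore x (nval s i) (rval s e) s)"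
| SampleUniform: "exec \<omega> (SampleUniform x i) s (1 + ncost i)
    ((rstore x (nval s i) (fst \<omega> (upos s)) s)\<lparr>upos := Suc (upos s)\<rparr>)"
| SampleNormal: "exec \<omega> (SampleNormal x i) s (1 + ncost i)
    ((rstore x (nval s i) (snd \<omega> (gpos s)) s)\<lparr>gpos := Suc (gpos s)\<rparr>)"
| Seq: "exec \<omega> c s t s' \<Longrightarrow> exec \<omega> c' s' t' s'' \<Longrightarrow> exec \<omega> (Seq c c') s (t + t') s''"
| IfTrue: "bval s b \<Longrightarrow> exec \<omega> c s t s' \<Longrightarrow> exec \<omega> (If b c c') s (1 + bcost b + t) s'"
| IfFalse: "\<not> bval s b \<Longrightarrow> exec \<omega> c' s t s' \<Longrightarrow> exec \<omega> (If b c c') s (1 + bcost b + t) s'"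
| WhileFalse: "\<not> bval s b \<Longrightarrow> exec \<omega> (While b c) s (1 + bcost b) s"
| WhileTrue: "bval s b \<Longrightarrow> exec \<omega> c s t s' \<Longrightarrow> exec \<omega> (While b c) s' t' s'' \<Longrightarrow>
    exec \<omega> (While b c) s (1 + bcost b + t + t') s''"

inductive_cases exec_elims:
  "exec \<omega> Skip s t s'"
  "exec \<omega> (NAssign x i e) s t s'"
  "exec \<omega> (RAssign x i r) s t s'"
  "exec \<omega> (SampleUniform x i) s t s'"
  "exec \<omega> (SampleNormal x i) s t s'"
  "exec \<omega> (Seq c c') s t s'"
  "exec \<omega> (If b c c') s t s'"

inductive_cases exec_WhileE: "exec \<omega> (While b c) s t s'"

lemma exec_deterministic:
  "exec \<omega> c s t s' \<Longrightarrow> exec \<omega> c s u s'' \<Longrightarrow> u = t \<and> s'' = s'"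
proof (induction arbitrary: u s'' rule: exec.induct)
  case (Seq c s t s' c' t' s1)
  from Seq.prems obtain r v r' where "exec \<omega> c s r v" "exec \<omega> c' v r' s''" "u = r + r'"
    by (auto elim: exec_elims(6))
  with Seq.IH show ?case by metis
next
  case (IfTrue s b c t s' c')
  from IfTrue.prems IfTrue.hyps(1) obtain r where "exec \<omega> c s r s''" "u = 1 + bcost b + r"
    by (auto elim: exec_elims(7))
  with IfTrue.IH show ?case by metis
next
  case (IfFalse s b c' t s' c)
  from IfFalse.prems IfFalse.hyps(1) obtain r where "exec \<omega> c' s r s''" "u = 1 + bcost b + r"
    by (auto elim: exec_elims(7))
  with IfFalse.IH show ?case by metis
next
  case (WhileFalse s b c)
  from WhileFalse.prems WhileFalse.hyps show ?case by (auto elim: exec_WhileE)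
next
  case (WhileTrue s b c t s' t' s1)
  from WhileTrue.prems WhileTrue.hyps(1) obtain r v r'
    where "exec \<omega> c s r v" "exec \<omega> (While b c) v r' s''" "u = 1 + bcost b + r + r'"
    by (auto elim: exec_WhileE)
  with WhileTrue.IH show ?case by metis
qed (auto elim: exec_elims)

lemma prob_space_tape_space: "prob_space tape_space"
proof -
  interpret U: product_prob_space "\<lambda>_. uniform_measure lborel {0..1::real}" "UNIV :: nat set"
    by (intro product_prob_spaceI prob_space_uniform_measure) auto
  interpret N: product_prob_space "\<lambda>_. std_normal_distribution" "UNIV :: nat set"
    by (intro product_prob_spaceI prob_space_normal_density) auto
  interpret pair_prob_space "\<Pi>\<^sub>M k \<in> (UNIV :: nat set). uniform_measure lborel {0..1::real}"
    "\<Pi>\<^sub>M k \<in> (UNIV :: nat set). std_normal_distribution" ..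
  show ?thesis
    unfolding tape_space_def by (rule prob_space_axioms)
qed


section \<open>Input and output\<close>

definition init_state ::
    "nat \<Rightarrow> nat \<Rightarrow> (nat \<times> nat \<times> real) list \<Rightarrow> real \<Rightarrow> real \<Rightarrow> state" where
  "init_state n d es \<epsilon> \<delta> =
     \<lparr> nmem = (\<lambda>_ _. 0)
         (''n'' := (\<lambda>_. 0)(0 := n),
          ''d'' := (\<lambda>_. 0)(0 := d),
          ''nnz'' := (\<lambda>_. 0)(0 := length es),
          ''row'' := (\<lambda>k. if k < length es then fst (es ! k) else 0),
          ''col'' := (\<lambda>k. if k < length es then fst (snd (es ! k)) else 0)),
       rmem = (\<lambda>_ _. 0)
         (''val'' := (\<lambda>k. if k < length es then snd (snd (es ! k)) else 0),
          ''eps'' := (\<lambda>_. 0)(0 := \<epsilon>),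
          ''delta'' := (\<lambda>_. 0)(0 := \<delta>)),
       upos = 0, gpos = 0 \<rparr>"

definition estimate :: "state \<Rightarrow> real" where
  "estimate s = rmem s ''out'' 0"

definition tau :: "nat \<Rightarrow> nat \<Rightarrow> real \<Rightarrow> real \<Rightarrow> real" where
  "tau m d \<epsilon> \<delta> =
     min (real m / \<epsilon> * ln (real d / (\<epsilon> * \<delta>)))
         ((real d)\<^sup>2 / \<epsilon> ^ 3 * (ln (real d / (\<epsilon> * \<delta>)))\<^sup>2)"

end

(*
The rows of A are sampled independently, row a_i with probability q_i = min 1 (r |a_i|^2 / |A|_F^2),
and the power method is run from a Gaussian vector x on S = sum_i a_i a_i^T / q_i over the sampled
rows.  With r of order d l / eps^2, where l is log2 (d / (eps delta)) up to rounding, S keeps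
O(d^2 l / eps^2) entries, and O(l / eps) iterations suffice for the ratio
x^T S^(2K) x / x^T S^(2K-1) x to approximate the norm of S from below.  The norm of S is at least
(1 - eps) |A|^2 by a scalar Chernoff bound in one nearly optimal direction.  The upper bound needs
no matrix exponentials: for c = |A|_F^2 / r one has

  E tr (S + b)^(p+1) <= b E tr (S + b)^p + |A|^2 E tr (S + b + c)^p,

because u^T (P + w u u^T)^p u <= u^T (P + w |u|^2)^p u for positive semidefinite P.  Iterating gives
E tr S^p <= d |A|^(2p) exp (p^2 c / |A|^2), and Markov's inequality with p of order l / eps
concludes.
*)
theory Submission
  imports Defs
begin


section \<open>Powers of Gram operators\<close>

definition ip :: "nat \<Rightarrow> (nat \<Rightarrow> real) \<Rightarrow> (nat \<Rightarrow> real) \<Rightarrow> real" where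
  "ip d x y = (\<Sum>j<d. x j * y j)"

lemma ip_commute: "ip d x y = ip d y x"
  by (simp add: ip_def mult.commute)

lemma ip_add_right: "ip d x (\<lambda>j. y j + z j) = ip d x y + ip d x z"
  by (simp add: ip_def distrib_left sum.distrib)

lemma ip_scale_right: "ip d x (\<lambda>j. c * y j) = c * ip d x y"
  by (simp add: ip_def sum_distrib_left mult.left_commute)

lemma ip_add_left: "ip d (\<lambda>j. y j + z j) x = ip d y x + ip d z x"
  by (simp add: ip_commute[of d _ x] ip_add_right)

lemma ip_scale_left: "ip d (\<lambda>j. c * y j) x = c * ip d y x"
  by (simp add: ip_commute[of d _ x] ip_scale_right)

lemma ip_sum_right: "ip d x (\<lambda>j. \<Sum>i\<in>T. f i j) = (\<Sum>i\<in>T. ip d x (f i))"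
  unfolding ip_def by (simp add: sum_distrib_left) (rule sum.swap)

lemma ip_nonneg: "0 \<le> ip d x x"
  by (simp add: ip_def sum_nonneg)

definition unit_fun :: "nat \<Rightarrow> nat \<Rightarrow> real" where
  "unit_fun j = (\<lambda>k. if k = j then 1 else 0)"

lemma ip_unit_right: "j < d \<Longrightarrow> ip d x (unit_fun j) = x j"
  by (simp add: ip_def unit_fun_def if_distrib cong: if_cong)

lemma ip_unit_left: "j < d \<Longrightarrow> ip d (unit_fun j) x = x j"
  by (simp add: ip_commute[of d "unit_fun j"] ip_unit_right)

definition psd_op :: "nat \<Rightarrow> ((nat \<Rightarrow> real) \<Rightarrow> nat \<Rightarrow> real) \<Rightarrow> bool" where
  "psd_op d P \<longleftrightarrow>
     (\<forall>x y. P (\<lambda>j. x j + y j) = (\<lambda>j. P x j + P y j)) \<and>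
     (\<forall>c x. P (\<lambda>j. c * x j) = (\<lambda>j. c * P x j)) \<and>
     (\<forall>x y. ip d (P x) y = ip d x (P y)) \<and>
     (\<forall>x. 0 \<le> ip d x (P x))"

lemma psd_op_id: "psd_op d (\<lambda>x. x)"
  by (simp add: psd_op_def ip_nonneg)

lemma psd_op_add: "psd_op d P \<Longrightarrow> P (\<lambda>j. x j + y j) = (\<lambda>j. P x j + P y j)"
  and psd_op_scale: "psd_op d P \<Longrightarrow> P (\<lambda>j. c * x j) = (\<lambda>j. c * P x j)"
  and psd_op_sym: "psd_op d P \<Longrightarrow> ip d (P x) y = ip d x (P y)"
  and psd_op_nonneg: "psd_op d P \<Longrightarrow> 0 \<le> ip d x (P x)"
  by (auto simp: psd_op_def)

lemma psd_op_Cauchy_Schwarz: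
  assumes P: "psd_op d P"
  shows "(ip d x (P y))\<^sup>2 \<le> ip d x (P x) * ip d y (P y)"
proof -
  let ?a = "ip d y (P y)" and ?b = "ip d x (P y)" and ?c = "ip d x (P x)"
  have sym: "ip d y (P x) = ?b"
    using psd_op_sym[OF P, of y x] by (simp add: ip_commute)
  have q: "0 \<le> ?c + 2 * t * ?b + t\<^sup>2 * ?a" for t
  proof -
    have "0 \<le> ip d (\<lambda>j. x j + t * y j) (P (\<lambda>j. x j + t * y j))"
      by (rule psd_op_nonneg[OF P])
    also have "\<dots> = ?c + 2 * t * ?b + t\<^sup>2 * ?a"
      by (simp add: psd_op_add[OF P] psd_op_scale[OF P] ip_add_left ip_add_right ip_scale_left
          ip_scale_right sym power2_eq_square algebra_simps)
    finally show ?thesis .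
  qed
  have a: "0 \<le> ?a" and c: "0 \<le> ?c"
    by (rule psd_op_nonneg[OF P])+
  show ?thesis
  proof (cases "?a = 0")
    case True
    have "?b = 0"
    proof (rule ccontr)
      assume b: "?b \<noteq> 0"
      have "0 \<le> ?c + 2 * (- (?c + 1) / (2 * ?b)) * ?b"
        using q[of "- (?c + 1) / (2 * ?b)"] True by simp
      also have "\<dots> = - 1" using b by (simp add: field_simps)
      finally show False by simp
    qed
    then show ?thesis using True by simp
  next
    case False
    have "0 \<le> ?a * (?c + 2 * (- ?b / ?a) * ?b + (- ?b / ?a)\<^sup>2 * ?a)"
      by (rule mult_nonneg_nonneg[OF a q])
    also have "\<dots> = ?c * ?a - ?b\<^sup>2"
      using False by (simp add: field_simps power2_eq_square)
    finally show ?thesis by simp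
  qed
qed

lemmas ip_Cauchy_Schwarz = psd_op_Cauchy_Schwarz[OF psd_op_id]

lemma funpow_psd_add:
  "psd_op d P \<Longrightarrow> (P ^^ k) (\<lambda>j. x j + y j) = (\<lambda>j. (P ^^ k) x j + (P ^^ k) y j)"
  by (induction k) (simp_all add: psd_op_add)

lemma funpow_psd_scale:
  "psd_op d P \<Longrightarrow> (P ^^ k) (\<lambda>j. c * x j) = (\<lambda>j. c * (P ^^ k) x j)"
  by (induction k) (simp_all add: psd_op_scale)

lemma funpow_psd_sym:
  "psd_op d P \<Longrightarrow> ip d ((P ^^ k) x) y = ip d x ((P ^^ k) y)"
  by (induction k arbitrary: x y) (simp_all add: psd_op_sym funpow_swap1)

definition moment :: "nat \<Rightarrow> ((nat \<Rightarrow> real) \<Rightarrow> nat \<Rightarrow> real) \<Rightarrow> (nat \<Rightarrow> real) \<Rightarrow> nat \<Rightarrow> real" where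
  "moment d P x k = ip d x ((P ^^ k) x)"

lemma moment_0: "moment d P x 0 = ip d x x"
  and moment_1: "moment d P x 1 = ip d x (P x)"
  by (simp_all add: moment_def)

lemma ip_funpow_funpow:
  assumes "psd_op d P"
  shows "ip d ((P ^^ i) x) ((P ^^ j) y) = ip d x ((P ^^ (i + j)) y)"
  using assms by (simp add: funpow_psd_sym funpow_add)

lemma moment_shift:
  assumes "psd_op d P"
  shows "moment d P ((P ^^ h) x) k = moment d P x (k + 2 * h)"
proof -
  have "moment d P ((P ^^ h) x) k = ip d ((P ^^ h) x) ((P ^^ (k + h)) x)"
    by (simp add: moment_def funpow_add)
  then show ?thesis
    by (simp only: ip_funpow_funpow[OF assms] moment_def) (simp add: mult_2 add.commute add.left_commute)
qed

lemma moment_parity: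
  assumes "psd_op d P"
  obtains h where "moment d P x k = ip d ((P ^^ h) x) ((P ^^ h) x)"
  | h where "moment d P x k = ip d ((P ^^ h) x) (P ((P ^^ h) x))"
proof (cases "even k")
  case True
  then obtain h where "k = 0 + 2 * h" by auto
  then have "moment d P x k = ip d ((P ^^ h) x) ((P ^^ h) x)"
    using moment_shift[OF assms, of h x 0] by (simp add: moment_0)
  then show thesis by (rule that(1))
next
  case False
  then obtain h where "k = 1 + 2 * h" by (auto elim: oddE)
  then have "moment d P x k = ip d ((P ^^ h) x) (P ((P ^^ h) x))"
    using moment_shift[OF assms, of h x 1] by (simp add: moment_1[simplified])
  then show thesis by (rule that(2))
qed

lemma moment_nonneg: "psd_op d P \<Longrightarrow> 0 \<le> moment d P x k"
  by (rule moment_parity[of d P x k]) (simp_all add: ip_nonneg psd_op_nonneg)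

lemma moment_log_convex:
  assumes P: "psd_op d P"
  shows "(moment d P x (Suc k))\<^sup>2 \<le> moment d P x k * moment d P x (Suc (Suc k))"
proof -
  have *: "(moment d P y (Suc 0))\<^sup>2 \<le> moment d P y 0 * moment d P y 2" for y
    using ip_Cauchy_Schwarz[of d y "P y"] psd_op_sym[OF P, of y "P y"]
    by (simp add: moment_def numeral_2_eq_2)
  have **: "(moment d P y 2)\<^sup>2 \<le> moment d P y (Suc 0) * moment d P y 3" for y
    using psd_op_Cauchy_Schwarz[OF P, of y "P y"] psd_op_sym[OF P, of y "P (P y)"]
    by (simp add: moment_def numeral_2_eq_2 numeral_3_eq_3)
  show ?thesis
  proof (cases "even k")
    case True
    then obtain h where "k = 2 * h" by auto
    then show ?thesis
      using *[of "(P ^^ h) x"] by (simp add: moment_shift[OF P])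
  next
    case False
    then obtain h where "k = Suc (2 * h)" by (auto elim: oddE)
    then show ?thesis
      using **[of "(P ^^ h) x"] by (simp add: moment_shift[OF P] numeral_3_eq_3)
  qed
qed

locale log_convex_seq =
  fixes m :: "nat \<Rightarrow> real"
  assumes nonneg: "0 \<le> m k"
    and log_convex: "(m (Suc k))\<^sup>2 \<le> m k * m (Suc (Suc k))"
begin

lemma ratio_mono: "i \<le> j \<Longrightarrow> m (Suc i) * m j \<le> m i * m (Suc j)"
proof (induction j rule: dec_induct)
  case (step j)
  show ?case
  proof (cases "m j = 0")
    case True
    then have "m (Suc j) = 0" using log_convex[of j] by simp
    then show ?thesis by (simp add: nonneg)
  next
    case False
    have "m j * (m (Suc i) * m (Suc j)) = (m (Suc i) * m j) * m (Suc j)" by simp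
    also have "\<dots> \<le> (m i * m (Suc j)) * m (Suc j)"
      by (rule mult_right_mono[OF step.IH nonneg])
    also have "\<dots> = m i * (m (Suc j))\<^sup>2" by (simp add: power2_eq_square)
    also have "\<dots> \<le> m i * (m j * m (Suc (Suc j)))"
      by (rule mult_left_mono[OF log_convex nonneg])
    also have "\<dots> = m j * (m i * m (Suc (Suc j)))" by simp
    finally show ?thesis
      using False nonneg[of j] by (simp add: mult_le_cancel_left)
  qed
qed simp

lemma supermult: "m i * m j \<le> m 0 * m (i + j)"
proof -
  have *: "m i * m j \<le> m 0 * m (i + j)" if "i \<le> j" for i j
    using that
  proof (induction i arbitrary: j)
    case (Suc i)
    then show ?case using ratio_mono[of i j] Suc.IH[of "Suc j"] by simp
  qed simp
  show ?thesis
    using *[of i j] *[of j i] by (cases "i \<le> j") (simp_all add: ac_simps)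
qed

lemma power_le: "m 0 = 1 \<Longrightarrow> m 1 ^ k \<le> m k"
proof (induction k)
  case (Suc k)
  have "m 1 ^ Suc k \<le> m 1 * m k"
    using mult_left_mono[OF Suc.IH nonneg[of 1]] Suc.prems by simp
  also have "\<dots> \<le> m (Suc k)"
    using supermult[of 1 k] Suc.prems by simp
  finally show ?case .
qed simp

lemma le_ratio_power:
  assumes "m k > 0"
  shows "m (Suc k) \<le> m 0 * (m (Suc k) / m k) ^ Suc k"
proof -
  have "m j \<le> m 0 * (m (Suc k) / m k) ^ j" if "j \<le> Suc k" for j
    using that
  proof (induction j)
    case (Suc j)
    have "m (Suc j) \<le> m j * (m (Suc k) / m k)"
      using ratio_mono[of j k] Suc.prems assms by (simp add: field_simps)
    also have "\<dots> \<le> m 0 * (m (Suc k) / m k) ^ j * (m (Suc k) / m k)"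
      using Suc by (intro mult_right_mono) (simp_all add: nonneg)
    finally show ?case by (simp add: ac_simps)
  qed simp
  from this[of "Suc k"] show ?thesis by (simp del: power_Suc)
qed

text \<open>The scalar form of comparing the powers of \<open>P + w u u\<^sup>T\<close> and of \<open>P + c\<close> in the direction \<open>u\<close>,
  where \<open>m\<close> is the sequence of moments of \<open>P\<close> at \<open>u\<close>.\<close>

lemma shift_recursion:
  fixes G :: "nat \<Rightarrow> nat \<Rightarrow> real"
  assumes G0: "\<And>j. G 0 j = m j" and GS: "\<And>q j. G (Suc q) j = G q (Suc j) + c * G q j"
    and c: "0 \<le> c"
  shows "m (q + j) \<le> G q j" and "G q i * m j \<le> m 0 * G q (i + j)"
proof -
  have *: "m (q + j) \<le> G q j" for q j
  proof (induction q arbitrary: j)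
    case (Suc q)
    have "0 \<le> c * G q j"
      using c Suc.IH[of j] nonneg[of "q + j"] by (intro mult_nonneg_nonneg) auto
    then show ?case using Suc.IH[of "Suc j"] by (simp add: GS)
  qed (simp add: G0)
  then show "m (q + j) \<le> G q j" .
  show "G q i * m j \<le> m 0 * G q (i + j)"
  proof (induction q arbitrary: i)
    case (Suc q)
    have "G (Suc q) i * m j = G q (Suc i) * m j + c * (G q i * m j)"
      by (simp add: GS algebra_simps)
    also have "\<dots> \<le> m 0 * G q (Suc i + j) + c * (m 0 * G q (i + j))"
      by (intro add_mono mult_left_mono Suc.IH c)
    finally show ?case by (simp add: GS algebra_simps)
  qed (simp add: G0 supermult)
qed

lemma rank_one_recursion:
  fixes F G :: "nat \<Rightarrow> nat \<Rightarrow> real"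
  assumes F0: "\<And>j. F 0 j = m j" and FS: "\<And>q j. F (Suc q) j = F q (Suc j) + w * m j * F q 0"
    and w: "0 \<le> w"
  shows "m (q + j) \<le> F q j"
    and "(\<And>j. G 0 j = m j) \<Longrightarrow> (\<And>q j. G (Suc q) j = G q (Suc j) + c * G q j) \<Longrightarrow>
      w * m 0 \<le> c \<Longrightarrow> F q j \<le> G q j"
proof -
  have *: "m (q + j) \<le> F q j" for q j
  proof (induction q arbitrary: j)
    case (Suc q)
    have "0 \<le> w * m j * F q 0"
      using w nonneg[of j] order_trans[OF nonneg Suc.IH[of 0]] by simp
    then show ?case using Suc.IH[of "Suc j"] by (simp add: FS)
  qed (simp add: F0)
  then show "m (q + j) \<le> F q j" .
  assume G0: "\<And>j. G 0 j = m j" and GS: "\<And>q j. G (Suc q) j = G q (Suc j) + c * G q j"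
    and c: "w * m 0 \<le> c"
  have c0: "0 \<le> c" using c w nonneg[of 0] by (meson mult_nonneg_nonneg order_trans)
  note shift = shift_recursion[of G c, OF G0 GS c0]
  show "F q j \<le> G q j"
  proof (induction q arbitrary: j)
    case (Suc q)
    have G_nonneg: "0 \<le> G q j" using shift(1)[of q j] nonneg[of "q + j"] by simp
    have "F (Suc q) j \<le> G q (Suc j) + w * m j * G q 0"
      using Suc.IH[of "Suc j"] mult_left_mono[OF Suc.IH[of 0], of "w * m j"] w nonneg[of j]
      by (simp add: FS)
    also have "w * m j * G q 0 \<le> w * (m 0 * G q j)"
      using mult_left_mono[OF shift(2)[of q 0 j] w] by (simp add: ac_simps)
    also have "w * (m 0 * G q j) \<le> c * G q j"
      using mult_right_mono[OF c G_nonneg] by (simp add: ac_simps)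
    finally show ?case by (simp add: GS)
  qed (simp add: F0 G0)
qed

end

lemma log_convex_seq_moment: "psd_op d P \<Longrightarrow> log_convex_seq (moment d P x)"
  by unfold_locales (auto intro: moment_nonneg moment_log_convex)

lemma moment_ratio_le:
  assumes P: "psd_op d P" and le: "\<And>x. ip d x (P x) \<le> b * ip d x x"
  shows "moment d P x (Suc (2 * h + 1)) \<le> b * moment d P x (2 * h + 1)"
proof -
  let ?y = "(P ^^ h) x"
  let ?s = "ip d (P ?y) (P ?y)" and ?t = "ip d ?y (P ?y)"
  have "?s\<^sup>2 \<le> ?t * ip d (P ?y) (P (P ?y))"
    using psd_op_Cauchy_Schwarz[OF P, of ?y "P ?y"] by (simp add: psd_op_sym[OF P])
  also have "\<dots> \<le> ?t * (b * ?s)"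
    by (rule mult_left_mono[OF le psd_op_nonneg[OF P]])
  finally have *: "?s * ?s \<le> (b * ?t) * ?s" by (simp add: power2_eq_square ac_simps)
  have "?s \<le> b * ?t"
  proof (cases "?s = 0")
    case True
    show ?thesis
    proof (cases "?t = 0")
      case False
      have "0 \<le> b * ip d ?y ?y"
        using order_trans[OF psd_op_nonneg[OF P] le] .
      have "?t\<^sup>2 \<le> ip d ?y ?y * ?s" by (rule ip_Cauchy_Schwarz)
      with True False show ?thesis by simp
    qed (simp add: True)
  next
    case False
    then have "?s > 0" using ip_nonneg[of d "P ?y"] by simp
    with * show ?thesis by (simp add: mult_le_cancel_right)
  qed
  moreover have "?s = moment d P x (Suc (2 * h + 1))"
    using moment_shift[OF P, of h x 2] by (simp add: moment_def numeral_2_eq_2 psd_op_sym[OF P])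
  moreover have "?t = moment d P x (2 * h + 1)"
    using moment_shift[OF P, of h x 1] by (simp add: moment_def)
  ultimately show ?thesis by simp
qed

definition gram :: "nat \<Rightarrow> 'i set \<Rightarrow> ('i \<Rightarrow> real) \<Rightarrow> ('i \<Rightarrow> nat \<Rightarrow> real) \<Rightarrow> real \<Rightarrow> (nat \<Rightarrow> real) \<Rightarrow> nat \<Rightarrow> real"
  where "gram d T w a b x = (\<lambda>j. b * x j + (\<Sum>i\<in>T. w i * ip d (a i) x * a i j))"

lemma ip_gram: "ip d y (gram d T w a b x) = b * ip d y x + (\<Sum>i\<in>T. w i * ip d (a i) x * ip d (a i) y)"
  unfolding gram_def
  by (simp add: ip_add_right ip_scale_right ip_sum_right ip_commute[of d y])

lemma psd_op_gram:
  assumes "\<And>i. i \<in> T \<Longrightarrow> 0 \<le> w i" and "0 \<le> b"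
  shows "psd_op d (gram d T w a b)"
  unfolding psd_op_def
proof (intro conjI allI)
  fix x y :: "nat \<Rightarrow> real" and c :: real
  show "gram d T w a b (\<lambda>j. x j + y j) = (\<lambda>j. gram d T w a b x j + gram d T w a b y j)"
    by (simp add: gram_def ip_add_right algebra_simps sum.distrib)
  show "gram d T w a b (\<lambda>j. c * x j) = (\<lambda>j. c * gram d T w a b x j)"
    by (simp add: gram_def ip_scale_right algebra_simps sum_distrib_left)
  show "ip d (gram d T w a b x) y = ip d x (gram d T w a b y)"
    by (simp add: ip_commute[of d "gram d T w a b x"] ip_gram ip_commute[of d y x] ac_simps)
  show "0 \<le> ip d x (gram d T w a b x)"
    using assms by (simp add: ip_gram ip_nonneg sum_nonneg mult.assoc)
qed

lemma gram_shift: "gram d T w a (b + c) x = (\<lambda>j. gram d T w a b x j + c * x j)"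
  by (simp add: gram_def algebra_simps)

lemma gram_insert:
  assumes "finite T" "i \<notin> T"
  shows "gram d (insert i T) w a b x = (\<lambda>j. gram d T w a b x j + w i * ip d (a i) x * a i j)"
  using assms by (simp add: gram_def algebra_simps)

lemma shift_moments:
  fixes T w a b c d u
  defines "P \<equiv> gram d T w a b" and "Q \<equiv> gram d T w a (b + c)"
  assumes w: "\<And>i. i \<in> T \<Longrightarrow> 0 \<le> w i" and b: "0 \<le> b" and c: "0 \<le> c"
  shows "ip d u ((Q ^^ Suc q) ((P ^^ j) u)) = ip d u ((Q ^^ q) ((P ^^ Suc j) u)) + c * ip d u ((Q ^^ q) ((P ^^ j) u))"
proof -
  have Q: "psd_op d Q" unfolding Q_def using w b c by (intro psd_op_gram) auto
  have "Q ((P ^^ j) u) = (\<lambda>l. (P ^^ Suc j) u l + c * (P ^^ j) u l)"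
    by (simp add: P_def Q_def gram_shift)
  then have "(Q ^^ Suc q) ((P ^^ j) u) = (Q ^^ q) (\<lambda>l. (P ^^ Suc j) u l + c * (P ^^ j) u l)"
    by (simp add: funpow_Suc_right del: funpow.simps)
  then show ?thesis
    by (simp add: funpow_psd_add[OF Q] funpow_psd_scale[OF Q] ip_add_right ip_scale_right
        del: funpow.simps)
qed

lemma gram_power_mono_shift:
  assumes w: "\<And>i. i \<in> T \<Longrightarrow> 0 \<le> w i" and b: "0 \<le> b" and c: "0 \<le> c"
  shows "ip d u ((gram d T w a b ^^ q) u) \<le> ip d u ((gram d T w a (b + c) ^^ q) u)"
proof -
  interpret log_convex_seq "moment d (gram d T w a b) u"
    using w b by (intro log_convex_seq_moment psd_op_gram)
  have "moment d (gram d T w a b) u (q + 0) \<le> ip d u ((gram d T w a (b + c) ^^ q) ((gram d T w a b ^^ 0) u))"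
    by (rule shift_recursion(1)[where G = "\<lambda>q j. ip d u ((gram d T w a (b + c) ^^ q) ((gram d T w a b ^^ j) u))", OF _ shift_moments[OF w b c] c])
      (simp_all add: moment_def)
  then show ?thesis by (simp add: moment_def)
qed

lemma gram_power_insert:
  assumes T: "finite T" "i \<notin> T" and w: "\<And>k. k \<in> insert i T \<Longrightarrow> 0 \<le> w k" and b: "0 \<le> b"
  shows "ip d (a i) ((gram d T w a b ^^ q) (a i)) \<le> ip d (a i) ((gram d (insert i T) w a b ^^ q) (a i))"
    and "w i * ip d (a i) (a i) \<le> c \<Longrightarrow>
      ip d (a i) ((gram d (insert i T) w a b ^^ q) (a i)) \<le> ip d (a i) ((gram d T w a (b + c) ^^ q) (a i))"
proof -
  let ?P = "gram d T w a b" and ?D = "gram d (insert i T) w a b" and ?Q = "gram d T w a (b + c)"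
  let ?u = "a i"
  define F where "F q j = ip d ?u ((?D ^^ q) ((?P ^^ j) ?u))" for q j
  have D: "psd_op d ?D" using w b by (intro psd_op_gram) auto
  interpret log_convex_seq "moment d ?P ?u"
    using w b by (intro log_convex_seq_moment psd_op_gram) auto
  have F0: "F 0 j = moment d ?P ?u j" for j
    by (simp add: F_def moment_def)
  have FS: "F (Suc q) j = F q (Suc j) + w i * moment d ?P ?u j * F q 0" for q j
  proof -
    have "?D ((?P ^^ j) ?u) = (\<lambda>l. (?P ^^ Suc j) ?u l + (w i * moment d ?P ?u j) * ?u l)"
      by (simp add: gram_insert[OF T] moment_def)
    then have "(?D ^^ Suc q) ((?P ^^ j) ?u)
        = (?D ^^ q) (\<lambda>l. (?P ^^ Suc j) ?u l + (w i * moment d ?P ?u j) * ?u l)"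
      by (simp add: funpow_Suc_right del: funpow.simps)
    then show ?thesis
      by (simp add: F_def funpow_psd_add[OF D] funpow_psd_scale[OF D] ip_add_right ip_scale_right
          del: funpow.simps(2))
  qed
  have wi: "0 \<le> w i" using w by simp
  have *: "F q 0 = ip d ?u ((?D ^^ q) ?u)" by (simp add: F_def)
  show "ip d ?u ((?P ^^ q) ?u) \<le> ip d ?u ((?D ^^ q) ?u)"
    using rank_one_recursion(1)[where F = F, OF F0 FS wi, of q 0]
    by (simp add: F_def moment_def)
  assume c: "w i * ip d ?u ?u \<le> c"
  then have c0: "0 \<le> c" using wi ip_nonneg[of d ?u] by (meson mult_nonneg_nonneg order_trans)
  have "F q 0 \<le> ip d ?u ((?Q ^^ q) ((?P ^^ 0) ?u))"
  proof (rule rank_one_recursion(2)[where F = F and G = "\<lambda>q j. ip d ?u ((?Q ^^ q) ((?P ^^ j) ?u))", OF F0 FS wi])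
    show "ip d ?u ((?Q ^^ Suc q) ((?P ^^ j) ?u))
        = ip d ?u ((?Q ^^ q) ((?P ^^ Suc j) ?u)) + c * ip d ?u ((?Q ^^ q) ((?P ^^ j) ?u))" for q j
      using w b c0 by (intro shift_moments) auto
  qed (use c in \<open>simp_all add: moment_def\<close>)
  then show "ip d ?u ((?D ^^ q) ?u) \<le> ip d ?u ((?Q ^^ q) ?u)"
    by (simp add: *)
qed

definition tr :: "nat \<Rightarrow> ((nat \<Rightarrow> real) \<Rightarrow> nat \<Rightarrow> real) \<Rightarrow> real" where
  "tr d P = (\<Sum>j<d. P (unit_fun j) j)"

lemma tr_gram_Suc:
  assumes w: "\<And>i. i \<in> T \<Longrightarrow> 0 \<le> w i" and b: "0 \<le> b"
  shows "tr d (gram d T w a b ^^ Suc p) =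
    b * tr d (gram d T w a b ^^ p) + (\<Sum>i\<in>T. w i * ip d (a i) ((gram d T w a b ^^ p) (a i)))"
proof -
  let ?G = "gram d T w a b"
  have G: "psd_op d ?G" using w b by (rule psd_op_gram)
  have "ip d (a i) ((?G ^^ p) (unit_fun j)) = (?G ^^ p) (a i) j" if "j < d" for i j
    using that by (simp add: funpow_psd_sym[OF G, symmetric] ip_unit_right)
  then have "tr d (?G ^^ Suc p) = b * tr d (?G ^^ p) + (\<Sum>j<d. \<Sum>i\<in>T. w i * ((?G ^^ p) (a i) j * a i j))"
    by (simp add: tr_def gram_def[of d T w a b "(?G ^^ p) _"] sum.distrib sum_distrib_left mult.assoc)
  also have "(\<Sum>j<d. \<Sum>i\<in>T. w i * ((?G ^^ p) (a i) j * a i j)) = (\<Sum>i\<in>T. w i * ip d (a i) ((?G ^^ p) (a i)))"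
    by (subst sum.swap) (simp add: ip_def sum_distrib_left mult.commute)
  finally show ?thesis .
qed

lemma sum_squares_unit: "(\<Sum>j<d. (ip d x (unit_fun j))\<^sup>2) = ip d x x"
  by (simp add: ip_unit_right ip_def[of d x x] power2_eq_square)

lemma sum_ip_power_le_tr:
  assumes w: "\<And>i. i \<in> T \<Longrightarrow> 0 \<le> w i" and b: "0 \<le> b"
    and le: "\<And>x. (\<Sum>i\<in>I. (ip d (\<alpha> i) x)\<^sup>2) \<le> \<kappa> * ip d x x"
  shows "(\<Sum>i\<in>I. ip d (\<alpha> i) ((gram d T w a b ^^ p) (\<alpha> i))) \<le> \<kappa> * tr d (gram d T w a b ^^ p)"
proof -
  let ?G = "gram d T w a b"
  have G: "psd_op d ?G" using w b by (rule psd_op_gram)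
  have dbl: "ip d x ((?G ^^ (2 * h)) x) = ip d ((?G ^^ h) x) ((?G ^^ h) x)" for h x
    by (simp add: ip_funpow_funpow[OF G] mult_2)
  have tr_dbl: "tr d (?G ^^ (2 * h)) = (\<Sum>j<d. ip d ((?G ^^ h) (unit_fun j)) ((?G ^^ h) (unit_fun j)))" for h
    by (simp add: tr_def ip_unit_left dbl[symmetric])
  have even: "(\<Sum>i\<in>I. ip d (\<alpha> i) ((?G ^^ (2 * h)) (\<alpha> i))) \<le> \<kappa> * tr d (?G ^^ (2 * h))" for h
  proof -
    have "(\<Sum>i\<in>I. ip d (\<alpha> i) ((?G ^^ (2 * h)) (\<alpha> i))) = (\<Sum>i\<in>I. \<Sum>j<d. (ip d ((?G ^^ h) (\<alpha> i)) (unit_fun j))\<^sup>2)"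
      by (simp only: dbl sum_squares_unit)
    also have "\<dots> = (\<Sum>j<d. \<Sum>i\<in>I. (ip d (\<alpha> i) ((?G ^^ h) (unit_fun j)))\<^sup>2)"
      by (subst sum.swap) (simp add: funpow_psd_sym[OF G])
    also have "\<dots> \<le> (\<Sum>j<d. \<kappa> * ip d ((?G ^^ h) (unit_fun j)) ((?G ^^ h) (unit_fun j)))"
      by (rule sum_mono) (rule le)
    finally show ?thesis by (simp add: tr_dbl sum_distrib_left)
  qed
  show ?thesis
  proof (cases "even p")
    case True
    then obtain h where "p = 2 * h" by auto
    then show ?thesis using even by simp
  next
    case False
    then obtain h where p: "p = Suc (2 * h)" by (auto elim: oddE)
    have "ip d x ((?G ^^ p) x) = b * ip d x ((?G ^^ (2 * h)) x) + (\<Sum>l\<in>T. w l * (ip d ((?G ^^ h) (a l)) x)\<^sup>2)" for x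
    proof -
      have "ip d x ((?G ^^ p) x) = ip d ((?G ^^ h) x) (?G ((?G ^^ h) x))"
        using ip_funpow_funpow[OF G, of h x "Suc h" x] p by (simp add: mult_2 del: funpow.simps(2)) simp
      then show ?thesis
        by (simp add: ip_gram dbl funpow_psd_sym[OF G] power2_eq_square mult.assoc)
    qed
    then have "(\<Sum>i\<in>I. ip d (\<alpha> i) ((?G ^^ p) (\<alpha> i))) =
        b * (\<Sum>i\<in>I. ip d (\<alpha> i) ((?G ^^ (2 * h)) (\<alpha> i))) +
        (\<Sum>i\<in>I. \<Sum>l\<in>T. w l * (ip d ((?G ^^ h) (a l)) (\<alpha> i))\<^sup>2)"
      by (simp add: sum.distrib sum_distrib_left)
    also have "(\<Sum>i\<in>I. \<Sum>l\<in>T. w l * (ip d ((?G ^^ h) (a l)) (\<alpha> i))\<^sup>2) =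
        (\<Sum>l\<in>T. w l * (\<Sum>i\<in>I. (ip d (\<alpha> i) ((?G ^^ h) (a l)))\<^sup>2))"
      by (subst sum.swap) (simp add: sum_distrib_left ip_commute)
    also have "b * (\<Sum>i\<in>I. ip d (\<alpha> i) ((?G ^^ (2 * h)) (\<alpha> i))) + \<dots> \<le>
        b * (\<kappa> * tr d (?G ^^ (2 * h))) + (\<Sum>l\<in>T. w l * (\<kappa> * ip d ((?G ^^ h) (a l)) ((?G ^^ h) (a l))))"
      by (intro add_mono mult_left_mono sum_mono even le w b)
    also have "\<dots> = \<kappa> * tr d (?G ^^ p)"
      by (simp only: p tr_gram_Suc[OF w b] dbl)
        (simp add: sum_distrib_left algebra_simps)
    finally show ?thesis .
  qed
qed

lemma tr_power_nonneg:
  assumes w: "\<And>i. i \<in> T \<Longrightarrow> 0 \<le> w i" and b: "0 \<le> b"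
  shows "0 \<le> tr d (gram d T w a b ^^ p)"
proof -
  have "0 \<le> moment d (gram d T w a b) (unit_fun j) p" for j
    using w b by (intro moment_nonneg psd_op_gram)
  then show ?thesis
    unfolding tr_def moment_def by (intro sum_nonneg) (metis ip_unit_left lessThan_iff)
qed

lemma rayleigh_power_le_tr:
  assumes w: "\<And>i. i \<in> T \<Longrightarrow> 0 \<le> w i" and b: "0 \<le> b" and y: "ip d y y = 1"
  shows "(ip d y (gram d T w a b y)) ^ p \<le> tr d (gram d T w a b ^^ p)"
proof -
  let ?G = "gram d T w a b"
  interpret log_convex_seq "moment d ?G y"
    using w b by (intro log_convex_seq_moment psd_op_gram)
  have "(ip d y (?G y)) ^ p \<le> ip d y ((?G ^^ p) y)"
    using power_le[of p] y by (simp add: moment_def)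
  also have "\<dots> \<le> 1 * tr d (?G ^^ p)"
    using sum_ip_power_le_tr[OF w b, where I = "{()}" and \<alpha> = "\<lambda>_. y" and \<kappa> = 1 and T = T and d = d]
      ip_Cauchy_Schwarz[of d y] y by simp
  finally show ?thesis by simp
qed

lemma quadratic_form_le_of_tr:
  assumes w: "\<And>i. i \<in> T \<Longrightarrow> 0 \<le> w i" and b: "0 \<le> b" and \<beta>: "0 \<le> \<beta>"
    and less: "tr d (gram d T w a b ^^ p) < \<beta> ^ p"
  shows "ip d x (gram d T w a b x) \<le> \<beta> * ip d x x"
proof (cases "ip d x x = 0")
  case True
  have "(ip d x (gram d T w a b x))\<^sup>2 \<le> ip d x x * ip d (gram d T w a b x) (gram d T w a b x)"
    by (rule ip_Cauchy_Schwarz)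
  with True show ?thesis by simp
next
  case False
  let ?G = "gram d T w a b"
  define s where "s = ip d x x"
  have s: "s > 0" using False ip_nonneg[of d x] by (simp add: s_def)
  define r where "r = 1 / sqrt s"
  have r: "r * r = 1 / s" using s by (simp add: r_def)
  define y where "y = (\<lambda>j. r * x j)"
  have y: "ip d y y = 1"
    using s r by (simp add: y_def ip_scale_left ip_scale_right s_def[symmetric] mult.assoc[symmetric])
  have "ip d y (?G y) < \<beta>"
    using power_less_imp_less_base[OF order.strict_trans1[OF rayleigh_power_le_tr[OF w b y] less] \<beta>] .
  moreover have "ip d y (?G y) = ip d x (?G x) / s"
    by (simp add: y_def psd_op_scale[OF psd_op_gram[OF w b]] ip_scale_left ip_scale_right
        mult.assoc[symmetric] r)
  ultimately show ?thesis using s by (simp add: field_simps s_def)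
qed


section \<open>Random subsets\<close>

definition subset_weight :: "'i set \<Rightarrow> ('i \<Rightarrow> real) \<Rightarrow> 'i set \<Rightarrow> real" where
  "subset_weight I q T = (\<Prod>i\<in>T. q i) * (\<Prod>i\<in>I - T. 1 - q i)"

definition subset_expect :: "'i set \<Rightarrow> ('i \<Rightarrow> real) \<Rightarrow> ('i set \<Rightarrow> real) \<Rightarrow> real" where
  "subset_expect I q f = (\<Sum>T\<in>Pow I. subset_weight I q T * f T)"

lemma subset_expect_add:
  "subset_expect I q (\<lambda>T. f T + g T) = subset_expect I q f + subset_expect I q g"
  by (simp add: subset_expect_def distrib_left sum.distrib)

lemma subset_expect_cmult: "subset_expect I q (\<lambda>T. c * f T) = c * subset_expect I q f"
  by (simp add: subset_expect_def sum_distrib_left mult.left_commute)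

lemma subset_expect_sum:
  "subset_expect I q (\<lambda>T. \<Sum>k\<in>K. f k T) = (\<Sum>k\<in>K. subset_expect I q (f k))"
  unfolding subset_expect_def sum_distrib_left by (rule sum.swap)

lemma subset_expect_cong:
  "(\<And>T. T \<subseteq> I \<Longrightarrow> f T = g T) \<Longrightarrow> subset_expect I q f = subset_expect I q g"
  unfolding subset_expect_def by (rule sum.cong) auto

lemma subset_expect_prod:
  assumes "finite I"
  shows "subset_expect I q (\<lambda>T. (\<Prod>i\<in>T. f i) * (\<Prod>i\<in>I - T. g i)) = (\<Prod>i\<in>I. q i * f i + (1 - q i) * g i)"
  using prod_add[OF assms, of "\<lambda>i. q i * f i" "\<lambda>i. (1 - q i) * g i"]
  by (simp add: subset_expect_def subset_weight_def prod.distrib ac_simps)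

locale random_subset =
  fixes I :: "'i set" and q :: "'i \<Rightarrow> real"
  assumes finite_I: "finite I" and q_range: "i \<in> I \<Longrightarrow> 0 \<le> q i \<and> q i \<le> 1"
begin

abbreviation "weight \<equiv> subset_weight I q"
abbreviation "expect \<equiv> subset_expect I q"

lemma weight_nonneg: "T \<subseteq> I \<Longrightarrow> 0 \<le> weight T"
  unfolding subset_weight_def using q_range by (intro mult_nonneg_nonneg prod_nonneg) auto

lemma expect_const: "expect (\<lambda>_. c) = c"
proof -
  have "expect (\<lambda>_. 1) = 1"
    using subset_expect_prod[OF finite_I, of q "\<lambda>_. 1" "\<lambda>_. 1"] by simp
  then show ?thesis using subset_expect_cmult[of I q c "\<lambda>_. 1"] by simp
qed

lemma expect_mono: "(\<And>T. T \<subseteq> I \<Longrightarrow> f T \<le> g T) \<Longrightarrow> expect f \<le> expect g"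
  unfolding subset_expect_def by (intro sum_mono mult_left_mono) (auto simp: weight_nonneg)

lemma expect_split:
  assumes i: "i \<in> I"
  shows "expect f = (\<Sum>T\<in>Pow (I - {i}). subset_weight (I - {i}) q T * (q i * f (insert i T) + (1 - q i) * f T))"
proof -
  have "Pow I = Pow (I - {i}) \<union> insert i ` Pow (I - {i})"
    using Pow_insert[of i "I - {i}"] i by (simp add: insert_absorb)
  then have "expect f = (\<Sum>T\<in>Pow (I - {i}) \<union> insert i ` Pow (I - {i}). weight T * f T)"
    by (simp add: subset_expect_def)
  also have "\<dots> = (\<Sum>T\<in>Pow (I - {i}). weight T * f T) + (\<Sum>T\<in>insert i ` Pow (I - {i}). weight T * f T)"
    using finite_I by (intro sum.union_disjoint) auto
  also have "(\<Sum>T\<in>insert i ` Pow (I - {i}). weight T * f T)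
      = (\<Sum>T\<in>Pow (I - {i}). weight (insert i T) * f (insert i T))"
    by (rule sum.reindex[unfolded comp_def]) (auto simp: inj_on_def)
  also have "(\<Sum>T\<in>Pow (I - {i}). weight T * f T) + \<dots> =
      (\<Sum>T\<in>Pow (I - {i}). subset_weight (I - {i}) q T * (q i * f (insert i T) + (1 - q i) * f T))"
    unfolding sum.distrib[symmetric]
  proof (rule sum.cong)
    fix T assume "T \<in> Pow (I - {i})"
    then have T: "T \<subseteq> I" "i \<notin> T" "finite T" using finite_I finite_subset by auto
    have 1: "weight (insert i T) = q i * subset_weight (I - {i}) q T"
      using T by (simp add: subset_weight_def Diff_insert2[of I i T] insert_Diff_if)
    have "I - T = insert i (I - {i} - T)" using T i by auto
    then have 2: "weight T = (1 - q i) * subset_weight (I - {i}) q T"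
      using finite_I by (simp add: subset_weight_def)
    show "weight T * f T + weight (insert i T) * f (insert i T) =
        subset_weight (I - {i}) q T * (q i * f (insert i T) + (1 - q i) * f T)"
      by (simp add: 1 2 algebra_simps)
  qed simp
  finally show ?thesis .
qed

lemma expect_member:
  assumes i: "i \<in> I"
  shows "expect (\<lambda>T. if i \<in> T then h T else 0) = q i * expect (\<lambda>T. h (insert i T))"
proof -
  have "expect (\<lambda>T. if i \<in> T then h T else 0) = (\<Sum>T\<in>Pow (I - {i}). subset_weight (I - {i}) q T * (q i * h (insert i T)))"
    unfolding expect_split[OF i] by (rule sum.cong) auto
  moreover have "expect (\<lambda>T. h (insert i T)) = (\<Sum>T\<in>Pow (I - {i}). subset_weight (I - {i}) q T * h (insert i T))"
    unfolding expect_split[OF i] by (rule sum.cong) (auto simp: algebra_simps)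
  ultimately show ?thesis by (simp add: sum_distrib_left mult.left_commute)
qed

lemma expect_insert_certain:
  assumes "i \<in> I" "q i = 1"
  shows "expect (\<lambda>T. h (insert i T)) = expect h"
  unfolding expect_split[OF assms(1)] by (rule sum.cong) (auto simp: assms(2))

lemma Markov:
  assumes "\<And>T. T \<subseteq> I \<Longrightarrow> 0 \<le> X T" and "c > 0" and "\<And>T. T \<subseteq> I \<Longrightarrow> Q T \<Longrightarrow> c \<le> X T"
  shows "expect (\<lambda>T. of_bool (Q T)) \<le> expect X / c"
proof -
  have "expect (\<lambda>T. of_bool (Q T)) \<le> expect (\<lambda>T. (1 / c) * X T)"
    using assms by (intro expect_mono) auto
  then show ?thesis using subset_expect_cmult[of I q "1 / c" X] by simp
qed

text \<open>The moment method replaces the matrix exponential of the usual matrix Chernoff bounds: each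
  factor \<open>gram d T w a b\<close> that is peeled off the trace costs a shift of \<open>b\<close> by \<open>c\<close>.\<close>

lemma expect_tr_power_le:
  fixes a :: "'i \<Rightarrow> nat \<Rightarrow> real" and d :: nat and \<kappa> c :: real
  defines "w \<equiv> \<lambda>i. 1 / q i"
  assumes q_pos: "\<And>i. i \<in> I \<Longrightarrow> 0 < q i"
    and small: "\<And>i. i \<in> I \<Longrightarrow> q i < 1 \<Longrightarrow> w i * ip d (a i) (a i) \<le> c"
    and c: "0 \<le> c" and \<kappa>: "0 \<le> \<kappa>"
    and le: "\<And>x. (\<Sum>i\<in>I. (ip d (a i) x)\<^sup>2) \<le> \<kappa> * ip d x x"
    and b: "0 \<le> b"
  shows "expect (\<lambda>T. tr d (gram d T w a b ^^ p)) \<le> real d * (\<Prod>k<p. \<kappa> + b + real k * c)"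
  using b
proof (induction p arbitrary: b)
  case 0
  show ?case by (simp add: tr_def unit_fun_def expect_const)
next
  case (Suc p)
  note b = Suc.prems
  have w: "0 \<le> w i" if "i \<in> I" for i using q_range[OF that] by (simp add: w_def)
  let ?Q = "\<lambda>b i T. ip d (a i) ((gram d T w a b ^^ p) (a i))"
  have *: "expect (\<lambda>T. if i \<in> T then w i * ?Q b i T else 0) \<le> expect (?Q (b + c) i)" if i: "i \<in> I" for i
  proof -
    have "expect (\<lambda>T. if i \<in> T then w i * ?Q b i T else 0) = expect (\<lambda>T. ?Q b i (insert i T))"
      using q_pos[OF i] unfolding expect_member[OF i, of "\<lambda>T. w i * ?Q b i T"] subset_expect_cmult
      by (simp add: w_def)
    also have "\<dots> \<le> expect (?Q (b + c) i)"
    proof (cases "q i = 1")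
      case True
      have "expect (\<lambda>T. ?Q b i (insert i T)) = expect (?Q b i)"
        by (rule expect_insert_certain[OF i True])
      also have "\<dots> \<le> expect (?Q (b + c) i)"
        using w b c by (intro expect_mono gram_power_mono_shift) auto
      finally show ?thesis .
    next
      case False
      show ?thesis
      proof (rule expect_mono)
        fix T assume T: "T \<subseteq> I"
        define T' where "T' = T - {i}"
        have T': "finite T'" "i \<notin> T'" "insert i T = insert i T'" "T' \<subseteq> I"
          using T finite_I by (auto simp: T'_def dest: finite_subset)
        have w': "0 \<le> w k" if "k \<in> insert i T'" for k using that T' i w by auto
        have "?Q b i (insert i T) \<le> ?Q (b + c) i T'"
          unfolding T'(3) using small[OF i] q_range[OF i] False
          by (intro gram_power_insert(2) T' w' b) auto
        also have "\<dots> \<le> ?Q (b + c) i T"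
        proof (cases "i \<in> T")
          case True
          then have "T = insert i T'" by (auto simp: T'_def)
          then show ?thesis
            using gram_power_insert(1)[OF T'(1,2) w', where b = "b + c" and d = d and a = a and q = p] b c by simp
        next
          case False
          then show ?thesis by (simp add: T'_def)
        qed
        finally show "?Q b i (insert i T) \<le> ?Q (b + c) i T" .
      qed
    qed
    finally show ?thesis .
  qed
  have "expect (\<lambda>T. tr d (gram d T w a b ^^ Suc p)) =
      expect (\<lambda>T. b * tr d (gram d T w a b ^^ p) + (\<Sum>i\<in>I. if i \<in> T then w i * ?Q b i T else 0))"
  proof (rule subset_expect_cong)
    fix T assume T: "T \<subseteq> I"
    then have "(\<Sum>i\<in>T. w i * ?Q b i T) = (\<Sum>i\<in>I. if i \<in> T then w i * ?Q b i T else 0)"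
      using finite_I by (intro sum.mono_neutral_cong_left) auto
    then show "tr d (gram d T w a b ^^ Suc p) =
        b * tr d (gram d T w a b ^^ p) + (\<Sum>i\<in>I. if i \<in> T then w i * ?Q b i T else 0)"
      using tr_gram_Suc[of T w b d p a] w T b by (auto simp del: funpow.simps)
  qed
  also have "\<dots> = b * expect (\<lambda>T. tr d (gram d T w a b ^^ p)) +
      (\<Sum>i\<in>I. expect (\<lambda>T. if i \<in> T then w i * ?Q b i T else 0))"
    by (simp add: subset_expect_add subset_expect_cmult subset_expect_sum)
  also have "\<dots> \<le> b * expect (\<lambda>T. tr d (gram d T w a b ^^ p)) + (\<Sum>i\<in>I. expect (?Q (b + c) i))"
    by (intro add_left_mono sum_mono *)
  also have "(\<Sum>i\<in>I. expect (?Q (b + c) i)) = expect (\<lambda>T. \<Sum>i\<in>I. ?Q (b + c) i T)"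
    by (simp add: subset_expect_sum)
  also have "\<dots> \<le> expect (\<lambda>T. \<kappa> * tr d (gram d T w a (b + c) ^^ p))"
    using w b c by (intro expect_mono sum_ip_power_le_tr le) auto
  also have "\<dots> = \<kappa> * expect (\<lambda>T. tr d (gram d T w a (b + c) ^^ p))"
    by (simp add: subset_expect_cmult)
  also have "b * expect (\<lambda>T. tr d (gram d T w a b ^^ p)) + \<dots> \<le>
      b * (real d * (\<Prod>k<p. \<kappa> + b + real k * c)) + \<kappa> * (real d * (\<Prod>k<p. \<kappa> + (b + c) + real k * c))"
    using b c \<kappa> by (intro add_mono mult_left_mono Suc.IH) auto
  also have "\<dots> \<le> b * (real d * (\<Prod>k<p. \<kappa> + (b + c) + real k * c)) + \<kappa> * (real d * (\<Prod>k<p. \<kappa> + (b + c) + real k * c))"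
    using b c \<kappa> by (intro add_mono mult_left_mono prod_mono) auto
  also have "\<dots> = real d * ((\<kappa> + b) * (\<Prod>k<p. \<kappa> + (b + c) + real k * c))"
    by (simp add: algebra_simps)
  also have "(\<kappa> + b) * (\<Prod>k<p. \<kappa> + (b + c) + real k * c) = (\<Prod>k<Suc p. \<kappa> + b + real k * c)"
    by (simp add: prod.lessThan_Suc_shift algebra_simps del: prod.lessThan_Suc)
  finally show ?case by simp
qed

end

lemma exp_minus_le_quadratic:
  fixes x :: real
  assumes "0 \<le> x"
  shows "exp (- x) \<le> 1 - x + x\<^sup>2 / 2"
proof -
  have pos: "0 < 1 + x + x\<^sup>2 / 2" using assms by (simp add: add_pos_nonneg)
  have "(1 - x + x\<^sup>2 / 2) * (1 + x + x\<^sup>2 / 2) = 1 + x ^ 4 / 4"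
    by (simp add: power2_eq_square power4_eq_xxxx field_simps)
  then have "1 / (1 + x + x\<^sup>2 / 2) \<le> 1 - x + x\<^sup>2 / 2"
    using pos by (simp add: divide_le_eq)
  moreover have "exp (- x) \<le> 1 / (1 + x + x\<^sup>2 / 2)"
    using exp_lower_Taylor_quadratic[OF assms] pos by (simp add: exp_minus field_simps)
  ultimately show ?thesis by simp
qed

context random_subset
begin

lemma expect_exp_sum:
  "expect (\<lambda>T. exp (\<Sum>i\<in>T. z i)) = (\<Prod>i\<in>I. q i * exp (z i) + (1 - q i))"
proof -
  have "expect (\<lambda>T. exp (\<Sum>i\<in>T. z i)) = expect (\<lambda>T. (\<Prod>i\<in>T. exp (z i)) * (\<Prod>i\<in>I - T. 1))"
    using finite_I by (intro subset_expect_cong) (auto simp: exp_sum dest: finite_subset)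
  then show ?thesis
    using subset_expect_prod[OF finite_I, of q "\<lambda>i. exp (z i)" "\<lambda>_. 1"] by simp
qed

lemma sum_upper_tail:
  assumes z: "\<And>i. i \<in> I \<Longrightarrow> 0 \<le> z i \<and> z i \<le> 1" and r: "(\<Sum>i\<in>I. q i * z i) \<le> r"
  shows "expect (\<lambda>T. of_bool (3 * r < (\<Sum>i\<in>T. z i))) \<le> exp (- r)"
proof -
  have "expect (\<lambda>T. exp (\<Sum>i\<in>T. z i)) \<le> (\<Prod>i\<in>I. exp (2 * (q i * z i)))"
    unfolding expect_exp_sum
  proof (rule prod_mono, rule conjI)
    fix i assume i: "i \<in> I"
    have "exp (z i) \<le> 1 + z i + (z i)\<^sup>2"
      using z[OF i] by (intro exp_bound) auto
    moreover have "(z i)\<^sup>2 \<le> z i" using z[OF i] by (simp add: power2_eq_square mult_left_le)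
    ultimately have "q i * exp (z i) \<le> q i * (1 + 2 * z i)"
      using q_range[OF i] by (intro mult_left_mono) auto
    then have "q i * exp (z i) + (1 - q i) \<le> 1 + 2 * (q i * z i)"
      by (simp add: algebra_simps)
    also have "\<dots> \<le> exp (2 * (q i * z i))" by (rule exp_ge_add_one_self)
    finally show "q i * exp (z i) + (1 - q i) \<le> exp (2 * (q i * z i))" .
    show "0 \<le> q i * exp (z i) + (1 - q i)" using q_range[OF i] by simp
  qed
  also have "\<dots> = exp (2 * (\<Sum>i\<in>I. q i * z i))"
    using finite_I by (simp add: exp_sum sum_distrib_left)
  also have "\<dots> \<le> exp (2 * r)" using r by simp
  finally have E: "expect (\<lambda>T. exp (\<Sum>i\<in>T. z i)) \<le> exp (2 * r)" .
  have "expect (\<lambda>T. of_bool (3 * r < (\<Sum>i\<in>T. z i))) \<le> expect (\<lambda>T. exp (\<Sum>i\<in>T. z i)) / exp (3 * r)"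
    by (rule Markov) auto
  also have "\<dots> \<le> exp (2 * r) / exp (3 * r)" by (rule divide_right_mono[OF E]) simp
  also have "\<dots> = exp (- r)" by (simp flip: exp_diff)
  finally show ?thesis .
qed

lemma sum_lower_tail:
  assumes q_pos: "\<And>i. i \<in> I \<Longrightarrow> 0 < q i" and z: "\<And>i. i \<in> I \<Longrightarrow> 0 \<le> z i"
    and small: "\<And>i. i \<in> I \<Longrightarrow> q i < 1 \<Longrightarrow> z i / q i \<le> c"
    and c: "0 < c" and \<eta>: "0 \<le> \<eta>"
  defines "m \<equiv> \<Sum>i\<in>I. z i"
  shows "expect (\<lambda>T. of_bool ((\<Sum>i\<in>T. z i / q i) < (1 - \<eta>) * m)) \<le> exp (- (m * \<eta>\<^sup>2 / (2 * c)))"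
proof -
  define \<theta> where "\<theta> = \<eta> / c"
  have \<theta>: "0 \<le> \<theta>" "\<theta> * c = \<eta>" using c \<eta> by (simp_all add: \<theta>_def)
  have "expect (\<lambda>T. exp (\<Sum>i\<in>T. - \<theta> * (z i / q i))) \<le> (\<Prod>i\<in>I. exp (- \<theta> * (1 - \<eta> / 2) * z i))"
    unfolding expect_exp_sum
  proof (rule prod_mono, rule conjI)
    fix i assume i: "i \<in> I"
    show "0 \<le> q i * exp (- \<theta> * (z i / q i)) + (1 - q i)" using q_range[OF i] by simp
    show "q i * exp (- \<theta> * (z i / q i)) + (1 - q i) \<le> exp (- \<theta> * (1 - \<eta> / 2) * z i)"
    proof (cases "q i = 1")
      case True
      have "0 \<le> \<theta> * (\<eta> / 2 * z i)" using \<theta> \<eta> z[OF i] by simp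
      then show ?thesis using True by (simp add: algebra_simps)
    next
      case False
      define x where "x = \<theta> * (z i / q i)"
      have x0: "0 \<le> x" using \<theta> z[OF i] q_pos[OF i] by (simp add: x_def)
      have qx: "q i * x = \<theta> * z i" using q_pos[OF i] by (simp add: x_def)
      have "x \<le> \<eta>"
        using small[OF i] False q_range[OF i] mult_left_mono[OF _ \<theta>(1), of "z i / q i" c] \<theta>(2)
        by (simp add: x_def)
      then have "x\<^sup>2 \<le> x * \<eta>" using x0 by (simp add: power2_eq_square mult_left_mono)
      then have "exp (- x) \<le> 1 - x + x * \<eta> / 2"
        using exp_minus_le_quadratic[OF x0] by simp
      then have "q i * exp (- x) + (1 - q i) \<le> q i * (1 - x + x * \<eta> / 2) + (1 - q i)"
        using q_pos[OF i] by simp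
      also have "\<dots> = 1 + - (q i * x) * (1 - \<eta> / 2)" by (simp add: algebra_simps)
      also have "\<dots> \<le> exp (- (q i * x) * (1 - \<eta> / 2))" by (rule exp_ge_add_one_self)
      finally have "q i * exp (- x) + (1 - q i) \<le> exp (- (\<theta> * z i) * (1 - \<eta> / 2))"
        by (simp only: qx)
      moreover have "- \<theta> * (z i / q i) = - x" "- \<theta> * (1 - \<eta> / 2) * z i = - (\<theta> * z i) * (1 - \<eta> / 2)"
        by (simp_all add: x_def)
      ultimately show ?thesis by (simp only:)
    qed
  qed
  also have "\<dots> = exp (- \<theta> * (1 - \<eta> / 2) * m)"
    using finite_I by (simp add: exp_sum m_def sum_distrib_left)
  finally have E: "expect (\<lambda>T. exp (\<Sum>i\<in>T. - \<theta> * (z i / q i))) \<le> exp (- \<theta> * (1 - \<eta> / 2) * m)" .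
  have "expect (\<lambda>T. of_bool ((\<Sum>i\<in>T. z i / q i) < (1 - \<eta>) * m)) \<le>
      expect (\<lambda>T. exp (\<Sum>i\<in>T. - \<theta> * (z i / q i))) / exp (- \<theta> * ((1 - \<eta>) * m))"
  proof (rule Markov)
    fix T assume "(\<Sum>i\<in>T. z i / q i) < (1 - \<eta>) * m"
    then have "\<theta> * (\<Sum>i\<in>T. z i / q i) \<le> \<theta> * ((1 - \<eta>) * m)"
      using \<theta> by (intro mult_left_mono) auto
    moreover have "(\<Sum>i\<in>T. - \<theta> * (z i / q i)) = - (\<theta> * (\<Sum>i\<in>T. z i / q i))"
      by (simp add: sum_distrib_left sum_negf)
    ultimately show "exp (- \<theta> * ((1 - \<eta>) * m)) \<le> exp (\<Sum>i\<in>T. - \<theta> * (z i / q i))"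
      by simp
  qed auto
  also have "\<dots> \<le> exp (- \<theta> * (1 - \<eta> / 2) * m) / exp (- \<theta> * ((1 - \<eta>) * m))"
    by (rule divide_right_mono[OF E]) simp
  also have "\<dots> = exp (- (\<theta> * \<eta> * m / 2))"
    by (simp flip: exp_diff) (simp add: algebra_simps)
  also have "\<theta> * \<eta> * m / 2 = m * \<eta>\<^sup>2 / (2 * c)"
    by (simp add: \<theta>_def power2_eq_square ac_simps)
  finally show ?thesis .
qed

lemma expect_of_bool_disj:
  "expect (\<lambda>T. of_bool (A T \<or> B T)) \<le> expect (\<lambda>T. of_bool (A T)) + expect (\<lambda>T. of_bool (B T))"
  unfolding subset_expect_add[symmetric] by (rule expect_mono) auto

lemma sampled_gram_upper_tail:
  fixes a :: "'i \<Rightarrow> nat \<Rightarrow> real" and d l :: nat and \<kappa> \<epsilon> \<delta> c :: real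
  assumes q_pos: "\<And>i. i \<in> I \<Longrightarrow> 0 < q i"
    and small: "\<And>i. i \<in> I \<Longrightarrow> q i < 1 \<Longrightarrow> ip d (a i) (a i) / q i \<le> c"
    and \<kappa>: "0 < \<kappa>" and le: "\<And>x. (\<Sum>i\<in>I. (ip d (a i) x)\<^sup>2) \<le> \<kappa> * ip d x x"
    and \<epsilon>: "0 < \<epsilon>" "\<epsilon> < 1" and c: "0 \<le> c" "128 * real l * c \<le> \<kappa> * \<epsilon>\<^sup>2" and l: "1 \<le> l"
  shows "expect (\<lambda>T. of_bool (\<not> (\<forall>x. ip d x (gram d T (\<lambda>i. 1 / q i) a 0 x) \<le> (1 + \<epsilon>) * \<kappa> * ip d x x)))
    \<le> real d * exp (- (3 * real l))"
proof -
  define p where "p = 2 * nat \<lceil>4 * real l / \<epsilon>\<rceil>"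
  have "real p = 2 * of_int \<lceil>4 * real l / \<epsilon>\<rceil>"
    using \<epsilon> by (simp add: p_def)
  then have p_ge: "8 * real l / \<epsilon> \<le> real p" and "real p \<le> 8 * real l / \<epsilon> + 2"
    by linarith+
  moreover have "1 \<le> real l / \<epsilon>" using \<epsilon> l by (simp add: le_divide_eq)
  ultimately have p_le: "real p \<le> 10 * real l / \<epsilon>" by simp
  let ?tr = "\<lambda>T. tr d (gram d T (\<lambda>i. 1 / q i) a 0 ^^ p)"
  have w: "0 \<le> 1 / q i" if "i \<in> I" for i using q_pos[OF that] by simp
  have \<beta>: "0 \<le> (1 + \<epsilon>) * \<kappa>" using \<epsilon> \<kappa> by simp
  have pc: "real p * (real p * c / \<kappa>) \<le> real l * (100/128)"
  proof -
    have "real p * (real p * c / \<kappa>) = (real p)\<^sup>2 * (c / \<kappa>)" by (simp add: power2_eq_square)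
    also have "\<dots> \<le> (10 * real l / \<epsilon>)\<^sup>2 * (\<epsilon>\<^sup>2 / (128 * real l))"
      using p_le c \<kappa> l \<epsilon> by (intro mult_mono power_mono) (auto simp: field_simps)
    also have "\<dots> = real l * (100/128)"
      using l \<epsilon> by (simp add: power2_eq_square field_simps)
    finally show ?thesis .
  qed
  have "expect ?tr \<le> real d * (\<Prod>k<p. \<kappa> + 0 + real k * c)"
    using small le \<kappa> q_pos c by (intro expect_tr_power_le) auto
  also have "(\<Prod>k<p. \<kappa> + 0 + real k * c) \<le> (\<Prod>k<p. \<kappa> * (1 + real p * c / \<kappa>))"
    using \<kappa> c by (intro prod_mono) (auto simp: distrib_left intro!: mult_right_mono)
  also have "\<dots> = \<kappa> ^ p * (1 + real p * c / \<kappa>) ^ p"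
    by (simp add: power_mult_distrib)
  also have "\<dots> \<le> \<kappa> ^ p * exp (real p * c / \<kappa>) ^ p"
    using \<kappa> c by (intro mult_left_mono power_mono exp_ge_add_one_self) auto
  also have "exp (real p * c / \<kappa>) ^ p = exp (real p * (real p * c / \<kappa>))"
    by (rule exp_of_nat_mult[symmetric])
  also have "\<dots> \<le> exp (real l)" using order_trans[OF pc] by simp
  finally have E: "expect ?tr \<le> real d * (\<kappa> ^ p * exp (real l))"
    using \<kappa> by (simp add: mult_left_mono)
  have "exp (\<epsilon> / 2) \<le> 1 + \<epsilon> / 2 + (\<epsilon> / 2)\<^sup>2" using \<epsilon> by (intro exp_bound) auto
  also have "\<dots> \<le> 1 + \<epsilon>" using \<epsilon> by (simp add: power2_eq_square field_simps)
  finally have "exp (\<epsilon> / 2) ^ p \<le> (1 + \<epsilon>) ^ p" by (intro power_mono) auto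
  moreover have "exp (4 * real l) \<le> exp (\<epsilon> / 2) ^ p"
    using p_ge \<epsilon> by (simp add: exp_of_nat_mult[symmetric] field_simps)
  ultimately have "exp (4 * real l) \<le> (1 + \<epsilon>) ^ p" by simp
  then have \<beta>_ge: "exp (4 * real l) * \<kappa> ^ p \<le> ((1 + \<epsilon>) * \<kappa>) ^ p"
    using \<kappa> by (simp add: power_mult_distrib)
  have "expect (\<lambda>T. of_bool (\<not> (\<forall>x. ip d x (gram d T (\<lambda>i. 1 / q i) a 0 x) \<le> (1 + \<epsilon>) * \<kappa> * ip d x x)))
      \<le> expect ?tr / (exp (4 * real l) * \<kappa> ^ p)"
  proof (rule Markov)
    fix T assume T: "T \<subseteq> I"
    show "0 \<le> ?tr T" using w T by (intro tr_power_nonneg) auto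
    assume "\<not> (\<forall>x. ip d x (gram d T (\<lambda>i. 1 / q i) a 0 x) \<le> (1 + \<epsilon>) * \<kappa> * ip d x x)"
    then have "\<not> ?tr T < ((1 + \<epsilon>) * \<kappa>) ^ p"
      using quadratic_form_le_of_tr[where T = T and w = "\<lambda>i. 1 / q i" and b = 0 and \<beta> = "(1 + \<epsilon>) * \<kappa>"
          and d = d and a = a and p = p] w T \<beta> by auto
    then show "exp (4 * real l) * \<kappa> ^ p \<le> ?tr T" using \<beta>_ge by simp
  qed (use \<kappa> in auto)
  also have "\<dots> \<le> real d * (\<kappa> ^ p * exp (real l)) / (exp (4 * real l) * \<kappa> ^ p)"
    using \<kappa> by (intro divide_right_mono E) auto
  also have "\<dots> = real d * (exp (real l) / exp (4 * real l))" using \<kappa> by simp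
  also have "exp (real l) / exp (4 * real l) = exp (- (3 * real l))"
    by (simp flip: exp_diff)
  finally show ?thesis .
qed

end

lemma two_power_le_exp: "(2::real) ^ (4 * l) \<le> exp (3 * real l)"
proof -
  have "(16::real) \<le> (13/8) ^ 6" by (simp add: field_simps)
  also have "(13/8::real) ^ 6 \<le> exp (1/2) ^ 6"
    using exp_lower_Taylor_quadratic[of "1/2"] by (intro power_mono) (auto simp: power2_eq_square)
  also have "exp (1/2::real) ^ 6 = exp 3" by (simp flip: exp_of_nat_mult)
  finally have "(16::real) ^ l \<le> exp 3 ^ l" by (intro power_mono) auto
  moreover have "(2::real) ^ (4 * l) = 16 ^ l" by (simp add: power_mult)
  moreover have "exp 3 ^ l = exp (3 * real l)" by (simp add: exp_of_nat_mult[symmetric] mult.commute)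
  ultimately show ?thesis by simp
qed


section \<open>The randomized power method\<close>

lemma measure_random_subset:
  fixes M :: "'b measure" and \<rho> :: "'i \<Rightarrow> 'k"
  assumes M: "prob_space M" and I: "finite I" "inj_on \<rho> I" and T: "T \<subseteq> I"
    and A: "\<And>i. i \<in> I \<Longrightarrow> A i \<in> sets M"
  defines "PM \<equiv> \<Pi>\<^sub>M k \<in> (UNIV :: 'k set). M"
  shows "{u \<in> space PM. {i \<in> I. u (\<rho> i) \<in> A i} = T} \<in> sets PM"
    and "measure PM {u \<in> space PM. {i \<in> I. u (\<rho> i) \<in> A i} = T} = subset_weight I (\<lambda>i. measure M (A i)) T"
proof -
  interpret M: prob_space M by (rule M)
  interpret P: product_prob_space "\<lambda>_. M" "UNIV :: 'k set"
    using M by (intro product_prob_spaceI)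
  define X where "X k = (let i = the_inv_into I \<rho> k in if i \<in> T then A i else space M - A i)" for k
  have X: "X (\<rho> i) = (if i \<in> T then A i else space M - A i)" if "i \<in> I" for i
    using that I by (simp add: X_def the_inv_into_f_f Let_def)
  have *: "{u \<in> space PM. {i \<in> I. u (\<rho> i) \<in> A i} = T} = {u \<in> space PM. \<forall>k\<in>\<rho> ` I. u k \<in> X k}"
    using T by (auto simp: X PM_def space_PiM split: if_splits)
  have sets: "X k \<in> sets M" if "k \<in> \<rho> ` I" for k
    using that A by (auto simp: X)
  have "{u \<in> space PM. u k \<in> X k} \<in> sets PM" if "k \<in> \<rho> ` I" for k
    unfolding PM_def by (rule sets_Collect_single') (use sets[OF that] sets.sets_into_space[OF sets[OF that]] in \<open>auto simp: Collect_conj_eq[symmetric] Int_def[symmetric] Int_absorb1\<close>)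
  then show "{u \<in> space PM. {i \<in> I. u (\<rho> i) \<in> A i} = T} \<in> sets PM"
    unfolding * using I by (intro sets.sets_Collect_finite_All) auto
  have "emeasure PM {u \<in> space PM. \<forall>k\<in>\<rho> ` I. u k \<in> X k} = (\<Prod>k\<in>\<rho> ` I. emeasure M (X k))"
    unfolding PM_def using I sets by (intro P.emeasure_PiM_Collect) auto
  also have "\<dots> = (\<Prod>i\<in>I. ennreal (measure M (X (\<rho> i))))"
    using I by (simp add: prod.reindex M.emeasure_eq_measure)
  also have "\<dots> = ennreal (\<Prod>i\<in>I. measure M (X (\<rho> i)))"
    by (simp add: prod_ennreal)
  finally have "measure PM {u \<in> space PM. {i \<in> I. u (\<rho> i) \<in> A i} = T} = (\<Prod>i\<in>I. measure M (X (\<rho> i)))"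
    by (simp add: * measure_def prod_nonneg)
  also have "\<dots> = (\<Prod>i\<in>I. if i \<in> T then measure M (A i) else 1 - measure M (A i))"
    using A by (intro prod.cong) (auto simp: X M.prob_compl)
  also have "\<dots> = subset_weight I (\<lambda>i. measure M (A i)) T"
    unfolding subset_weight_def using I T
    by (subst prod.subset_diff[OF T]) (auto intro!: arg_cong2[where f = times] prod.cong simp: subset_iff mult.commute)
  finally show "measure PM {u \<in> space PM. {i \<in> I. u (\<rho> i) \<in> A i} = T} = subset_weight I (\<lambda>i. measure M (A i)) T" .
qed

lemma measure_pair_random_subset:
  fixes M1 :: "'a measure" and M2 :: "'b measure"
  assumes "prob_space M1" and "prob_space M2" and "random_subset I q"
    and sel: "\<And>u. sel u \<subseteq> I"
    and sel_sets: "\<And>T. T \<subseteq> I \<Longrightarrow> {u \<in> space M1. sel u = T} \<in> sets M1"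
    and sel_measure: "\<And>T. T \<subseteq> I \<Longrightarrow> measure M1 {u \<in> space M1. sel u = T} = subset_weight I q T"
    and P_sets: "\<And>T. T \<subseteq> I \<Longrightarrow> {g \<in> space M2. P T g} \<in> sets M2"
    and good: "\<And>T. T \<subseteq> I \<Longrightarrow> Good T \<Longrightarrow> 1 - \<beta> \<le> measure M2 {g \<in> space M2. P T g}"
    and bad: "subset_expect I q (\<lambda>T. of_bool (\<not> Good T)) \<le> \<alpha>" and \<beta>: "0 \<le> \<beta>"
  shows "1 - \<alpha> - \<beta> \<le> measure (M1 \<Otimes>\<^sub>M M2) {\<omega> \<in> space (M1 \<Otimes>\<^sub>M M2). P (sel (fst \<omega>)) (snd \<omega>)}"
proof -
  interpret M1: prob_space M1 by fact
  interpret M2: prob_space M2 by fact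
  interpret random_subset I q by fact
  interpret pair: pair_prob_space M1 M2 ..
  let ?A = "\<lambda>T. {u \<in> space M1. sel u = T}" and ?B = "\<lambda>T. {g \<in> space M2. P T g}"
  have *: "{\<omega> \<in> space (M1 \<Otimes>\<^sub>M M2). P (sel (fst \<omega>)) (snd \<omega>)} = (\<Union>T\<in>Pow I. ?A T \<times> ?B T)"
    using sel by (auto simp: space_pair_measure)
  have "measure (M1 \<Otimes>\<^sub>M M2) (\<Union>T\<in>Pow I. ?A T \<times> ?B T) = (\<Sum>T\<in>Pow I. measure (M1 \<Otimes>\<^sub>M M2) (?A T \<times> ?B T))"
    using finite_I sel_sets P_sets
    by (intro pair.finite_measure_finite_Union) (auto simp: disjoint_family_on_def)
  also have "\<dots> = (\<Sum>T\<in>Pow I. subset_weight I q T * measure M2 (?B T))"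
    using sel_sets P_sets sel_measure by (intro sum.cong) (auto simp: measure_def M2.emeasure_pair_measure_Times enn2real_mult)
  also have "\<dots> \<ge> (\<Sum>T\<in>Pow I. subset_weight I q T * (1 - \<beta> - of_bool (\<not> Good T)))"
  proof (intro sum_mono mult_left_mono weight_nonneg)
    fix T assume "T \<in> Pow I"
    then show "1 - \<beta> - of_bool (\<not> Good T) \<le> measure M2 (?B T)"
      using good[of T] order_trans[OF _ measure_nonneg, of "- \<beta>" M2 "?B T"] \<beta> by (cases "Good T") auto
  qed auto
  also have "(\<Sum>T\<in>Pow I. subset_weight I q T * (1 - \<beta> - of_bool (\<not> Good T)))
      = expect (\<lambda>_. 1 - \<beta>) - expect (\<lambda>T. of_bool (\<not> Good T))"
    unfolding subset_expect_def sum_subtractf[symmetric] by (simp only: right_diff_distrib)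
  finally show ?thesis
    unfolding * expect_const using bad by linarith
qed

abbreviation "normal_tape \<equiv> \<Pi>\<^sub>M k \<in> (UNIV :: nat set). std_normal_distribution"

lemma prob_space_std_normal: "prob_space std_normal_distribution"
  by (rule prob_space_normal_density) simp

lemma prob_space_normal_tape: "prob_space normal_tape"
  by (intro prob_space_PiM prob_space_std_normal)

interpretation normal_tape: prob_space normal_tape
  by (rule prob_space_normal_tape)

lemma normal_tape_component_measurable [measurable]: "(\<lambda>g. g k) \<in> borel_measurable normal_tape"
  using measurable_component_singleton[of k UNIV "\<lambda>_. std_normal_distribution"]
  by (simp add: measurable_def)

lemma normal_tape_component_distr: "distr normal_tape borel (\<lambda>g. g k) = std_normal_distribution"
proof -
  have "distr normal_tape borel (\<lambda>g. g k) = distr normal_tape std_normal_distribution (\<lambda>g. g k)"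
    by (rule distr_cong) auto
  then show ?thesis
    using distr_PiM_component[of UNIV "\<lambda>_. std_normal_distribution" k] prob_space_std_normal by simp
qed

lemma normal_tape_component: "distributed normal_tape lborel (\<lambda>g. g k) std_normal_density"
proof -
  have "distr normal_tape lborel (\<lambda>g. g k) = distr normal_tape borel (\<lambda>g. g k)"
    by (rule distr_cong) auto
  then show ?thesis
    by (simp add: distributed_def normal_tape_component_distr)
qed

lemma normal_tape_indep:
  assumes "inj_on \<pi> J"
  shows "normal_tape.indep_vars (\<lambda>_. borel) (\<lambda>j g. g (\<pi> j)) J"
proof (cases "J = {}")
  case True
  then show ?thesis by (simp add: normal_tape.indep_vars_def normal_tape.indep_sets_def)
next
  case False
  have sets: "sets (\<Pi>\<^sub>M j\<in>J. borel) = sets (\<Pi>\<^sub>M j\<in>J. std_normal_distribution)"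
    by (intro sets_PiM_cong) auto
  have "distr normal_tape (\<Pi>\<^sub>M j\<in>J. borel) (\<lambda>g. \<lambda>j\<in>J. g (\<pi> j))
      = distr normal_tape (\<Pi>\<^sub>M j\<in>J. std_normal_distribution) (\<lambda>g. \<lambda>j\<in>J. g (\<pi> j))"
    by (rule distr_cong) (auto simp: sets)
  also have "\<dots> = (\<Pi>\<^sub>M j\<in>J. std_normal_distribution)"
    using assms by (intro distr_PiM_reindex prob_space_std_normal) auto
  finally show ?thesis
    using False by (subst normal_tape.indep_vars_iff_distr_eq_PiM')
      (auto simp: normal_tape_component_distr)
qed

lemma normal_tape_anti_concentration:
  assumes J: "finite J" "inj_on \<pi> J" and s: "(\<Sum>j\<in>J. (c j)\<^sup>2) = s\<^sup>2" "0 < s" and t: "0 \<le> t"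
  shows "measure normal_tape {g \<in> space normal_tape. \<bar>\<Sum>j\<in>J. c j * g (\<pi> j)\<bar> < t * s} \<le> t"
proof -
  define J' where "J' = {j \<in> J. c j \<noteq> 0}"
  have J': "finite J'" "J' \<subseteq> J" using J by (auto simp: J'_def)
  have sum: "(\<Sum>j\<in>J'. c j * g (\<pi> j)) = (\<Sum>j\<in>J. c j * g (\<pi> j))" for g :: "nat \<Rightarrow> real"
    using J by (intro sum.mono_neutral_left) (auto simp: J'_def)
  have s': "(\<Sum>j\<in>J'. \<bar>c j\<bar>\<^sup>2) = s\<^sup>2"
    unfolding s(1)[symmetric] power2_abs using J by (intro sum.mono_neutral_left) (auto simp: J'_def)
  then have "J' \<noteq> {}" using s by auto
  have "normal_tape.indep_vars (\<lambda>_. borel) (\<lambda>j g. c j * g (\<pi> j)) J'"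
    using normal_tape.indep_vars_compose2[OF normal_tape_indep[OF inj_on_subset[OF J(2) J'(2)]],
        of "\<lambda>j x. c j * x" "\<lambda>_. borel"] by simp
  moreover have "distributed normal_tape lborel (\<lambda>g. c j * g (\<pi> j)) (normal_density 0 \<bar>c j\<bar>)" if "j \<in> J'" for j
    using normal_tape.normal_density_affine[OF normal_tape_component[of "\<pi> j"], of "c j" 0] that
    by (simp add: J'_def)
  ultimately have "distributed normal_tape lborel (\<lambda>g. \<Sum>j\<in>J'. c j * g (\<pi> j))
      (normal_density (\<Sum>j\<in>J'. 0) (sqrt (\<Sum>j\<in>J'. \<bar>c j\<bar>\<^sup>2)))"
    using J' \<open>J' \<noteq> {}\<close> by (intro normal_tape.sum_indep_normal) (auto simp: J'_def)
  then have D: "distributed normal_tape lborel (\<lambda>g. \<Sum>j\<in>J. c j * g (\<pi> j)) (normal_density 0 s)"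
    using s by (simp only: sum s' real_sqrt_abs abs_of_pos sum.neutral_const)
  have dens: "normal_density 0 s x \<le> 1 / (2 * s)" for x
  proof -
    have "2 * s = sqrt (4 * s\<^sup>2)" using s by (simp add: real_sqrt_mult)
    also have "\<dots> \<le> sqrt (2 * pi * s\<^sup>2)" using pi_ge_two by (intro real_sqrt_le_mono mult_right_mono) auto
    finally have "1 / sqrt (2 * pi * s\<^sup>2) \<le> 1 / (2 * s)" using s by (intro divide_left_mono) auto
    moreover have "1 / sqrt (2 * pi * s\<^sup>2) * exp (- (x - 0)\<^sup>2 / (2 * s\<^sup>2)) \<le> 1 / sqrt (2 * pi * s\<^sup>2) * 1"
      by (intro mult_left_mono) auto
    ultimately show ?thesis unfolding normal_density_def by simp
  qed
  let ?A = "{- (t * s)<..<t * s}"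
  have "{g \<in> space normal_tape. \<bar>\<Sum>j\<in>J. c j * g (\<pi> j)\<bar> < t * s} = (\<lambda>g. \<Sum>j\<in>J. c j * g (\<pi> j)) -` ?A \<inter> space normal_tape"
    by (auto simp: abs_less_iff)
  then have "emeasure normal_tape {g \<in> space normal_tape. \<bar>\<Sum>j\<in>J. c j * g (\<pi> j)\<bar> < t * s}
      = (\<integral>\<^sup>+x. ennreal (normal_density 0 s x) * indicator ?A x \<partial>lborel)"
    by (simp add: distributed_emeasure[OF D])
  also have "\<dots> \<le> (\<integral>\<^sup>+x. ennreal (1 / (2 * s)) * indicator ?A x \<partial>lborel)"
    by (intro nn_integral_mono mult_right_mono ennreal_leI dens) auto
  also have "\<dots> = ennreal (1 / (2 * s)) * emeasure lborel ?A"
    by (simp add: nn_integral_cmult_indicator)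
  also have "\<dots> = ennreal (1 / (2 * s) * (2 * (t * s)))"
    using s t by (subst ennreal_mult) (auto simp: mult.commute)
  also have "1 / (2 * s) * (2 * (t * s)) = t" using s by simp
  finally show ?thesis
    using t by (simp add: normal_tape.emeasure_eq_measure)
qed

lemma normal_tape_norm_tail:
  assumes J: "finite J" and R: "0 < R"
  shows "measure normal_tape {g \<in> space normal_tape. R \<le> (\<Sum>j\<in>J. (g (\<pi> j))\<^sup>2)} \<le> real (card J) / R"
proof -
  have 1: "integrable normal_tape (\<lambda>g. (g k)\<^sup>2)" for k
    using distributed_integrable[OF normal_tape_component, of "\<lambda>x. x\<^sup>2" k]
      integrable_std_normal_moment[of 2] by simp
  have 2: "(\<integral>g. (g k)\<^sup>2 \<partial>normal_tape) = 1" for k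
    using distributed_integral[OF normal_tape_component, of "\<lambda>x. x\<^sup>2" k]
      integral_std_normal_moment_even[of 1] by simp
  have "measure normal_tape {g \<in> space normal_tape. R \<le> (\<Sum>j\<in>J. (g (\<pi> j))\<^sup>2)}
      \<le> (\<integral>g. (\<Sum>j\<in>J. (g (\<pi> j))\<^sup>2) \<partial>normal_tape) / R"
    by (rule integral_Markov_inequality_measure[where A = "{}"])
      (use R 1 in \<open>auto simp: sum_nonneg\<close>)
  then show ?thesis by (simp add: Bochner_Integration.integral_sum 1 2)
qed

lemma power_method_bounds:
  assumes S: "psd_op d S" and upper: "\<And>y. ip d y (S y) \<le> \<beta> * ip d y y"
    and v: "ip d v v = 1" "\<alpha> \<le> ip d v (S v)" "0 < \<alpha>"
    and overlap: "t * sqrt (ip d ((S ^^ K) v) ((S ^^ K) v)) \<le> \<bar>ip d ((S ^^ K) v) x\<bar>" "0 < t"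
    and R: "ip d x x \<le> R" and K: "1 \<le> K" and \<eta>: "0 < \<eta>" "\<eta> < 1" "(1 - \<eta>) ^ (2 * K) * R \<le> t\<^sup>2"
  defines "\<rho> \<equiv> moment d S x (2 * K) / moment d S x (2 * K - 1)"
  shows "(1 - \<eta>) * \<alpha> \<le> \<rho>" and "\<rho> \<le> \<beta>"
proof -
  interpret x: log_convex_seq "moment d S x" by (rule log_convex_seq_moment[OF S])
  interpret v: log_convex_seq "moment d S v" by (rule log_convex_seq_moment[OF S])
  obtain h where h: "K = Suc h" using K by (cases K) auto
  have dbl: "ip d ((S ^^ K) y) ((S ^^ K) y) = moment d S y (2 * K)" for y
    using moment_shift[OF S, of K y 0] by (simp add: moment_0)
  have \<alpha>_pos: "0 < \<alpha> ^ (2 * K)" using v by simp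
  have "\<alpha> ^ (2 * K) \<le> moment d S v 1 ^ (2 * K)"
    using v by (intro power_mono) (auto simp: moment_1[simplified])
  also have "\<dots> \<le> moment d S v (2 * K)"
    using v by (intro v.power_le) (simp add: moment_0)
  finally have "t\<^sup>2 * \<alpha> ^ (2 * K) \<le> (t * sqrt (moment d S v (2 * K)))\<^sup>2"
    using v.nonneg[of "2 * K"] by (simp add: power_mult_distrib mult_left_mono)
  also have "\<dots> \<le> (ip d ((S ^^ K) v) x)\<^sup>2"
    using overlap by (simp add: dbl abs_le_square_iff[symmetric] v.nonneg)
  also have "\<dots> = (ip d v ((S ^^ K) x))\<^sup>2" by (simp add: funpow_psd_sym[OF S])
  also have "\<dots> \<le> moment d S x (2 * K)"
    using ip_Cauchy_Schwarz[of d v "(S ^^ K) x"] v by (simp add: dbl)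
  finally have lower: "t\<^sup>2 * \<alpha> ^ (2 * K) \<le> moment d S x (2 * K)" .
  have tpos: "0 < t\<^sup>2 * \<alpha> ^ (2 * K)"
    using \<alpha>_pos overlap(2) by (intro mult_pos_pos[OF zero_less_power])
  then have pos: "0 < moment d S x (2 * K)" using lower by (rule less_le_trans)
  have ratio: "moment d S x (2 * K) \<le> \<beta> * moment d S x (2 * K - 1)"
    using moment_ratio_le[OF S upper, of x h] by (simp add: h)
  have "moment d S x (2 * K - 1) \<noteq> 0" using ratio pos by auto
  then have pos': "0 < moment d S x (2 * K - 1)" using x.nonneg[of "2 * K - 1"] by simp
  then show "\<rho> \<le> \<beta>" using ratio by (simp add: \<rho>_def divide_le_eq)
  have \<rho>_pos: "0 < \<rho>" using pos pos' by (simp add: \<rho>_def)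
  have "Suc (2 * K - 1) = 2 * K" using K by simp
  then have "moment d S x (2 * K) \<le> ip d x x * \<rho> ^ (2 * K)"
    using x.le_ratio_power[OF pos'] by (simp add: \<rho>_def moment_0)
  also have "\<dots> \<le> R * \<rho> ^ (2 * K)" using R \<rho>_pos by (intro mult_right_mono) auto
  finally have bound: "t\<^sup>2 * \<alpha> ^ (2 * K) \<le> R * \<rho> ^ (2 * K)" by (rule order_trans[OF lower])
  show "(1 - \<eta>) * \<alpha> \<le> \<rho>"
  proof (rule ccontr)
    assume "\<not> (1 - \<eta>) * \<alpha> \<le> \<rho>"
    then have "\<rho> < (1 - \<eta>) * \<alpha>" by simp
    then have "\<rho> ^ (2 * K) < ((1 - \<eta>) * \<alpha>) ^ (2 * K)"
      using \<rho>_pos K by (intro power_strict_mono) auto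
    moreover have "0 < R"
    proof (rule zero_less_mult_pos2)
      show "0 < R * \<rho> ^ (2 * K)" by (rule less_le_trans[OF tpos bound])
      show "0 < \<rho> ^ (2 * K)" using \<rho>_pos by (rule zero_less_power)
    qed
    ultimately have "R * \<rho> ^ (2 * K) < R * ((1 - \<eta>) * \<alpha>) ^ (2 * K)"
      by (intro mult_strict_left_mono)
    also have "\<dots> = ((1 - \<eta>) ^ (2 * K) * R) * \<alpha> ^ (2 * K)" by (simp add: power_mult_distrib)
    also have "\<dots> \<le> t\<^sup>2 * \<alpha> ^ (2 * K)"
      using \<eta>(3) \<alpha>_pos by (intro mult_right_mono) auto
    also note bound
    finally show False by simp
  qed
qed

definition start_vec :: "nat set \<Rightarrow> (nat \<Rightarrow> nat) \<Rightarrow> (nat \<Rightarrow> real) \<Rightarrow> nat \<Rightarrow> real" where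
  "start_vec J \<pi> g j = (if j \<in> J then g (\<pi> j) else 0)"

lemma ip_start_vec:
  assumes "J \<subseteq> {..<d}"
  shows "ip d c (start_vec J \<pi> g) = (\<Sum>j\<in>J. c j * g (\<pi> j))"
  unfolding ip_def start_vec_def using assms by (intro sum.mono_neutral_cong_right) auto

lemma measurable_start_vec_power [measurable]:
  "(\<lambda>g. (gram d T w a b ^^ k) (start_vec J \<pi> g) j) \<in> borel_measurable normal_tape"
proof (induction k arbitrary: j)
  case 0
  then show ?case by (cases "j \<in> J") (simp_all add: start_vec_def)
next
  case (Suc k)
  note [measurable] = Suc.IH
  show ?case by (simp add: gram_def[of d T w a b "(gram d T w a b ^^ k) _"] ip_def)
qed

lemma measurable_start_vec_moment [measurable]:
  "(\<lambda>g. moment d (gram d T w a b) (start_vec J \<pi> g) k) \<in> borel_measurable normal_tape"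
proof -
  have [measurable]: "(\<lambda>g. start_vec J \<pi> g j) \<in> borel_measurable normal_tape" for j
    using measurable_start_vec_power[where k = 0] by simp
  show ?thesis by (simp add: moment_def ip_def)
qed

lemma random_start_power_method:
  fixes T w a d
  defines "S \<equiv> gram d T w a 0"
  assumes w: "\<And>i. i \<in> T \<Longrightarrow> 0 \<le> w i"
    and upper: "\<And>y. ip d y (S y) \<le> \<beta> * ip d y y"
    and v: "ip d v v = 1" "\<alpha> \<le> ip d v (S v)" "0 < \<alpha>"
    and J: "J \<subseteq> {..<d}" "inj_on \<pi> J" and a: "\<And>i j. i \<in> T \<Longrightarrow> j \<notin> J \<Longrightarrow> a i j = 0"
    and \<delta>: "0 < \<delta>" and d: "0 < d"
    and K: "1 \<le> K" and \<eta>: "0 < \<eta>" "\<eta> < 1" "(1 - \<eta>) ^ (2 * K) * (4 * real d / \<delta>) \<le> (\<delta> / 4)\<^sup>2"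
  shows "1 - \<delta> / 2 \<le> measure normal_tape {g \<in> space normal_tape.
    (1 - \<eta>) * \<alpha> \<le> moment d S (start_vec J \<pi> g) (2 * K) / moment d S (start_vec J \<pi> g) (2 * K - 1) \<and>
    moment d S (start_vec J \<pi> g) (2 * K) / moment d S (start_vec J \<pi> g) (2 * K - 1) \<le> \<beta>}"
    (is "_ \<le> measure normal_tape ?G")
proof -
  have S: "psd_op d S" unfolding S_def using w by (intro psd_op_gram) auto
  interpret v: log_convex_seq "moment d S v" by (rule log_convex_seq_moment[OF S])
  define c where "c = (S ^^ K) v"
  have c0: "c j = 0" if "j \<notin> J" for j
    using K a that by (cases K) (auto simp: c_def S_def gram_def)
  have "\<alpha> ^ (2 * K) \<le> moment d S v 1 ^ (2 * K)"
    using v by (intro power_mono) (auto simp: moment_1[simplified])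
  also have "\<dots> \<le> moment d S v (2 * K)"
    using v by (intro v.power_le) (simp add: moment_0)
  also have "\<dots> = ip d c c"
    using moment_shift[OF S, of K v 0] by (simp add: moment_0 c_def)
  finally have c_pos: "0 < ip d c c" using v by (meson less_le_trans zero_less_power)
  have "ip d c c = (\<Sum>j\<in>J. (c j)\<^sup>2)"
    unfolding ip_def power2_eq_square using J c0 by (intro sum.mono_neutral_right) auto
  then have c_sq: "(\<Sum>j\<in>J. (c j)\<^sup>2) = (sqrt (ip d c c))\<^sup>2" using c_pos by simp
  have finJ: "finite J" using J finite_subset by blast
  let ?B1 = "{g \<in> space normal_tape. \<bar>\<Sum>j\<in>J. c j * g (\<pi> j)\<bar> < \<delta> / 4 * sqrt (ip d c c)}"
  let ?B2 = "{g \<in> space normal_tape. 4 * real d / \<delta> \<le> (\<Sum>j\<in>J. (g (\<pi> j))\<^sup>2)}"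
  have B1: "measure normal_tape ?B1 \<le> \<delta> / 4"
    using finJ J c_sq c_pos \<delta> by (intro normal_tape_anti_concentration) auto
  have "card J \<le> d" using card_mono[OF _ J(1)] by simp
  have "measure normal_tape ?B2 \<le> real (card J) / (4 * real d / \<delta>)"
    using \<delta> d by (intro normal_tape_norm_tail[OF finJ]) simp
  also have "\<dots> \<le> real d / (4 * real d / \<delta>)"
    using \<delta> \<open>card J \<le> d\<close> by (intro divide_right_mono) auto
  also have "\<dots> = \<delta> / 4" using d by simp
  finally have B2: "measure normal_tape ?B2 \<le> \<delta> / 4" .
  have [measurable]: "?B1 \<in> sets normal_tape" "?B2 \<in> sets normal_tape"
    by measurable
  have "1 - measure normal_tape (?B1 \<union> ?B2) = measure normal_tape (space normal_tape - (?B1 \<union> ?B2))"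
    by (intro normal_tape.prob_compl[symmetric]) measurable
  also have "\<dots> \<le> measure normal_tape ?G"
  proof (rule normal_tape.finite_measure_mono)
    show "?G \<in> sets normal_tape" unfolding S_def by measurable
    show "space normal_tape - (?B1 \<union> ?B2) \<subseteq> ?G"
    proof
      fix g assume g: "g \<in> space normal_tape - (?B1 \<union> ?B2)"
      let ?x = "start_vec J \<pi> g"
      have "ip d ?x ?x = (\<Sum>j\<in>J. (g (\<pi> j))\<^sup>2)"
        by (subst ip_start_vec[OF J(1)]) (auto intro!: sum.cong simp: start_vec_def power2_eq_square)
      then have 1: "ip d ?x ?x \<le> 4 * real d / \<delta>" using g by auto
      have 2: "\<delta> / 4 * sqrt (ip d ((S ^^ K) v) ((S ^^ K) v)) \<le> \<bar>ip d ((S ^^ K) v) ?x\<bar>"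
        using g by (auto simp: ip_start_vec[OF J(1)] c_def[symmetric])
      show "g \<in> ?G"
        using power_method_bounds[OF S upper v 2 _ 1 K \<eta>] \<delta> g by simp
    qed
  qed
  finally have "1 - measure normal_tape (?B1 \<union> ?B2) \<le> measure normal_tape ?G" .
  moreover have "measure normal_tape (?B1 \<union> ?B2) \<le> measure normal_tape ?B1 + measure normal_tape ?B2"
    by (intro measure_Un_le) measurable
  ultimately show ?thesis using B1 B2 by linarith
qed


section \<open>Timed execution of programs\<close>

definition wp :: "tape \<Rightarrow> com \<Rightarrow> state \<Rightarrow> (nat \<Rightarrow> state \<Rightarrow> bool) \<Rightarrow> bool" where
  "wp \<omega> c s Q \<longleftrightarrow> (\<exists>t s'. exec \<omega> c s t s' \<and> Q t s')"

lemma wp_mono: "wp \<omega> c s Q \<Longrightarrow> (\<And>t s'. Q t s' \<Longrightarrow> Q' t s') \<Longrightarrow> wp \<omega> c s Q'"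
  by (auto simp: wp_def)

lemma wp_Skip [simp]: "wp \<omega> Skip s Q \<longleftrightarrow> Q 1 s"
  using exec.Skip[of \<omega> s] by (auto simp: wp_def elim: exec_elims)

lemma wp_NAssign [simp]:
  "wp \<omega> (NAssign x i e) s Q \<longleftrightarrow> Q (1 + ncost i + ncost e) (nstore x (nval s i) (nval s e) s)"
  using exec.NAssign[of \<omega> x i e s] by (auto simp: wp_def elim: exec_elims)

lemma wp_RAssign [simp]:
  "wp \<omega> (RAssign x i e) s Q \<longleftrightarrow> Q (1 + ncost i + rcost e) (rstore x (nval s i) (rval s e) s)"
  using exec.RAssign[of \<omega> x i e s] by (auto simp: wp_def elim: exec_elims)

lemma wp_SampleUniform [simp]:
  "wp \<omega> (SampleUniform x i) s Q \<longleftrightarrow>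
    Q (1 + ncost i) ((rstore x (nval s i) (fst \<omega> (upos s)) s)\<lparr>upos := Suc (upos s)\<rparr>)"
  using exec.SampleUniform[of \<omega> x i s] by (auto simp: wp_def elim: exec_elims)

lemma wp_SampleNormal [simp]:
  "wp \<omega> (SampleNormal x i) s Q \<longleftrightarrow>
    Q (1 + ncost i) ((rstore x (nval s i) (snd \<omega> (gpos s)) s)\<lparr>gpos := Suc (gpos s)\<rparr>)"
  using exec.SampleNormal[of \<omega> x i s] by (auto simp: wp_def elim: exec_elims)

lemma wp_Seq [simp]:
  "wp \<omega> (Seq c c') s Q \<longleftrightarrow> wp \<omega> c s (\<lambda>t s'. wp \<omega> c' s' (\<lambda>t' s''. Q (t + t') s''))"
  by (auto simp: wp_def intro: exec.Seq elim!: exec_elims(6))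

lemma wp_If [simp]:
  "wp \<omega> (If b c c') s Q \<longleftrightarrow>
    (if bval s b then wp \<omega> c s (\<lambda>t. Q (1 + bcost b + t)) else wp \<omega> c' s (\<lambda>t. Q (1 + bcost b + t)))"
  by (auto simp: wp_def simp del: One_nat_def intro: exec.IfTrue exec.IfFalse elim!: exec_elims(7))
    (metis plus_1_eq_Suc add.assoc)+

lemma wp_While_True:
  "bval s b \<Longrightarrow> wp \<omega> c s (\<lambda>t s'. wp \<omega> (While b c) s' (\<lambda>t' s''. Q (1 + bcost b + t + t') s'')) \<Longrightarrow>
    wp \<omega> (While b c) s Q"
  unfolding wp_def by (metis exec.WhileTrue)

lemma wp_While_False: "\<not> bval s b \<Longrightarrow> Q (1 + bcost b) s \<Longrightarrow> wp \<omega> (While b c) s Q"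
  unfolding wp_def by (metis exec.WhileFalse)

lemma wp_While:
  assumes "I 0 s"
    and step: "\<And>j s. j < N \<Longrightarrow> I j s \<Longrightarrow> bval s b \<and> wp \<omega> c s (\<lambda>t s'. t \<le> B \<and> I (Suc j) s')"
    and stop: "\<And>s. I N s \<Longrightarrow> \<not> bval s b"
  shows "wp \<omega> (While b c) s (\<lambda>t s'. t \<le> (N + 1) * (1 + bcost b + B) \<and> I N s')"
proof -
  have "wp \<omega> (While b c) s (\<lambda>t s'. t \<le> (N - j + 1) * (1 + bcost b + B) \<and> I N s')"
    if "j \<le> N" "I j s" for j s
    using that
  proof (induction "N - j" arbitrary: j s)
    case 0
    then show ?case using stop by (intro wp_While_False) auto
  next
    case (Suc k)
    then have j: "j < N" "k = N - Suc j" "Suc j \<le> N" by auto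
    from step[OF j(1) Suc.prems(2)] have b: "bval s b"
      and body: "wp \<omega> c s (\<lambda>t s'. t \<le> B \<and> I (Suc j) s')" by auto
    from b show ?case
    proof (rule wp_While_True)
      show "wp \<omega> c s (\<lambda>t s'. wp \<omega> (While b c) s' (\<lambda>t' s''.
          1 + bcost b + t + t' \<le> (N - j + 1) * (1 + bcost b + B) \<and> I N s''))"
      proof (rule wp_mono[OF body])
        fix t s' assume *: "t \<le> B \<and> I (Suc j) s'"
        have "N - j = Suc (N - Suc j)" using j by simp
        then show "wp \<omega> (While b c) s' (\<lambda>t' s''. 1 + bcost b + t + t' \<le> (N - j + 1) * (1 + bcost b + B) \<and> I N s'')"
          using * by (intro wp_mono[OF Suc.hyps(1)[OF j(2,3)]]) auto
      qed
    qed
  qed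
  from this[of 0 s] assms(1) show ?thesis by simp
qed

primrec seqs :: "com list \<Rightarrow> com" where
  "seqs [] = Skip"
| "seqs (c # cs) = Seq c (seqs cs)"

abbreviation nvar :: "string \<Rightarrow> nexp" where "nvar x \<equiv> NCell x (NConst 0)"
abbreviation rvar :: "string \<Rightarrow> rexp" where "rvar x \<equiv> RCell x (NConst 0)"
abbreviation nset :: "string \<Rightarrow> nexp \<Rightarrow> com" where "nset x e \<equiv> NAssign x (NConst 0) e"
abbreviation rset :: "string \<Rightarrow> rexp \<Rightarrow> com" where "rset x e \<equiv> RAssign x (NConst 0) e"

definition for_loop :: "string \<Rightarrow> com \<Rightarrow> com" where
  "for_loop x c = Seq (nset ''i'' (NConst 0))
     (While (NLess (nvar ''i'') (nvar x)) (Seq c (nset ''i'' (NAdd (nvar ''i'') (NConst 1)))))"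

lemma mem_nstore [simp]:
  "nmem (nstore x i k s) = (nmem s)(x := (nmem s x)(i := k))" "rmem (nstore x i k s) = rmem s"
  "upos (nstore x i k s) = upos s" "gpos (nstore x i k s) = gpos s"
  by (simp_all add: nstore_def)

lemma mem_rstore [simp]:
  "rmem (rstore x i r s) = (rmem s)(x := (rmem s x)(i := r))" "nmem (rstore x i r s) = nmem s"
  "upos (rstore x i r s) = upos s" "gpos (rstore x i r s) = gpos s"
  by (simp_all add: rstore_def)

lemma wp_for_loop:
  assumes x: "x \<noteq> ''i''" "nmem s x 0 = N" and I0: "I 0 s"
    and I_i: "\<And>j k s. I j s \<Longrightarrow> I j (nstore ''i'' 0 k s)"
    and step: "\<And>j s. j < N \<Longrightarrow> I j s \<Longrightarrow> nmem s ''i'' 0 = j \<Longrightarrow> nmem s x 0 = N \<Longrightarrow>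
      wp \<omega> c s (\<lambda>t s'. t \<le> B \<and> nmem s' ''i'' 0 = j \<and> nmem s' x 0 = N \<and> I (Suc j) s')"
  shows "wp \<omega> (for_loop x c) s (\<lambda>t s'. t \<le> (N + 1) * (B + 20) \<and> I N s')"
proof -
  let ?I = "\<lambda>j s. I j s \<and> nmem s ''i'' 0 = j \<and> nmem s x 0 = N"
  let ?inc = "nset ''i'' (NAdd (nvar ''i'') (NConst 1))"
  let ?s = "nstore ''i'' 0 0 s"
  have "wp \<omega> (While (NLess (nvar ''i'') (nvar x)) (Seq c ?inc)) ?s
    (\<lambda>t s'. t \<le> (N + 1) * (1 + bcost (NLess (nvar ''i'') (nvar x)) + (B + 6)) \<and> ?I N s')"
  proof (rule wp_While[where I = ?I and N = N])
    show "?I 0 ?s" using x I_i[OF I0] by simp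
  next
    fix j s assume j: "j < N" and I: "?I j s"
    have "wp \<omega> c s (\<lambda>t s'. t \<le> B \<and> nmem s' ''i'' 0 = j \<and> nmem s' x 0 = N \<and> I (Suc j) s')"
      using j I by (intro step) auto
    then have "wp \<omega> (Seq c ?inc) s (\<lambda>t s'. t \<le> B + 6 \<and> ?I (Suc j) s')"
      unfolding wp_Seq by (rule wp_mono) (use x I_i in auto)
    with j I show "bval s (NLess (nvar ''i'') (nvar x)) \<and> wp \<omega> (Seq c ?inc) s (\<lambda>t s'. t \<le> B + 6 \<and> ?I (Suc j) s')"
      by simp
  qed auto
  then show ?thesis
    unfolding for_loop_def wp_Seq wp_NAssign by simp (erule wp_mono, simp add: algebra_simps)
qed

definition unchanged :: "string set \<Rightarrow> string set \<Rightarrow> state \<Rightarrow> state \<Rightarrow> bool" where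
  "unchanged NX RX s s' \<longleftrightarrow> (\<forall>x. x \<notin> NX \<longrightarrow> nmem s' x = nmem s x) \<and> (\<forall>x. x \<notin> RX \<longrightarrow> rmem s' x = rmem s x)"

lemma unchanged_refl: "unchanged NX RX s s"
  by (simp add: unchanged_def)

lemma unchanged_nmem: "unchanged NX RX s s' \<Longrightarrow> x \<notin> NX \<Longrightarrow> nmem s' x = nmem s x"
  and unchanged_rmem: "unchanged NX RX s s' \<Longrightarrow> x \<notin> RX \<Longrightarrow> rmem s' x = rmem s x"
  by (auto simp: unchanged_def)

primrec latest :: "(nat \<Rightarrow> nat) \<Rightarrow> (nat \<Rightarrow> real) \<Rightarrow> nat \<Rightarrow> nat \<Rightarrow> real" where
  "latest key f 0 = (\<lambda>_. 0)"
| "latest key f (Suc j) = (latest key f j)(key j := f j)"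

primrec accum :: "(nat \<Rightarrow> nat) \<Rightarrow> (nat \<Rightarrow> real) \<Rightarrow> nat \<Rightarrow> nat \<Rightarrow> real" where
  "accum key f 0 = (\<lambda>_. 0)"
| "accum key f (Suc j) = (accum key f j)(key j := accum key f j (key j) + f j)"

lemma accum_eq_sum: "accum key f j i = (\<Sum>k | k < j \<and> key k = i. f k)"
proof (induction j)
  case (Suc j)
  have "{k. k < Suc j \<and> key k = i} = (if key j = i then insert j {k. k < j \<and> key k = i} else {k. k < j \<and> key k = i})"
    by (auto simp: less_Suc_eq)
  then show ?case using Suc by auto
qed simp

lemma latest_eq: "latest key f j i = (if \<exists>k<j. key k = i then f (Max {k. k < j \<and> key k = i}) else 0)"
proof (induction j)
  case (Suc j)
  show ?case
  proof (cases "key j = i")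
    case True
    then have "Max {k. k < Suc j \<and> key k = i} = j" by (intro Max_eqI) auto
    then show ?thesis using True by auto
  next
    case False
    then have "{k. k < Suc j \<and> key k = i} = {k. k < j \<and> key k = i}" by (auto simp: less_Suc_eq)
    then show ?thesis using Suc False by (auto simp: less_Suc_eq)
  qed
qed simp

text \<open>Each entry redraws the variates of its row and of its column, and the last draw counts.  This
  avoids any pass over the possibly much larger sets of all rows and all columns.\<close>

definition scan_prog :: com where
  "scan_prog = for_loop ''nnz'' (seqs [
     RAssign ''rn'' (NCell ''row'' (nvar ''i'')) (RAdd (RCell ''rn'' (NCell ''row'' (nvar ''i'')))
       (RMul (RCell ''val'' (nvar ''i'')) (RCell ''val'' (nvar ''i'')))),
     rset ''F'' (RAdd (rvar ''F'') (RMul (RCell ''val'' (nvar ''i'')) (RCell ''val'' (nvar ''i'')))),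
     SampleUniform ''u'' (NCell ''row'' (nvar ''i'')),
     SampleNormal ''x'' (NCell ''col'' (nvar ''i''))])"

lemma wp_scan:
  fixes s :: state
  defines "R \<equiv> nmem s ''row''" and "C \<equiv> nmem s ''col''" and "V \<equiv> rmem s ''val''" and "N \<equiv> nmem s ''nnz'' 0"
  assumes "rmem s ''rn'' = (\<lambda>_. 0)" "rmem s ''F'' 0 = 0" "rmem s ''u'' = (\<lambda>_. 0)" "rmem s ''x'' = (\<lambda>_. 0)"
    "upos s = 0" "gpos s = 0"
  shows "wp \<omega> scan_prog s (\<lambda>t s'. t \<le> (N + 1) * 100 \<and>
    unchanged {''i''} {''rn'', ''F'', ''u'', ''x''} s s' \<and>
    rmem s' ''rn'' = accum R (\<lambda>k. V k * V k) N \<and> rmem s' ''F'' 0 = (\<Sum>k<N. V k * V k) \<and>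
    rmem s' ''u'' = latest R (fst \<omega>) N \<and> rmem s' ''x'' = latest C (snd \<omega>) N)"
proof -
  let ?I = "\<lambda>j s'. unchanged {''i''} {''rn'', ''F'', ''u'', ''x''} s s' \<and>
    rmem s' ''rn'' = accum R (\<lambda>k. V k * V k) j \<and> rmem s' ''F'' 0 = (\<Sum>k<j. V k * V k) \<and>
    rmem s' ''u'' = latest R (fst \<omega>) j \<and> rmem s' ''x'' = latest C (snd \<omega>) j \<and> upos s' = j \<and> gpos s' = j"
  show ?thesis
    unfolding scan_prog_def
  proof (rule wp_mono[OF wp_for_loop[where I = ?I and B = 80 and N = N]])
    show "?I 0 s" using assms(5-) by (simp add: unchanged_refl)
    show "\<And>j k s'. ?I j s' \<Longrightarrow> ?I j (nstore ''i'' 0 k s')" by (auto simp: unchanged_def)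
    fix j s' assume "?I j s'" "nmem s' ''i'' 0 = j" "nmem s' ''nnz'' 0 = N"
    moreover from this have "nmem s' ''row'' = R" "nmem s' ''col'' = C" "rmem s' ''val'' = V"
      by (auto simp: unchanged_def R_def C_def V_def)
    ultimately show "wp \<omega> (seqs [
       RAssign ''rn'' (NCell ''row'' (nvar ''i'')) (RAdd (RCell ''rn'' (NCell ''row'' (nvar ''i'')))
         (RMul (RCell ''val'' (nvar ''i'')) (RCell ''val'' (nvar ''i'')))),
       rset ''F'' (RAdd (rvar ''F'') (RMul (RCell ''val'' (nvar ''i'')) (RCell ''val'' (nvar ''i'')))),
       SampleUniform ''u'' (NCell ''row'' (nvar ''i'')),
       SampleNormal ''x'' (NCell ''col'' (nvar ''i''))]) s'
      (\<lambda>t s'. t \<le> 80 \<and> nmem s' ''i'' 0 = j \<and> nmem s' ''nnz'' 0 = N \<and> ?I (Suc j) s')"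
      by (simp add: unchanged_def)
  qed (auto simp: N_def)
qed

definition log_prog :: com where
  "log_prog = seqs [
     rset ''g'' (RDiv (RNat (nvar ''d'')) (RMul (rvar ''eps'') (rvar ''delta''))),
     rset ''pw'' (RNat (NConst 1)),
     nset ''ell'' (NConst 0),
     While (RLess (rvar ''pw'') (rvar ''g'')) (seqs [
       rset ''pw'' (RAdd (rvar ''pw'') (rvar ''pw'')),
       nset ''ell'' (NAdd (nvar ''ell'') (NConst 1))]),
     rset ''r'' (RDiv (RMul (RNat (NConst 128)) (RMul (RNat (nvar ''d'')) (RNat (nvar ''ell''))))
       (RMul (rvar ''eps'') (rvar ''eps'')))]"

definition ceil_log2 :: "real \<Rightarrow> nat" where
  "ceil_log2 g = (LEAST j. g \<le> 2 ^ j)"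

lemma le_two_power_ceil_log2: "g \<le> 2 ^ ceil_log2 g"
proof -
  obtain j where "g < 2 ^ j" using real_arch_pow[of 2 g] by auto
  then show ?thesis unfolding ceil_log2_def by (rule LeastI[of _ j, OF less_imp_le])
qed

lemma less_ceil_log2: "j < ceil_log2 g \<Longrightarrow> 2 ^ j < g"
  unfolding ceil_log2_def using not_less_Least by force

lemma wp_log:
  fixes s :: state
  defines "g \<equiv> real (nmem s ''d'' 0) / (rmem s ''eps'' 0 * rmem s ''delta'' 0)"
  shows "wp \<omega> log_prog s (\<lambda>t s'. t \<le> (ceil_log2 g + 1) * 100 \<and>
    unchanged {''ell''} {''g'', ''pw'', ''r''} s s' \<and> nmem s' ''ell'' 0 = ceil_log2 g \<and>
    rmem s' ''r'' 0 = 128 * (real (nmem s ''d'' 0) * real (ceil_log2 g)) / (rmem s ''eps'' 0 * rmem s ''eps'' 0))"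
proof -
  let ?I = "\<lambda>j s'. unchanged {''ell''} {''g'', ''pw'', ''r''} s s' \<and> nmem s' ''ell'' 0 = j \<and>
    rmem s' ''g'' 0 = g \<and> rmem s' ''pw'' 0 = 2 ^ j"
  let ?b = "RLess (rvar ''pw'') (rvar ''g'')"
  let ?c = "seqs [rset ''pw'' (RAdd (rvar ''pw'') (rvar ''pw'')), nset ''ell'' (NAdd (nvar ''ell'') (NConst 1))]"
  have loop: "wp \<omega> (While ?b ?c) s'
    (\<lambda>t s'. t \<le> (ceil_log2 g + 1) * (1 + bcost ?b + 20) \<and> ?I (ceil_log2 g) s')" if "?I 0 s'" for s'
  proof (rule wp_While[where I = ?I])
    show "?I 0 s'" by (rule that)
  next
    fix j s' assume "j < ceil_log2 g" "?I j s'"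
    then show "bval s' ?b \<and> wp \<omega> ?c s' (\<lambda>t s'. t \<le> 20 \<and> ?I (Suc j) s')"
      using less_ceil_log2[of j g] by (simp add: unchanged_def)
  next
    fix s' assume "?I (ceil_log2 g) s'"
    then show "\<not> bval s' ?b" using le_two_power_ceil_log2[of g] by simp
  qed
  show ?thesis
    unfolding log_prog_def seqs.simps wp_Seq[of _ "rset _ _"] wp_Seq[of _ "nset _ _"] wp_RAssign wp_NAssign
    by (subst wp_Seq, rule wp_mono[OF loop[unfolded seqs.simps]]) (auto simp: unchanged_def g_def)
qed


definition sample_prog :: com where
  "sample_prog = for_loop ''nnz'' (If
     (RLess (RMul (RCell ''u'' (NCell ''row'' (nvar ''i''))) (rvar ''F''))
       (RMul (rvar ''r'') (RCell ''rn'' (NCell ''row'' (nvar ''i'')))))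
     (seqs [
       NAssign ''kr'' (nvar ''nk'') (NCell ''row'' (nvar ''i'')),
       NAssign ''kc'' (nvar ''nk'') (NCell ''col'' (nvar ''i'')),
       RAssign ''kv'' (nvar ''nk'') (RCell ''val'' (nvar ''i'')),
       If (RLess (RMul (rvar ''r'') (RCell ''rn'' (NCell ''row'' (nvar ''i'')))) (rvar ''F''))
         (RAssign ''kw'' (nvar ''nk'') (RMul (RDiv (rvar ''F'')
           (RMul (rvar ''r'') (RCell ''rn'' (NCell ''row'' (nvar ''i''))))) (RCell ''val'' (nvar ''i''))))
         (RAssign ''kw'' (nvar ''nk'') (RCell ''val'' (nvar ''i''))),
       nset ''nk'' (NAdd (nvar ''nk'') (NConst 1))])
     Skip)"

definition cap_prog :: com where
  "cap_prog = If (RLess (RMul (RNat (NConst 3)) (RMul (RNat (nvar ''d'')) (rvar ''r''))) (RNat (nvar ''nk'')))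
     (nset ''nk'' (NConst 0)) Skip"

definition kept :: "(nat \<Rightarrow> nat) \<Rightarrow> (nat \<Rightarrow> nat) \<Rightarrow> (nat \<Rightarrow> real) \<Rightarrow> (nat \<Rightarrow> real) \<Rightarrow> nat list \<Rightarrow> state \<Rightarrow> bool" where
  "kept R C V W ks s \<longleftrightarrow> nmem s ''nk'' 0 = length ks \<and> (\<forall>p < length ks.
     nmem s ''kr'' p = R (ks ! p) \<and> nmem s ''kc'' p = C (ks ! p) \<and>
     rmem s ''kv'' p = V (ks ! p) \<and> rmem s ''kw'' p = W (ks ! p))"

definition row_weight :: "real \<Rightarrow> real \<Rightarrow> real" where
  "row_weight F b = (if b < F then F / b else 1)"

lemma wp_sample:
  fixes s :: state
  defines "R \<equiv> nmem s ''row''" and "C \<equiv> nmem s ''col''" and "V \<equiv> rmem s ''val''" and "N \<equiv> nmem s ''nnz'' 0"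
    and "F \<equiv> rmem s ''F'' 0" and "r \<equiv> rmem s ''r'' 0" and "rn \<equiv> rmem s ''rn''" and "u \<equiv> rmem s ''u''"
  assumes "nmem s ''nk'' 0 = 0"
  shows "wp \<omega> sample_prog s (\<lambda>t s'. t \<le> (N + 1) * 120 \<and>
    unchanged {''i'', ''kr'', ''kc'', ''nk''} {''kv'', ''kw''} s s' \<and>
    kept R C V (\<lambda>k. row_weight F (r * rn (R k)) * V k) (filter (\<lambda>k. u (R k) * F < r * rn (R k)) [0..<N]) s')"
proof -
  let ?ks = "\<lambda>j. filter (\<lambda>k. u (R k) * F < r * rn (R k)) [0..<j]"
  let ?I = "\<lambda>j s'. unchanged {''i'', ''kr'', ''kc'', ''nk''} {''kv'', ''kw''} s s' \<and>
    kept R C V (\<lambda>k. row_weight F (r * rn (R k)) * V k) (?ks j) s'"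
  show ?thesis
    unfolding sample_prog_def
  proof (rule wp_mono[OF wp_for_loop[where I = ?I and B = 100 and N = N]])
    show "?I 0 s" using assms(9) by (simp add: unchanged_refl kept_def)
    show "\<And>j k s'. ?I j s' \<Longrightarrow> ?I j (nstore ''i'' 0 k s')" by (auto simp: unchanged_def kept_def)
    fix j s' assume I: "?I j s'" and i: "nmem s' ''i'' 0 = j" "nmem s' ''nnz'' 0 = N"
    moreover from I have "nmem s' ''row'' = R" "nmem s' ''col'' = C" "rmem s' ''val'' = V"
      "rmem s' ''F'' 0 = F" "rmem s' ''r'' 0 = r" "rmem s' ''rn'' = rn" "rmem s' ''u'' = u"
      by (auto simp: unchanged_def R_def C_def V_def F_def r_def rn_def u_def)
    moreover have "nmem s' ''nk'' 0 = length (?ks j)" using I by (simp add: kept_def)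
    ultimately show "wp \<omega> (If
     (RLess (RMul (RCell ''u'' (NCell ''row'' (nvar ''i''))) (rvar ''F''))
       (RMul (rvar ''r'') (RCell ''rn'' (NCell ''row'' (nvar ''i'')))))
     (seqs [
       NAssign ''kr'' (nvar ''nk'') (NCell ''row'' (nvar ''i'')),
       NAssign ''kc'' (nvar ''nk'') (NCell ''col'' (nvar ''i'')),
       RAssign ''kv'' (nvar ''nk'') (RCell ''val'' (nvar ''i'')),
       If (RLess (RMul (rvar ''r'') (RCell ''rn'' (NCell ''row'' (nvar ''i'')))) (rvar ''F''))
         (RAssign ''kw'' (nvar ''nk'') (RMul (RDiv (rvar ''F'')
           (RMul (rvar ''r'') (RCell ''rn'' (NCell ''row'' (nvar ''i''))))) (RCell ''val'' (nvar ''i''))))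
         (RAssign ''kw'' (nvar ''nk'') (RCell ''val'' (nvar ''i''))),
       nset ''nk'' (NAdd (nvar ''nk'') (NConst 1))])
     Skip) s' (\<lambda>t s'. t \<le> 100 \<and> nmem s' ''i'' 0 = j \<and> nmem s' ''nnz'' 0 = N \<and> ?I (Suc j) s')"
      by (cases "u (R j) * F < r * rn (R j)"; cases "r * rn (R j) < F")
        (simp_all add: unchanged_def kept_def nth_append row_weight_def less_Suc_eq)
  qed (auto simp: N_def)
qed

lemma wp_cap:
  assumes "kept R C V W ks s"
  shows "wp \<omega> cap_prog s (\<lambda>t s'. t \<le> 30 \<and> unchanged {''nk''} {} s s' \<and>
    kept R C V W (if 3 * (real (nmem s ''d'' 0) * rmem s ''r'' 0) < real (length ks) then [] else ks) s')"
  using assms by (auto simp: cap_prog_def kept_def unchanged_def)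

context
  fixes R C :: "nat \<Rightarrow> nat" and V W :: "nat \<Rightarrow> real" and ks :: "nat list"
begin

definition pow_rows :: "(nat \<Rightarrow> real) \<Rightarrow> nat \<Rightarrow> real" where
  "pow_rows X = accum (\<lambda>p. R (ks ! p)) (\<lambda>p. V (ks ! p) * X (C (ks ! p))) (length ks)"

definition pow_step :: "(nat \<Rightarrow> real) \<Rightarrow> nat \<Rightarrow> real" where
  "pow_step X = accum (\<lambda>p. C (ks ! p)) (\<lambda>p. W (ks ! p) * pow_rows X (R (ks ! p))) (length ks)"

definition pow_form :: "(nat \<Rightarrow> real) \<Rightarrow> (nat \<Rightarrow> real) \<Rightarrow> real" where
  "pow_form X Z = (\<Sum>p<length ks. W (ks ! p) * pow_rows X (R (ks ! p)) * Z (C (ks ! p)))"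

end

definition pow_prog :: com where
  "pow_prog = seqs [
     for_loop ''nk'' (seqs [
       RAssign ''y'' (NCell ''kr'' (nvar ''i'')) (RNat (NConst 0)),
       RAssign ''z'' (NCell ''kc'' (nvar ''i'')) (RNat (NConst 0))]),
     for_loop ''nk'' (
       RAssign ''y'' (NCell ''kr'' (nvar ''i'')) (RAdd (RCell ''y'' (NCell ''kr'' (nvar ''i'')))
         (RMul (RCell ''kv'' (nvar ''i'')) (RCell ''x'' (NCell ''kc'' (nvar ''i'')))))),
     rset ''den'' (RNat (NConst 0)),
     for_loop ''nk'' (seqs [
       RAssign ''z'' (NCell ''kc'' (nvar ''i'')) (RAdd (RCell ''z'' (NCell ''kc'' (nvar ''i'')))
         (RMul (RCell ''kw'' (nvar ''i'')) (RCell ''y'' (NCell ''kr'' (nvar ''i''))))),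
       rset ''den'' (RAdd (rvar ''den'') (RMul (RMul (RCell ''kw'' (nvar ''i''))
         (RCell ''y'' (NCell ''kr'' (nvar ''i'')))) (RCell ''x'' (NCell ''kc'' (nvar ''i'')))))]),
     rset ''num'' (RNat (NConst 0)),
     for_loop ''nk'' (seqs [
       rset ''num'' (RAdd (rvar ''num'') (RMul (RMul (RCell ''kw'' (nvar ''i''))
         (RCell ''y'' (NCell ''kr'' (nvar ''i'')))) (RCell ''z'' (NCell ''kc'' (nvar ''i''))))),
       RAssign ''x'' (NCell ''kc'' (nvar ''i'')) (RCell ''z'' (NCell ''kc'' (nvar ''i'')))]),
     rset ''out'' (RDiv (rvar ''num'') (rvar ''den'')),
     nset ''it'' (NAdd (nvar ''it'') (NConst 1))]"

lemma wp_pow: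
  assumes K: "kept R C V W ks s" and X: "\<forall>p<length ks. rmem s ''x'' (C (ks ! p)) = X (C (ks ! p))"
  defines "Z \<equiv> pow_step R C V W ks X" and "f \<equiv> pow_form R C V W ks X"
  shows "wp \<omega> pow_prog s (\<lambda>t s'. t \<le> (length ks + 1) * 500 \<and>
    unchanged {''i'', ''it''} {''x'', ''y'', ''z'', ''den'', ''num'', ''out''} s s' \<and>
    (\<forall>p<length ks. rmem s' ''x'' (C (ks ! p)) = Z (C (ks ! p))) \<and>
    rmem s' ''out'' 0 = f Z / f X \<and> nmem s' ''it'' 0 = Suc (nmem s ''it'' 0))"
proof -
  let ?RX = "{''x'', ''y'', ''z'', ''den'', ''num'', ''out''}"
  let ?U = "\<lambda>s'. unchanged {''i''} ?RX s s'"
  define Y where "Y = pow_rows R C V ks X"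
  have mem: "nmem s' ''nk'' 0 = length ks" "\<And>p. p < length ks \<Longrightarrow> nmem s' ''kr'' p = R (ks ! p)"
    "\<And>p. p < length ks \<Longrightarrow> nmem s' ''kc'' p = C (ks ! p)" "\<And>p. p < length ks \<Longrightarrow> rmem s' ''kv'' p = V (ks ! p)"
    "\<And>p. p < length ks \<Longrightarrow> rmem s' ''kw'' p = W (ks ! p)" if "?U s'" for s'
    using that K by (auto simp: unchanged_def kept_def)
  let ?P = "\<lambda>s'. ?U s' \<and> (\<forall>p<length ks. rmem s' ''x'' (C (ks ! p)) = X (C (ks ! p)))"
  let ?I1 = "\<lambda>j s'. ?P s' \<and> (\<forall>p<j. rmem s' ''y'' (R (ks ! p)) = 0 \<and> rmem s' ''z'' (C (ks ! p)) = 0)"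
  let ?I2 = "\<lambda>j s'. ?P s' \<and> (\<forall>p<length ks. rmem s' ''z'' (C (ks ! p)) = 0 \<and>
    rmem s' ''y'' (R (ks ! p)) = accum (\<lambda>p. R (ks ! p)) (\<lambda>p. V (ks ! p) * X (C (ks ! p))) j (R (ks ! p)))"
  let ?I3 = "\<lambda>j s'. ?P s' \<and> (\<forall>p<length ks. rmem s' ''y'' (R (ks ! p)) = Y (R (ks ! p)) \<and>
    rmem s' ''z'' (C (ks ! p)) = accum (\<lambda>p. C (ks ! p)) (\<lambda>p. W (ks ! p) * Y (R (ks ! p))) j (C (ks ! p))) \<and>
    rmem s' ''den'' 0 = (\<Sum>p<j. W (ks ! p) * Y (R (ks ! p)) * X (C (ks ! p)))"
  let ?I4 = "\<lambda>j s'. ?U s' \<and> rmem s' ''den'' 0 = f X \<and> (\<forall>p<length ks. rmem s' ''y'' (R (ks ! p)) = Y (R (ks ! p)) \<and>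
    rmem s' ''z'' (C (ks ! p)) = Z (C (ks ! p))) \<and> (\<forall>p<j. rmem s' ''x'' (C (ks ! p)) = Z (C (ks ! p))) \<and>
    rmem s' ''num'' 0 = (\<Sum>p<j. W (ks ! p) * Y (R (ks ! p)) * Z (C (ks ! p)))"
  let ?c1 = "seqs [
       RAssign ''y'' (NCell ''kr'' (nvar ''i'')) (RNat (NConst 0)),
       RAssign ''z'' (NCell ''kc'' (nvar ''i'')) (RNat (NConst 0))]"
  let ?c2 = "RAssign ''y'' (NCell ''kr'' (nvar ''i'')) (RAdd (RCell ''y'' (NCell ''kr'' (nvar ''i'')))
         (RMul (RCell ''kv'' (nvar ''i'')) (RCell ''x'' (NCell ''kc'' (nvar ''i'')))))"
  let ?c3 = "seqs [
       RAssign ''z'' (NCell ''kc'' (nvar ''i'')) (RAdd (RCell ''z'' (NCell ''kc'' (nvar ''i'')))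
         (RMul (RCell ''kw'' (nvar ''i'')) (RCell ''y'' (NCell ''kr'' (nvar ''i''))))),
       rset ''den'' (RAdd (rvar ''den'') (RMul (RMul (RCell ''kw'' (nvar ''i''))
         (RCell ''y'' (NCell ''kr'' (nvar ''i'')))) (RCell ''x'' (NCell ''kc'' (nvar ''i'')))))]"
  let ?c4 = "seqs [
       rset ''num'' (RAdd (rvar ''num'') (RMul (RMul (RCell ''kw'' (nvar ''i''))
         (RCell ''y'' (NCell ''kr'' (nvar ''i'')))) (RCell ''z'' (NCell ''kc'' (nvar ''i''))))),
       RAssign ''x'' (NCell ''kc'' (nvar ''i'')) (RCell ''z'' (NCell ''kc'' (nvar ''i'')))]"
  have l1: "wp \<omega> (for_loop ''nk'' ?c1) s' (\<lambda>t s'. t \<le> (length ks + 1) * (60 + 20) \<and> ?I1 (length ks) s')" if "?P s'" for s'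
  proof (rule wp_for_loop[where I = ?I1 and N = "length ks" and B = 60])
    show "?I1 0 s'" using that by simp
    fix j s' assume "j < length ks" "?I1 j s'" "nmem s' ''i'' 0 = j" "nmem s' ''nk'' 0 = length ks"
    then show "wp \<omega> ?c1 s' (\<lambda>t s'. t \<le> 60 \<and> nmem s' ''i'' 0 = j \<and> nmem s' ''nk'' 0 = length ks \<and> ?I1 (Suc j) s')"
      using mem[of s'] by (auto simp: unchanged_def less_Suc_eq)
  qed (use that mem[of s'] in \<open>auto simp: unchanged_def\<close>)
  have l2: "wp \<omega> (for_loop ''nk'' ?c2) s' (\<lambda>t s'. t \<le> (length ks + 1) * (60 + 20) \<and> ?I2 (length ks) s')" if "?I2 0 s'" for s'
  proof (rule wp_for_loop[where I = ?I2 and N = "length ks" and B = 60])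
    show "?I2 0 s'" by (rule that)
    fix j s' assume "j < length ks" "?I2 j s'" "nmem s' ''i'' 0 = j" "nmem s' ''nk'' 0 = length ks"
    then show "wp \<omega> ?c2 s' (\<lambda>t s'. t \<le> 60 \<and> nmem s' ''i'' 0 = j \<and> nmem s' ''nk'' 0 = length ks \<and> ?I2 (Suc j) s')"
      using mem[of s'] by (auto simp: unchanged_def)
  qed (use that mem[of s'] in \<open>auto simp: unchanged_def\<close>)
  have l3: "wp \<omega> (for_loop ''nk'' ?c3) s' (\<lambda>t s'. t \<le> (length ks + 1) * (80 + 20) \<and> ?I3 (length ks) s')" if "?I3 0 s'" for s'
  proof (rule wp_for_loop[where I = ?I3 and N = "length ks" and B = 80])
    show "?I3 0 s'" by (rule that)
    fix j s' assume "j < length ks" "?I3 j s'" "nmem s' ''i'' 0 = j" "nmem s' ''nk'' 0 = length ks"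
    then show "wp \<omega> ?c3 s' (\<lambda>t s'. t \<le> 80 \<and> nmem s' ''i'' 0 = j \<and> nmem s' ''nk'' 0 = length ks \<and> ?I3 (Suc j) s')"
      using mem[of s'] by (auto simp: unchanged_def)
  qed (use that mem[of s'] in \<open>auto simp: unchanged_def\<close>)
  have l4: "wp \<omega> (for_loop ''nk'' ?c4) s' (\<lambda>t s'. t \<le> (length ks + 1) * (80 + 20) \<and> ?I4 (length ks) s')" if "?I4 0 s'" for s'
  proof (rule wp_for_loop[where I = ?I4 and N = "length ks" and B = 80])
    show "?I4 0 s'" by (rule that)
    fix j s' assume "j < length ks" "?I4 j s'" "nmem s' ''i'' 0 = j" "nmem s' ''nk'' 0 = length ks"
    then show "wp \<omega> ?c4 s' (\<lambda>t s'. t \<le> 80 \<and> nmem s' ''i'' 0 = j \<and> nmem s' ''nk'' 0 = length ks \<and> ?I4 (Suc j) s')"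
      using mem[of s'] by (auto simp: unchanged_def less_Suc_eq)
  qed (use that mem[of s'] in \<open>auto simp: unchanged_def\<close>)
  have "?P s" using X by (simp add: unchanged_refl)
  show ?thesis
    unfolding pow_prog_def seqs.simps
    apply (subst wp_Seq)
    apply (rule wp_mono[OF l1[unfolded seqs.simps, OF \<open>?P s\<close>]])
    apply (subst wp_Seq)
    apply (rule wp_mono[OF l2])
     apply simp
    apply (subst wp_Seq, subst wp_RAssign, subst wp_Seq)
    apply (rule wp_mono[OF l3[unfolded seqs.simps]])
     apply (simp add: unchanged_def Y_def pow_rows_def)
    apply (subst wp_Seq, subst wp_RAssign, subst wp_Seq)
    apply (rule wp_mono[OF l4[unfolded seqs.simps]])
     apply (simp add: unchanged_def Z_def Y_def f_def pow_step_def pow_form_def)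
    apply (simp add: unchanged_def f_def pow_form_def Y_def)
    done
qed

definition norm_prog :: com where
  "norm_prog = seqs [
     scan_prog,
     rset ''out'' (rvar ''F''),
     If (BAnd (NLess (NConst 1) (nvar ''d'')) (NLess (NConst 0) (nvar ''nnz'')))
       (seqs [
         log_prog,
         sample_prog,
         cap_prog,
         While (RLess (RMul (RNat (nvar ''it'')) (rvar ''eps'')) (RMul (RNat (NConst 9)) (RNat (nvar ''ell'')))) pow_prog])
       Skip]"

definition num_iter :: "real \<Rightarrow> nat \<Rightarrow> nat" where
  "num_iter \<epsilon> l = nat \<lceil>9 * real l / \<epsilon>\<rceil>"

lemma less_num_iter_iff: "0 < \<epsilon> \<Longrightarrow> real t * \<epsilon> < 9 * real l \<longleftrightarrow> t < num_iter \<epsilon> l"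
  unfolding num_iter_def by (simp add: zless_nat_eq_int_zless less_ceiling_iff pos_less_divide_eq)

lemma wp_pow_loop:
  assumes K: "kept R C V W ks s" and x: "rmem s ''x'' = X" and it: "nmem s ''it'' 0 = 0"
    and \<epsilon>: "0 < rmem s ''eps'' 0"
  defines "N \<equiv> num_iter (rmem s ''eps'' 0) (nmem s ''ell'' 0)"
    and "Y \<equiv> \<lambda>t. (pow_step R C V W ks ^^ t) X"
  shows "wp \<omega> (While (RLess (RMul (RNat (nvar ''it'')) (rvar ''eps'')) (RMul (RNat (NConst 9)) (RNat (nvar ''ell'')))) pow_prog) s
    (\<lambda>t s'. t \<le> (N + 1) * ((length ks + 1) * 500 + 20) \<and>
      rmem s' ''out'' 0 = (if N = 0 then rmem s ''out'' 0 else
        pow_form R C V W ks (Y (N - 1)) (Y N) / pow_form R C V W ks (Y (N - 1)) (Y (N - 1))))"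
proof -
  let ?b = "RLess (RMul (RNat (nvar ''it'')) (rvar ''eps'')) (RMul (RNat (NConst 9)) (RNat (nvar ''ell'')))"
  let ?I = "\<lambda>t s'. unchanged {''i'', ''it''} {''x'', ''y'', ''z'', ''den'', ''num'', ''out''} s s' \<and>
    nmem s' ''it'' 0 = t \<and> (\<forall>p<length ks. rmem s' ''x'' (C (ks ! p)) = Y t (C (ks ! p))) \<and>
    rmem s' ''out'' 0 = (if t = 0 then rmem s ''out'' 0 else
        pow_form R C V W ks (Y (t - 1)) (Y t) / pow_form R C V W ks (Y (t - 1)) (Y (t - 1)))"
  have b: "bval s' ?b \<longleftrightarrow> t < N" if "?I t s'" for t s'
    using that less_num_iter_iff[OF \<epsilon>, of t "nmem s ''ell'' 0"] by (simp add: unchanged_def N_def)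
  have "wp \<omega> (While ?b pow_prog) s (\<lambda>t s'. t \<le> (N + 1) * (1 + bcost ?b + (length ks + 1) * 500) \<and> ?I N s')"
  proof (rule wp_While[where I = ?I and N = N])
    show "?I 0 s" using x it by (simp add: unchanged_refl Y_def)
    fix t s' assume t: "t < N" and I: "?I t s'"
    have "kept R C V W ks s'" using K I by (simp add: kept_def unchanged_def)
    with I have "wp \<omega> pow_prog s' (\<lambda>t' s''. t' \<le> (length ks + 1) * 500 \<and>
      unchanged {''i'', ''it''} {''x'', ''y'', ''z'', ''den'', ''num'', ''out''} s' s'' \<and>
      (\<forall>p<length ks. rmem s'' ''x'' (C (ks ! p)) = pow_step R C V W ks (Y t) (C (ks ! p))) \<and>
      rmem s'' ''out'' 0 = pow_form R C V W ks (Y t) (pow_step R C V W ks (Y t)) / pow_form R C V W ks (Y t) (Y t) \<and>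
      nmem s'' ''it'' 0 = Suc (nmem s' ''it'' 0))"
      by (intro wp_pow) auto
    then show "bval s' ?b \<and> wp \<omega> pow_prog s' (\<lambda>t' s''. t' \<le> (length ks + 1) * 500 \<and> ?I (Suc t) s'')"
      using b[OF I] t I by (auto elim!: wp_mono simp: unchanged_def Y_def)
  qed (use b in auto)
  moreover have "(N + 1) * (1 + bcost ?b + (length ks + 1) * 500) \<le> (N + 1) * ((length ks + 1) * 500 + 20)"
    by (intro mult_le_mono2) simp
  ultimately show ?thesis
    by (elim wp_mono conjE) (intro conjI, erule order_trans, assumption+)
qed

definition entry_row :: "(nat \<times> nat \<times> real) list \<Rightarrow> nat \<Rightarrow> nat" where
  "entry_row es k = (if k < length es then fst (es ! k) else 0)"

definition entry_col :: "(nat \<times> nat \<times> real) list \<Rightarrow> nat \<Rightarrow> nat" where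
  "entry_col es k = (if k < length es then fst (snd (es ! k)) else 0)"

definition entry_val :: "(nat \<times> nat \<times> real) list \<Rightarrow> nat \<Rightarrow> real" where
  "entry_val es k = (if k < length es then snd (snd (es ! k)) else 0)"

definition row_norm2 :: "(nat \<times> nat \<times> real) list \<Rightarrow> nat \<Rightarrow> real" where
  "row_norm2 es = accum (entry_row es) (\<lambda>k. entry_val es k * entry_val es k) (length es)"

definition frob2 :: "(nat \<times> nat \<times> real) list \<Rightarrow> real" where
  "frob2 es = (\<Sum>k<length es. entry_val es k * entry_val es k)"

definition log_factor :: "nat \<Rightarrow> real \<Rightarrow> real \<Rightarrow> nat" where
  "log_factor d \<epsilon> \<delta> = ceil_log2 (real d / (\<epsilon> * \<delta>))"

definition sample_size :: "nat \<Rightarrow> real \<Rightarrow> real \<Rightarrow> real" where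
  "sample_size d \<epsilon> \<delta> = 128 * (real d * real (log_factor d \<epsilon> \<delta>)) / (\<epsilon> * \<epsilon>)"

definition sampled_entries :: "nat \<Rightarrow> (nat \<times> nat \<times> real) list \<Rightarrow> real \<Rightarrow> real \<Rightarrow> (nat \<Rightarrow> real) \<Rightarrow> nat list" where
  "sampled_entries d es \<epsilon> \<delta> u =
     (let ks = filter (\<lambda>k. latest (entry_row es) u (length es) (entry_row es k) * frob2 es
            < sample_size d \<epsilon> \<delta> * row_norm2 es (entry_row es k)) [0..<length es]
      in if 3 * (real d * sample_size d \<epsilon> \<delta>) < real (length ks) then [] else ks)"

definition scaled_val :: "nat \<Rightarrow> (nat \<times> nat \<times> real) list \<Rightarrow> real \<Rightarrow> real \<Rightarrow> nat \<Rightarrow> real" where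
  "scaled_val d es \<epsilon> \<delta> k =
     row_weight (frob2 es) (sample_size d \<epsilon> \<delta> * row_norm2 es (entry_row es k)) * entry_val es k"

lemma wp_norm_prog:
  fixes es :: "(nat \<times> nat \<times> real) list" and d n :: nat and \<epsilon> \<delta> :: real and \<omega> :: tape
  assumes \<epsilon>: "0 < \<epsilon>"
  defines "N \<equiv> length es" and "ks \<equiv> sampled_entries d es \<epsilon> \<delta> (fst \<omega>)"
    and "K \<equiv> num_iter \<epsilon> (log_factor d \<epsilon> \<delta>)"
  defines "step \<equiv> pow_step (entry_row es) (entry_col es) (entry_val es) (scaled_val d es \<epsilon> \<delta>) ks"
    and "form \<equiv> pow_form (entry_row es) (entry_col es) (entry_val es) (scaled_val d es \<epsilon> \<delta>) ks"
    and "x \<equiv> latest (entry_col es) (snd \<omega>) N"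
  shows "wp \<omega> norm_prog (init_state n d es \<epsilon> \<delta>) (\<lambda>t s.
    t \<le> 1000 * (N + 1) + (if 1 < d \<and> 0 < N then 1000 * (log_factor d \<epsilon> \<delta> + 1) + 1000 * (K + 1) * (length ks + 1) else 0) \<and>
    estimate s = (if 1 < d \<and> 0 < N \<and> 0 < K
      then form ((step ^^ (K - 1)) x) ((step ^^ K) x) / form ((step ^^ (K - 1)) x) ((step ^^ (K - 1)) x)
      else frob2 es))"
proof -
  let ?s0 = "init_state n d es \<epsilon> \<delta>"
  let ?R = "entry_row es" and ?C = "entry_col es" and ?V = "entry_val es" and ?W = "scaled_val d es \<epsilon> \<delta>"
  let ?l = "log_factor d \<epsilon> \<delta>" and ?r = "sample_size d \<epsilon> \<delta>"
  let ?b = "RLess (RMul (RNat (nvar ''it'')) (rvar ''eps'')) (RMul (RNat (NConst 9)) (RNat (nvar ''ell'')))"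
  let ?main = "seqs [log_prog, sample_prog, cap_prog, While ?b pow_prog]"
  define J where "J s \<longleftrightarrow> nmem s ''row'' = ?R \<and> nmem s ''col'' = ?C \<and> rmem s ''val'' = ?V \<and>
    nmem s ''nnz'' 0 = N \<and> nmem s ''d'' 0 = d \<and> rmem s ''eps'' 0 = \<epsilon> \<and> rmem s ''delta'' 0 = \<delta> \<and>
    nmem s ''nk'' 0 = 0 \<and> nmem s ''it'' 0 = 0 \<and> rmem s ''rn'' = row_norm2 es \<and> rmem s ''F'' 0 = frob2 es \<and>
    rmem s ''u'' = latest ?R (fst \<omega>) N \<and> rmem s ''x'' = x" for s :: state
  have init: "nmem ?s0 ''row'' = ?R" "nmem ?s0 ''col'' = ?C" "rmem ?s0 ''val'' = ?V" "nmem ?s0 ''nnz'' 0 = N"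
    by (auto simp: init_state_def entry_row_def entry_col_def entry_val_def N_def fun_eq_iff)
  have init': "nmem ?s0 ''d'' 0 = d" "rmem ?s0 ''eps'' 0 = \<epsilon>" "rmem ?s0 ''delta'' 0 = \<delta>"
    "nmem ?s0 ''nk'' 0 = 0" "nmem ?s0 ''it'' 0 = 0"
    by (simp_all add: init_state_def)
  have scan: "wp \<omega> scan_prog ?s0 (\<lambda>t s. t \<le> (N + 1) * 100 \<and> J s)"
  proof (rule wp_mono[OF wp_scan[of ?s0 \<omega>]])
    fix t s
    assume *: "t \<le> (nmem ?s0 ''nnz'' 0 + 1) * 100 \<and> unchanged {''i''} {''rn'', ''F'', ''u'', ''x''} ?s0 s \<and>
      rmem s ''rn'' = accum (nmem ?s0 ''row'') (\<lambda>k. rmem ?s0 ''val'' k * rmem ?s0 ''val'' k) (nmem ?s0 ''nnz'' 0) \<and>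
      rmem s ''F'' 0 = (\<Sum>k<nmem ?s0 ''nnz'' 0. rmem ?s0 ''val'' k * rmem ?s0 ''val'' k) \<and>
      rmem s ''u'' = latest (nmem ?s0 ''row'') (fst \<omega>) (nmem ?s0 ''nnz'' 0) \<and>
      rmem s ''x'' = latest (nmem ?s0 ''col'') (snd \<omega>) (nmem ?s0 ''nnz'' 0)"
    then have u: "unchanged {''i''} {''rn'', ''F'', ''u'', ''x''} ?s0 s" by blast
    have "nmem s a = nmem ?s0 a" if "a \<noteq> ''i''" for a
      using unchanged_nmem[OF u] that by simp
    then have n: "nmem s ''row'' = ?R" "nmem s ''col'' = ?C" "nmem s ''nnz'' 0 = N" "nmem s ''d'' 0 = d"
        "nmem s ''nk'' 0 = 0" "nmem s ''it'' 0 = 0"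
      using init init' by simp_all
    have r: "rmem s ''val'' = ?V" "rmem s ''eps'' 0 = \<epsilon>" "rmem s ''delta'' 0 = \<delta>"
      using unchanged_rmem[OF u, of "''val''"] unchanged_rmem[OF u, of "''eps''"]
        unchanged_rmem[OF u, of "''delta''"] init init' by simp_all
    from * show "t \<le> (N + 1) * 100 \<and> J s"
      unfolding J_def n r init row_norm2_def frob2_def N_def[symmetric] x_def by simp
  qed (simp_all add: init_state_def)
  have main: "wp \<omega> ?main s (\<lambda>t s'. t \<le> 120 * (N + 1) + 100 * (?l + 1) + 31 + (K + 1) * ((length ks + 1) * 500 + 20) \<and>
      estimate s' = (if 0 < K
      then form ((step ^^ (K - 1)) x) ((step ^^ K) x) / form ((step ^^ (K - 1)) x) ((step ^^ (K - 1)) x)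
      else rmem s ''out'' 0))" if J: "J s" for s
    unfolding seqs.simps wp_Seq
  proof (rule wp_mono[OF wp_log[of \<omega> s]])
    fix t1 s1
    assume 1: "t1 \<le> (ceil_log2 (real (nmem s ''d'' 0) / (rmem s ''eps'' 0 * rmem s ''delta'' 0)) + 1) * 100 \<and>
      unchanged {''ell''} {''g'', ''pw'', ''r''} s s1 \<and>
      nmem s1 ''ell'' 0 = ceil_log2 (real (nmem s ''d'' 0) / (rmem s ''eps'' 0 * rmem s ''delta'' 0)) \<and>
      rmem s1 ''r'' 0 = 128 * (real (nmem s ''d'' 0) * real (ceil_log2 (real (nmem s ''d'' 0) / (rmem s ''eps'' 0 * rmem s ''delta'' 0))))
        / (rmem s ''eps'' 0 * rmem s ''eps'' 0)"
    then have t1: "t1 \<le> (?l + 1) * 100" and J1: "J s1" and l1: "nmem s1 ''ell'' 0 = ?l" "rmem s1 ''r'' 0 = ?r"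
      and o1: "rmem s1 ''out'' 0 = rmem s ''out'' 0"
      using J by (auto simp: J_def unchanged_def log_factor_def sample_size_def)
    have nk1: "nmem s1 ''nk'' 0 = 0" using J1 by (simp add: J_def)
    let ?ks = "filter (\<lambda>k. latest ?R (fst \<omega>) N (?R k) * frob2 es < ?r * row_norm2 es (?R k)) [0..<N]"
    have ks_eq: "ks = (if 3 * (real d * ?r) < real (length ?ks) then [] else ?ks)"
      by (simp only: ks_def sampled_entries_def N_def Let_def)
    show "wp \<omega> sample_prog s1 (\<lambda>ta sa. wp \<omega> cap_prog sa (\<lambda>tb sb. wp \<omega> (While ?b pow_prog) sb (\<lambda>tc sc. wp \<omega> Skip sc (\<lambda>td s'.
      t1 + (ta + (tb + (tc + td))) \<le> 120 * (N + 1) + 100 * (?l + 1) + 31 + (K + 1) * ((length ks + 1) * 500 + 20) \<and>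
      estimate s' = (if 0 < K
      then form ((step ^^ (K - 1)) x) ((step ^^ K) x) / form ((step ^^ (K - 1)) x) ((step ^^ (K - 1)) x)
      else rmem s ''out'' 0)))))"
    proof (rule wp_mono[OF wp_sample[OF nk1, of \<omega>]], elim conjE)
      fix t2 s2
      assume t2: "t2 \<le> (nmem s1 ''nnz'' 0 + 1) * 120" and u2: "unchanged {''i'', ''kr'', ''kc'', ''nk''} {''kv'', ''kw''} s1 s2"
        and k2: "kept (nmem s1 ''row'') (nmem s1 ''col'') (rmem s1 ''val'')
          (\<lambda>k. row_weight (rmem s1 ''F'' 0) (rmem s1 ''r'' 0 * rmem s1 ''rn'' (nmem s1 ''row'' k)) * rmem s1 ''val'' k)
          (filter (\<lambda>k. rmem s1 ''u'' (nmem s1 ''row'' k) * rmem s1 ''F'' 0 < rmem s1 ''r'' 0 * rmem s1 ''rn'' (nmem s1 ''row'' k))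
            [0..<nmem s1 ''nnz'' 0]) s2"
      have "?W = (\<lambda>k. row_weight (frob2 es) (?r * row_norm2 es (?R k)) * ?V k)"
        by (simp add: scaled_val_def fun_eq_iff)
      then have k2': "kept ?R ?C ?V ?W ?ks s2" using k2 J1 l1 by (simp add: J_def)
      have d2: "nmem s2 ''d'' 0 = d" "rmem s2 ''r'' 0 = ?r" using u2 J1 l1 by (auto simp: unchanged_def J_def)
      show "wp \<omega> cap_prog s2 (\<lambda>tb sb. wp \<omega> (While ?b pow_prog) sb (\<lambda>tc sc. wp \<omega> Skip sc (\<lambda>td s'.
        t1 + (t2 + (tb + (tc + td))) \<le> 120 * (N + 1) + 100 * (?l + 1) + 31 + (K + 1) * ((length ks + 1) * 500 + 20) \<and>
        estimate s' = (if 0 < K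
        then form ((step ^^ (K - 1)) x) ((step ^^ K) x) / form ((step ^^ (K - 1)) x) ((step ^^ (K - 1)) x)
        else rmem s ''out'' 0))))"
      proof (rule wp_mono[OF wp_cap[OF k2', of \<omega>]], elim conjE)
        fix t3 :: nat and s3
        assume t3: "t3 \<le> 30" and u3: "unchanged {''nk''} {} s2 s3"
          and "kept ?R ?C ?V ?W (if 3 * (real (nmem s2 ''d'' 0) * rmem s2 ''r'' 0) < real (length ?ks) then [] else ?ks) s3"
        then have k3: "kept ?R ?C ?V ?W ks s3"
          by (simp only: d2 ks_eq)
        have s3: "rmem s3 ''x'' = x" "nmem s3 ''it'' 0 = 0" "rmem s3 ''eps'' 0 = \<epsilon>" "nmem s3 ''ell'' 0 = ?l"
          "rmem s3 ''out'' 0 = rmem s ''out'' 0"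
          using u2 u3 J1 l1 o1 by (auto simp: unchanged_def J_def)
        show "wp \<omega> (While ?b pow_prog) s3 (\<lambda>tc sc. wp \<omega> Skip sc (\<lambda>td s'.
          t1 + (t2 + (t3 + (tc + td))) \<le> 120 * (N + 1) + 100 * (?l + 1) + 31 + (K + 1) * ((length ks + 1) * 500 + 20) \<and>
          estimate s' = (if 0 < K
          then form ((step ^^ (K - 1)) x) ((step ^^ K) x) / form ((step ^^ (K - 1)) x) ((step ^^ (K - 1)) x)
          else rmem s ''out'' 0)))"
        proof (rule wp_mono[OF wp_pow_loop[OF k3 s3(1,2), of \<omega>]])
          show "0 < rmem s3 ''eps'' 0" using s3 \<epsilon> by simp
        qed (use t1 t2 t3 J1 in \<open>auto simp: s3 K_def[symmetric] step_def form_def estimate_def J_def\<close>)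
      qed
    qed
  qed
  show ?thesis
    unfolding norm_prog_def seqs.simps(2)[of scan_prog] seqs.simps(2)[of "rset _ _"]
      seqs.simps(2)[of "If _ _ _"] seqs.simps(1) wp_Seq
  proof (rule wp_mono[OF scan], elim conjE)
    fix t1 s1 assume t1: "t1 \<le> (N + 1) * 100" and J1: "J s1"
    let ?s = "rstore ''out'' 0 (frob2 es) s1"
    have "J ?s" using J1 by (simp add: J_def)
    note main = main[OF this]
    have s1: "rmem s1 ''F'' 0 = frob2 es" "nmem s1 ''d'' 0 = d" "nmem s1 ''nnz'' 0 = N" using J1 by (simp_all add: J_def)
    show "wp \<omega> (rset ''out'' (rvar ''F'')) s1 (\<lambda>ta sa. wp \<omega>
      (If (BAnd (NLess (NConst 1) (nvar ''d'')) (NLess (NConst 0) (nvar ''nnz''))) ?main Skip) sa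
      (\<lambda>tb sb. wp \<omega> Skip sb (\<lambda>tc s. t1 + (ta + (tb + tc)) \<le>
        1000 * (N + 1) + (if 1 < d \<and> 0 < N then 1000 * (?l + 1) + 1000 * (K + 1) * (length ks + 1) else 0) \<and>
        estimate s = (if 1 < d \<and> 0 < N \<and> 0 < K
        then form ((step ^^ (K - 1)) x) ((step ^^ K) x) / form ((step ^^ (K - 1)) x) ((step ^^ (K - 1)) x)
        else frob2 es))))"
    proof (cases "1 < d \<and> 0 < N")
      case True
      then show ?thesis
        unfolding wp_If wp_RAssign using t1 s1
        by (auto simp del: seqs.simps intro!: wp_mono[OF main] simp: algebra_simps)
    next
      case False
      then show ?thesis
        unfolding wp_If wp_RAssign using t1 s1 by (auto simp: estimate_def)
    qed
  qed
qed


section \<open>Sparse matrices\<close>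

definition mat_row :: "real mat \<Rightarrow> nat \<Rightarrow> nat \<Rightarrow> real" where
  "mat_row A i j = (if i < dim_row A \<and> j < dim_col A then A $$ (i, j) else 0)"

definition energy :: "real mat \<Rightarrow> (nat \<Rightarrow> real) \<Rightarrow> real" where
  "energy A x = (\<Sum>i<dim_row A. (ip (dim_col A) (mat_row A i) x)\<^sup>2)"

lemma eucl_norm_nonneg: "0 \<le> eucl_norm v"
  by (simp add: eucl_norm_def scalar_prod_def sum_nonneg)

lemma eucl_norm_vec: "(eucl_norm (vec d x))\<^sup>2 = ip d x x"
  using ip_nonneg[of d x] by (simp add: eucl_norm_def scalar_prod_def ip_def lessThan_atLeast0)

lemma eucl_norm_mult_mat_vec: "(eucl_norm (A *\<^sub>v vec (dim_col A) x))\<^sup>2 = energy A x"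
proof -
  have "A *\<^sub>v vec (dim_col A) x = vec (dim_row A) (\<lambda>i. ip (dim_col A) (mat_row A i) x)"
    by (rule eq_vecI) (auto simp: scalar_prod_def ip_def mat_row_def lessThan_atLeast0)
  then show ?thesis
    by (simp add: eucl_norm_vec energy_def ip_def[of "dim_row A"] power2_eq_square[of "ip _ _ _"])
qed

lemma energy_le_frobenius:
  "energy A x \<le> (\<Sum>i<dim_row A. ip (dim_col A) (mat_row A i) (mat_row A i)) * ip (dim_col A) x x"
  unfolding energy_def sum_distrib_right by (intro sum_mono ip_Cauchy_Schwarz)

lemma energy_scale: "energy A (\<lambda>j. c * x j) = c\<^sup>2 * energy A x"
  by (simp add: energy_def ip_scale_right power_mult_distrib sum_distrib_left)

lemma eucl_norm_bdd_above:
  "bdd_above ((\<lambda>x. eucl_norm (A *\<^sub>v x)) ` {x \<in> carrier_vec (dim_col A). eucl_norm x = 1})"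
proof (rule bdd_aboveI2)
  let ?F = "\<Sum>i<dim_row A. ip (dim_col A) (mat_row A i) (mat_row A i)"
  fix x assume x: "x \<in> {x \<in> carrier_vec (dim_col A). eucl_norm x = 1}"
  then have vec: "x = vec (dim_col A) (vec_index x)" by (intro eq_vecI) auto
  have "(eucl_norm (A *\<^sub>v x))\<^sup>2 = energy A (vec_index x)"
    using eucl_norm_mult_mat_vec[of A "vec_index x"] vec by simp
  also have "\<dots> \<le> ?F * ip (dim_col A) (vec_index x) (vec_index x)"
    by (rule energy_le_frobenius)
  also have "ip (dim_col A) (vec_index x) (vec_index x) = 1"
    using eucl_norm_vec[of "dim_col A" "vec_index x"] vec x by simp
  finally show "eucl_norm (A *\<^sub>v x) \<le> sqrt ?F"
    by (simp add: real_le_rsqrt)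
qed

lemma energy_le_spectral_norm_unit:
  assumes "ip (dim_col A) x x = 1"
  shows "energy A x \<le> (spectral_norm A)\<^sup>2" and "0 \<le> spectral_norm A"
proof -
  let ?x = "vec (dim_col A) x"
  have "(eucl_norm ?x)\<^sup>2 = 1" using assms by (simp add: eucl_norm_vec)
  then have "eucl_norm ?x = 1" using eucl_norm_nonneg[of ?x] by (simp add: power2_eq_1_iff)
  then have "eucl_norm (A *\<^sub>v ?x) \<le> spectral_norm A"
    unfolding spectral_norm_def by (intro cSUP_upper eucl_norm_bdd_above) auto
  then show "energy A x \<le> (spectral_norm A)\<^sup>2" and "0 \<le> spectral_norm A"
    using eucl_norm_nonneg[of "A *\<^sub>v ?x"] by (auto simp: eucl_norm_mult_mat_vec[symmetric] intro: power_mono order_trans)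
qed

lemma energy_le_spectral_norm: "energy A x \<le> (spectral_norm A)\<^sup>2 * ip (dim_col A) x x"
proof (cases "ip (dim_col A) x x = 0")
  case True
  then show ?thesis using energy_le_frobenius[of A x] by simp
next
  case False
  define s where "s = ip (dim_col A) x x"
  have s: "0 < s" using False ip_nonneg[of "dim_col A" x] by (simp add: s_def)
  have "ip (dim_col A) (\<lambda>j. (1 / sqrt s) * x j) (\<lambda>j. (1 / sqrt s) * x j) = 1"
    unfolding ip_scale_left ip_scale_right s_def[symmetric] using s by simp
  then have "energy A (\<lambda>j. (1 / sqrt s) * x j) \<le> (spectral_norm A)\<^sup>2"
    by (rule energy_le_spectral_norm_unit)
  then have "energy A x / s \<le> (spectral_norm A)\<^sup>2"
    unfolding energy_scale using s by (simp add: power_divide)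
  then show ?thesis using s by (simp add: s_def[symmetric] pos_divide_le_eq)
qed

lemma ip_unit_unit: "j < d \<Longrightarrow> ip d (unit_fun j) (unit_fun j) = 1"
  by (simp add: ip_unit_right) (simp add: unit_fun_def)

lemma spectral_norm_nonneg: "0 < dim_col A \<Longrightarrow> 0 \<le> spectral_norm A"
  by (rule energy_le_spectral_norm_unit(2)[OF ip_unit_unit])

lemma spectral_norm_approx:
  assumes "0 < dim_col A" and k: "0 \<le> k" "k < (spectral_norm A)\<^sup>2"
  obtains v where "ip (dim_col A) v v = 1" "k < energy A v"
proof -
  let ?S = "{x \<in> carrier_vec (dim_col A). eucl_norm x = 1}"
  have "eucl_norm (vec (dim_col A) (unit_fun 0)) = 1"
    using eucl_norm_vec[of "dim_col A" "unit_fun 0"] ip_unit_unit[OF assms(1)]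
      eucl_norm_nonneg[of "vec (dim_col A) (unit_fun 0)"] by (simp add: power2_eq_1_iff)
  then have "vec (dim_col A) (unit_fun 0) \<in> ?S" by simp
  then have "?S \<noteq> {}" by blast
  have "sqrt k < spectral_norm A"
    using real_sqrt_less_mono[OF k(2)] spectral_norm_nonneg[OF assms(1)] by simp
  then obtain x where x: "x \<in> ?S" "sqrt k < eucl_norm (A *\<^sub>v x)"
    unfolding spectral_norm_def less_cSUP_iff[OF \<open>?S \<noteq> {}\<close> eucl_norm_bdd_above] by auto
  then have vec: "x = vec (dim_col A) (vec_index x)" by (intro eq_vecI) auto
  show thesis
  proof (rule that)
    show "ip (dim_col A) (vec_index x) (vec_index x) = 1"
      using eucl_norm_vec[of "dim_col A" "vec_index x"] vec x by simp
    have "k < (eucl_norm (A *\<^sub>v x))\<^sup>2"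
      using x(2) k(1) real_less_lsqrt[of k "eucl_norm (A *\<^sub>v x)"] eucl_norm_nonneg[of "A *\<^sub>v x"]
      by (metis not_less real_sqrt_abs real_sqrt_less_iff abs_of_nonneg)
    then show "k < energy A (vec_index x)"
      using eucl_norm_mult_mat_vec[of A "vec_index x"] vec by simp
  qed
qed

lemma accum_nth:
  assumes "distinct ks"
  shows "accum (\<lambda>p. key (ks ! p)) (\<lambda>p. f (ks ! p)) (length ks) i = (\<Sum>k\<in>set ks. if key k = i then f k else 0)"
proof -
  have "accum (\<lambda>p. key (ks ! p)) (\<lambda>p. f (ks ! p)) (length ks) i = (\<Sum>p<length ks. if key (ks ! p) = i then f (ks ! p) else 0)"
    unfolding accum_eq_sum by (intro sum.mono_neutral_cong_left) auto
  also have "\<dots> = (\<Sum>k\<in>set ks. if key k = i then f k else 0)"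
    by (rule sum.reindex_bij_betw[OF bij_betw_nth[OF assms refl refl]])
  finally show ?thesis .
qed

locale sparse_matrix =
  fixes A :: "real mat" and n d :: nat and es :: "(nat \<times> nat \<times> real) list"
  assumes A: "A \<in> carrier_mat n d" and es: "entry_list A es"
begin

abbreviation "R \<equiv> entry_row es"
abbreviation "C \<equiv> entry_col es"
abbreviation "V \<equiv> entry_val es"
abbreviation "N \<equiv> length es"
abbreviation "a \<equiv> mat_row A"

lemma dims [simp]: "dim_row A = n" "dim_col A = d"
  using A by auto

lemma sum_entries:
  assumes "\<And>i j. f i j 0 = 0"
  shows "(\<Sum>k<N. f (R k) (C k) (V k)) = (\<Sum>i<n. \<Sum>j<d. f i j (a i j))"
proof -
  let ?S = "{(i, j). i < n \<and> j < d \<and> A $$ (i, j) \<noteq> 0}"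
  let ?g = "\<lambda>(i, j, v). f i j v"
  have "(\<Sum>k<N. f (R k) (C k) (V k)) = (\<Sum>k<N. ?g (es ! k))"
    by (intro sum.cong) (auto simp: entry_row_def entry_col_def entry_val_def split_beta)
  also have "\<dots> = (\<Sum>e\<in>set es. ?g e)"
    using es by (intro sum.reindex_bij_betw bij_betw_nth) (auto simp: entry_list_def)
  also have "set es = (\<lambda>(i, j). (i, j, A $$ (i, j))) ` ?S"
    using es unfolding entry_list_def by force
  also have "(\<Sum>e\<in>\<dots>. ?g e) = (\<Sum>(i, j)\<in>?S. f i j (A $$ (i, j)))"
    by (subst sum.reindex) (auto simp: inj_on_def intro!: sum.cong)
  also have "\<dots> = (\<Sum>(i, j)\<in>{..<n} \<times> {..<d}. f i j (a i j))"
    using assms by (intro sum.mono_neutral_cong_left) (auto simp: mat_row_def)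
  also have "\<dots> = (\<Sum>i<n. \<Sum>j<d. f i j (a i j))"
    by (rule sum.cartesian_product[symmetric])
  finally show ?thesis .
qed

lemma entry_bounds:
  assumes "k < N"
  shows "R k < n" "C k < d" "V k = a (R k) (C k)" "V k \<noteq> 0"
proof -
  have "es ! k \<in> set es" using assms by simp
  then obtain i j where "es ! k = (i, j, A $$ (i, j))" "i < n" "j < d" "A $$ (i, j) \<noteq> 0"
    using es unfolding entry_list_def by auto
  then show "R k < n" "C k < d" "V k = a (R k) (C k)" "V k \<noteq> 0"
    using assms by (simp_all add: entry_row_def entry_col_def entry_val_def mat_row_def)
qed

lemma entry_inj: "k < N \<Longrightarrow> k' < N \<Longrightarrow> R k = R k' \<Longrightarrow> C k = C k' \<Longrightarrow> k = k'"
  using es entry_bounds(3)[of k] entry_bounds(3)[of k'] nth_eq_iff_index_eq[of es k k']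
  by (auto simp: entry_list_def entry_row_def entry_col_def entry_val_def prod_eq_iff)

lemma entry_exists:
  assumes "a i j \<noteq> 0"
  obtains k where "k < N" "R k = i" "C k = j"
proof -
  have "(i, j, A $$ (i, j)) \<in> set es"
    using assms es by (auto simp: entry_list_def mat_row_def split: if_splits)
  then obtain k where "k < N" "es ! k = (i, j, A $$ (i, j))" by (auto simp: in_set_conv_nth)
  then show thesis by (intro that[of k]) (auto simp: entry_row_def entry_col_def)
qed

lemma row_norm2_eq: "i < n \<Longrightarrow> row_norm2 es i = ip d (a i) (a i)"
proof -
  assume i: "i < n"
  have "row_norm2 es i = (\<Sum>k<N. if R k = i then V k * V k else 0)"
    unfolding row_norm2_def accum_eq_sum by (intro sum.mono_neutral_cong_left) auto
  also have "\<dots> = (\<Sum>i'<n. \<Sum>j<d. if i' = i then a i' j * a i' j else 0)"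
    by (rule sum_entries[where f = "\<lambda>i' j v. if i' = i then v * v else 0"]) simp
  also have "\<dots> = (\<Sum>i'<n. if i' = i then \<Sum>j<d. a i j * a i j else 0)"
    by (intro sum.cong refl) simp
  finally show ?thesis using i by (simp add: ip_def)
qed

lemma frob2_eq: "frob2 es = (\<Sum>i<n. ip d (a i) (a i))"
  unfolding frob2_def ip_def by (rule sum_entries[where f = "\<lambda>i j v. v * v"]) simp

lemma frob2_le: "frob2 es \<le> real d * (spectral_norm A)\<^sup>2"
proof -
  have "frob2 es = (\<Sum>i<n. \<Sum>j<d. (ip d (a i) (unit_fun j))\<^sup>2)"
    unfolding frob2_eq by (simp add: sum_squares_unit)
  also have "\<dots> = (\<Sum>j<d. energy A (unit_fun j))"
    unfolding energy_def by (subst sum.swap) simp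
  also have "\<dots> \<le> (\<Sum>j<d. (spectral_norm A)\<^sup>2)"
    using energy_le_spectral_norm_unit(1)[of A] ip_unit_unit[of _ d] by (intro sum_mono) auto
  finally show ?thesis by simp
qed

lemma spectral_norm_le_frob2: "0 < d \<Longrightarrow> (spectral_norm A)\<^sup>2 \<le> frob2 es"
proof (rule ccontr)
  assume d: "0 < d" and "\<not> (spectral_norm A)\<^sup>2 \<le> frob2 es"
  moreover have "0 \<le> frob2 es" by (simp add: frob2_def sum_nonneg)
  ultimately obtain v where "ip d v v = 1" "frob2 es < energy A v"
    using spectral_norm_approx[of A "frob2 es"] by auto
  then show False using energy_le_frobenius[of A v] by (simp add: frob2_eq)
qed

context
  fixes T :: "nat set" and w :: "nat \<Rightarrow> real" and W :: "nat \<Rightarrow> real" and ks :: "nat list"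
  assumes T: "T \<subseteq> {..<n}" and W: "\<And>k. k < N \<Longrightarrow> R k \<in> T \<Longrightarrow> W k = w (R k) * V k"
    and ks: "distinct ks" "set ks = {k. k < N \<and> R k \<in> T}"
begin

lemma sum_kept:
  assumes "\<And>i j. f i j 0 = 0"
  shows "(\<Sum>k\<in>set ks. f (R k) (C k) (V k)) = (\<Sum>i\<in>T. \<Sum>j<d. f i j (a i j))"
proof -
  have "(\<Sum>k\<in>set ks. f (R k) (C k) (V k)) = (\<Sum>k<N. if R k \<in> T then f (R k) (C k) (V k) else 0)"
    unfolding ks(2) by (intro sum.mono_neutral_cong_left) auto
  also have "\<dots> = (\<Sum>i<n. \<Sum>j<d. if i \<in> T then f i j (a i j) else 0)"
    by (rule sum_entries[where f = "\<lambda>i j v. if i \<in> T then f i j v else 0"]) (simp add: assms)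
  also have "\<dots> = (\<Sum>i\<in>T. \<Sum>j<d. f i j (a i j))"
    using T by (intro sum.mono_neutral_cong_right) auto
  finally show ?thesis .
qed

lemma pow_rows_eq: "i \<in> T \<Longrightarrow> pow_rows R C V ks X i = ip d (a i) X"
proof -
  assume i: "i \<in> T"
  have "finite T" using T finite_subset by blast
  have "pow_rows R C V ks X i = (\<Sum>k\<in>set ks. if R k = i then V k * X (C k) else 0)"
    unfolding pow_rows_def by (rule accum_nth[OF ks(1), of R "\<lambda>k. V k * X (C k)"])
  also have "\<dots> = (\<Sum>i'\<in>T. if i' = i then \<Sum>j<d. a i j * X j else 0)"
    by (subst sum_kept[where f = "\<lambda>i' j v. if i' = i then v * X j else 0"]) (auto intro!: sum.cong)
  finally show ?thesis using i \<open>finite T\<close> by (simp add: ip_def)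
qed

lemma pow_step_eq: "pow_step R C V W ks X = gram d T w a 0 X"
proof
  fix j
  have "pow_step R C V W ks X j = (\<Sum>k\<in>set ks. if C k = j then W k * pow_rows R C V ks X (R k) else 0)"
    unfolding pow_step_def by (rule accum_nth[OF ks(1), of C "\<lambda>k. W k * pow_rows R C V ks X (R k)"])
  also have "\<dots> = (\<Sum>k\<in>set ks. if C k = j then w (R k) * V k * ip d (a (R k)) X else 0)"
    using W by (intro sum.cong) (auto simp: ks(2) pow_rows_eq)
  also have "\<dots> = (\<Sum>i\<in>T. \<Sum>j'<d. if j' = j then w i * ip d (a i) X * a i j else 0)"
    by (subst sum_kept[where f = "\<lambda>i j' v. if j' = j then w i * v * ip d (a i) X else 0"])
      (auto intro!: sum.cong)
  also have "\<dots> = (\<Sum>i\<in>T. w i * ip d (a i) X * a i j)"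
    by (intro sum.cong) (auto simp: mat_row_def)
  finally show "pow_step R C V W ks X j = gram d T w a 0 X j" by (simp add: gram_def)
qed

lemma pow_form_eq: "pow_form R C V W ks X Z = ip d Z (gram d T w a 0 X)"
proof -
  have "pow_form R C V W ks X Z = (\<Sum>k\<in>set ks. W k * pow_rows R C V ks X (R k) * Z (C k))"
    unfolding pow_form_def
    by (rule sum.reindex_bij_betw[OF bij_betw_nth[OF ks(1) refl refl], where g = "\<lambda>k. W k * pow_rows R C V ks X (R k) * Z (C k)"])
  also have "\<dots> = (\<Sum>k\<in>set ks. w (R k) * V k * ip d (a (R k)) X * Z (C k))"
    using W by (intro sum.cong) (auto simp: ks(2) pow_rows_eq)
  also have "\<dots> = (\<Sum>i\<in>T. \<Sum>j<d. w i * ip d (a i) X * (a i j * Z j))"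
    by (subst sum_kept[where f = "\<lambda>i j v. w i * v * ip d (a i) X * Z j"]) (auto intro!: sum.cong)
  also have "\<dots> = (\<Sum>i\<in>T. w i * ip d (a i) X * ip d (a i) Z)"
    by (simp add: ip_def[of d "a _" Z] sum_distrib_left)
  finally show ?thesis by (simp add: ip_gram)
qed

lemma pow_ratio_eq_moment_ratio:
  assumes w: "\<And>i. i \<in> T \<Longrightarrow> 0 \<le> w i" and K: "0 < K"
  defines "step \<equiv> pow_step R C V W ks" and "form \<equiv> pow_form R C V W ks" and "S \<equiv> gram d T w a 0"
  shows "form ((step ^^ (K - 1)) x) ((step ^^ K) x) / form ((step ^^ (K - 1)) x) ((step ^^ (K - 1)) x)
    = moment d S x (2 * K) / moment d S x (2 * K - 1)"
proof -
  have S: "psd_op d S" unfolding S_def using w by (intro psd_op_gram) auto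
  have step: "step = S" by (rule ext) (simp add: step_def S_def pow_step_eq)
  obtain h where h: "K = Suc h" using K by (cases K) auto
  have eq: "S ((S ^^ h) x) = (S ^^ Suc h) x" by simp
  have "form ((S ^^ h) x) ((S ^^ Suc h) x) = moment d S x (2 * K)"
    unfolding form_def pow_form_eq S_def[symmetric] eq ip_funpow_funpow[OF S]
    by (simp add: moment_def h mult_2 del: funpow.simps)
  moreover have "form ((S ^^ h) x) ((S ^^ h) x) = moment d S x (2 * K - 1)"
    unfolding form_def pow_form_eq S_def[symmetric] eq ip_funpow_funpow[OF S]
    by (simp add: moment_def h mult_2 del: funpow.simps)
  ultimately show ?thesis by (simp add: step h del: funpow.simps)
qed

end

end


section \<open>Analysis of the algorithm\<close>

definition last_index :: "(nat \<Rightarrow> nat) \<Rightarrow> nat \<Rightarrow> nat \<Rightarrow> nat" where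
  "last_index key m i = Max {k. k < m \<and> key k = i}"

lemma latest_last_index: "i \<in> key ` {..<m} \<Longrightarrow> latest key f m i = f (last_index key m i)"
  and latest_outside: "i \<notin> key ` {..<m} \<Longrightarrow> latest key f m i = 0"
  by (auto simp: latest_eq last_index_def)

lemma inj_on_last_index: "inj_on (last_index key m) (key ` {..<m})"
proof (rule inj_on_inverseI)
  fix i assume "i \<in> key ` {..<m}"
  then have "last_index key m i \<in> {k. k < m \<and> key k = i}"
    unfolding last_index_def by (intro Max_in) auto
  then show "key (last_index key m i) = i" by simp
qed

lemma measure_uniform_scaled_less:
  fixes F b :: real
  assumes "0 < F" "0 < b"
  shows "{x. x * F < b} \<in> sets (uniform_measure lborel {0..1::real})"
    and "measure (uniform_measure lborel {0..1}) {x. x * F < b} = min 1 (b / F)"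
proof -
  have *: "{x. x * F < b} = {..<b / F}" using assms by (auto simp: pos_less_divide_eq)
  then show "{x. x * F < b} \<in> sets (uniform_measure lborel {0..1::real})" by simp
  have "{0..1} \<inter> {..<b / F} = (if b / F \<le> 1 then {0..<b / F} else {0..1})" by auto
  then show "measure (uniform_measure lborel {0..1}) {x. x * F < b} = min 1 (b / F)"
    unfolding * using assms by (subst measure_uniform_measure) (auto simp: min_def)
qed

locale sparse_sampling = sparse_matrix +
  fixes \<epsilon> \<delta> :: real
  assumes d: "1 < d" and N: "0 < length es" and \<epsilon>: "0 < \<epsilon>" "\<epsilon> < 1" and \<delta>: "0 < \<delta>" "\<delta> < 1"
begin

definition "l = log_factor d \<epsilon> \<delta>"
definition "r = sample_size d \<epsilon> \<delta>"
definition "K = num_iter \<epsilon> l"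
definition "I = R ` {..<N}"
definition "J = C ` {..<N}"
abbreviation "F \<equiv> frob2 es"
abbreviation "\<kappa> \<equiv> (spectral_norm A)\<^sup>2"
definition "q i = min 1 (r * row_norm2 es i / F)"
definition "row_count i = card {k. k < N \<and> R k = i}"
definition "select u = {i \<in> I. u (last_index R N i) \<in> {x. x * F < r * row_norm2 es i}}"
definition "capped T = (if 3 * (real d * r) < real (\<Sum>i\<in>T. row_count i) then {} else T)"
abbreviation "S T \<equiv> gram d T (\<lambda>i. 1 / q i) a 0"
abbreviation "start g \<equiv> start_vec J (last_index C N) g"
definition "output T g = moment d (S T) (start g) (2 * K) / moment d (S T) (start g) (2 * K - 1)"

lemma ratio_bounds: "2 \<le> real d / (\<epsilon> * \<delta>)" "real d / \<delta> \<le> real d / (\<epsilon> * \<delta>)"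
proof -
  have "\<epsilon> * \<delta> \<le> \<delta>" using \<epsilon> \<delta> by (simp add: mult_le_cancel_right1)
  then show "real d / \<delta> \<le> real d / (\<epsilon> * \<delta>)"
    using \<epsilon> \<delta> by (intro divide_left_mono) auto
  moreover have "2 \<le> real d / \<delta>" using d \<delta> by (simp add: pos_le_divide_eq)
  ultimately show "2 \<le> real d / (\<epsilon> * \<delta>)" by simp
qed

lemma l_ge_1: "1 \<le> l"
proof (rule ccontr)
  assume "\<not> 1 \<le> l"
  then have "ceil_log2 (real d / (\<epsilon> * \<delta>)) = 0" by (simp add: l_def log_factor_def)
  then show False
    using le_two_power_ceil_log2[of "real d / (\<epsilon> * \<delta>)"] ratio_bounds by simp
qed

lemma fail_bound: "8 * real d / \<delta> \<le> exp (3 * real l)"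
proof -
  have "(8::real) = 2 ^ 3" by simp
  also have "\<dots> \<le> 2 ^ (3 * l)" using l_ge_1 by (intro power_increasing) auto
  finally have "8 * (real d / \<delta>) \<le> 2 ^ (3 * l) * 2 ^ l"
    using ratio_bounds le_two_power_ceil_log2[of "real d / (\<epsilon> * \<delta>)"] \<delta>
    by (intro mult_mono) (auto simp: l_def log_factor_def)
  also have "\<dots> = 2 ^ (4 * l)" by (simp flip: power_add)
  also have "\<dots> \<le> exp (3 * real l)" by (rule two_power_le_exp)
  finally show ?thesis by simp
qed

lemma exp_le_fail: "real d * exp (- (3 * real l)) \<le> \<delta> / 8" "exp (- (3 * real l)) \<le> \<delta> / 8"
proof -
  show *: "real d * exp (- (3 * real l)) \<le> \<delta> / 8"
    using fail_bound \<delta> by (simp add: exp_minus field_simps)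
  have "1 * exp (- (3 * real l)) \<le> real d * exp (- (3 * real l))"
    using d by (intro mult_right_mono) auto
  then show "exp (- (3 * real l)) \<le> \<delta> / 8"
    unfolding mult_1 using * by (rule order_trans)
qed

lemma r_eq: "r = 128 * real d * real l / \<epsilon>\<^sup>2"
  by (simp add: r_def sample_size_def l_def power2_eq_square)

lemma r_ge: "128 * real l \<le> r"
proof -
  have "\<epsilon>\<^sup>2 \<le> 1" using \<epsilon> by (simp add: power_le_one)
  then have "128 * real l * \<epsilon>\<^sup>2 \<le> 128 * real l * real d" using d by (intro mult_left_mono) auto
  then show ?thesis using \<epsilon> by (simp add: r_eq pos_le_divide_eq mult.commute mult.left_commute)
qed

lemma r_pos: "0 < r" using r_ge l_ge_1 by simp

lemma I_subset: "I \<subseteq> {..<n}" and finite_I: "finite I"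
  using entry_bounds by (auto simp: I_def)

lemma J_subset: "J \<subseteq> {..<d}"
  using entry_bounds by (auto simp: J_def)

lemma row_zero: "i \<notin> I \<Longrightarrow> a i j = 0" and col_zero: "j \<notin> J \<Longrightarrow> a i j = 0"
  by (metis I_def entry_exists image_eqI lessThan_iff) (metis J_def entry_exists image_eqI lessThan_iff)

lemma row_norm2_pos: "i \<in> I \<Longrightarrow> 0 < row_norm2 es i"
proof -
  assume "i \<in> I"
  then obtain k where k: "k < N" "R k = i" by (auto simp: I_def)
  then have "i < n" "C k < d" "a i (C k) \<noteq> 0" using entry_bounds[of k] by auto
  then have "0 < (\<Sum>j<d. a i j * a i j)"
    by (intro sum_pos2[of _ "C k"]) (auto simp: zero_less_mult_iff)
  with \<open>i < n\<close> show ?thesis by (simp add: row_norm2_eq ip_def)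
qed

lemma F_eq: "F = (\<Sum>i\<in>I. row_norm2 es i)"
proof -
  have "F = (\<Sum>i\<in>I. ip d (a i) (a i))"
    unfolding frob2_eq using I_subset by (intro sum.mono_neutral_right) (auto simp: ip_def row_zero)
  then show ?thesis using I_subset by (auto simp: row_norm2_eq intro!: sum.cong)
qed

lemma energy_eq: "energy A x = (\<Sum>i\<in>I. (ip d (a i) x)\<^sup>2)"
  unfolding energy_def using I_subset by (intro sum.mono_neutral_cong_right) (auto simp: ip_def row_zero)

lemma F_pos: "0 < F"
  unfolding F_eq using N by (intro sum_pos finite_I row_norm2_pos) (auto simp: I_def)

lemma \<kappa>_pos: "0 < \<kappa>"
  using F_pos frob2_le d by (smt (verit) mult_nonneg_nonpos of_nat_0_le_iff zero_le_power2)

lemma q_pos: "i \<in> I \<Longrightarrow> 0 < q i"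
  using r_pos row_norm2_pos F_pos by (simp add: q_def)

lemma inverse_q: "i \<in> I \<Longrightarrow> 1 / q i = row_weight F (r * row_norm2 es i)"
proof -
  assume "i \<in> I"
  then have "0 < r * row_norm2 es i" using r_pos row_norm2_pos by simp
  then show ?thesis using F_pos by (auto simp: q_def row_weight_def min_def)
qed

sublocale random_subset I q
  using finite_I q_pos by unfold_locales (auto simp: q_def intro: less_imp_le)

lemma small_rows:
  assumes "i \<in> I" "q i < 1"
  shows "ip d (a i) (a i) / q i \<le> F / r"
proof -
  have "ip d (a i) (a i) = row_norm2 es i" using assms I_subset by (auto simp: row_norm2_eq)
  moreover have "q i = r * row_norm2 es i / F" using assms(2) by (auto simp: q_def min_def split: if_splits)
  ultimately show ?thesis using row_norm2_pos[OF assms(1)] by simp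
qed

lemma variance_bound: "128 * real l * (F / r) \<le> \<kappa> * \<epsilon>\<^sup>2"
proof -
  have "128 * real l * (F / r) = F / real d * \<epsilon>\<^sup>2"
    using l_ge_1 \<epsilon> d by (simp add: r_eq field_simps)
  also have "\<dots> \<le> \<kappa> * \<epsilon>\<^sup>2"
    using frob2_le d by (intro mult_right_mono) (auto simp: divide_le_eq mult.commute)
  finally show ?thesis .
qed

lemma row_count_le: "row_count i \<le> d"
proof -
  have "card {k. k < N \<and> R k = i} = card (C ` {k. k < N \<and> R k = i})"
    by (intro card_image[symmetric] inj_onI) (auto intro: entry_inj)
  also have "\<dots> \<le> card {..<d}" by (intro card_mono) (auto simp: entry_bounds)
  finally show ?thesis by (simp add: row_count_def)
qed

definition "good v T \<longleftrightarrow> \<not> 3 * r < (\<Sum>i\<in>T. real (row_count i) / real d) \<and>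
  \<not> (\<Sum>i\<in>T. (ip d (a i) v)\<^sup>2 / q i) < (1 - \<epsilon> / 4) * energy A v \<and>
  (\<forall>x. ip d x (S T x) \<le> (1 + \<epsilon>) * \<kappa> * ip d x x)"

lemma expect_not_good:
  assumes v: "ip d v v = 1" "(1 - \<epsilon> / 8) * \<kappa> < energy A v"
  shows "expect (\<lambda>T. of_bool (\<not> good v T)) \<le> 3 * \<delta> / 8"
proof -
  let ?A = "\<lambda>T. 3 * r < (\<Sum>i\<in>T. real (row_count i) / real d)"
  let ?B = "\<lambda>T. (\<Sum>i\<in>T. (ip d (a i) v)\<^sup>2 / q i) < (1 - \<epsilon> / 4) * energy A v"
  let ?U = "\<lambda>T. \<not> (\<forall>x. ip d x (S T x) \<le> (1 + \<epsilon>) * \<kappa> * ip d x x)"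
  have cpos: "0 < F / r" using F_pos r_pos by simp
  have A: "expect (\<lambda>T. of_bool (?A T)) \<le> \<delta> / 8"
  proof -
    have "(\<Sum>i\<in>I. q i * (real (row_count i) / real d)) \<le> (\<Sum>i\<in>I. (r * row_norm2 es i / F) * 1)"
      using row_count_le d r_pos F_pos row_norm2_pos
      by (intro sum_mono mult_mono) (auto simp: q_def intro!: divide_nonneg_pos mult_nonneg_nonneg less_imp_le)
    also have "\<dots> = r" using F_pos by (simp add: F_eq[symmetric] sum_divide_distrib[symmetric] sum_distrib_left[symmetric])
    finally have "expect (\<lambda>T. of_bool (?A T)) \<le> exp (- r)"
      using row_count_le d by (intro sum_upper_tail) auto
    also have "\<dots> \<le> exp (- (3 * real l))" using r_ge by simp
    finally show ?thesis using exp_le_fail by simp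
  qed
  have B: "expect (\<lambda>T. of_bool (?B T)) \<le> \<delta> / 8"
  proof -
    have "expect (\<lambda>T. of_bool (?B T)) \<le> exp (- (energy A v * (\<epsilon> / 4)\<^sup>2 / (2 * (F / r))))"
      unfolding energy_eq
    proof (rule sum_lower_tail)
      fix i assume i: "i \<in> I" "q i < 1"
      have "(ip d (a i) v)\<^sup>2 / q i \<le> ip d (a i) (a i) / q i"
        using ip_Cauchy_Schwarz[of d "a i" v] v q_pos[OF i(1)] by (intro divide_right_mono) auto
      then show "(ip d (a i) v)\<^sup>2 / q i \<le> F / r" using small_rows[OF i] by simp
    qed (use q_pos cpos \<epsilon> in auto)
    also have "\<dots> \<le> exp (- (3 * real l))"
    proof -
      have "7 / 8 * \<kappa> \<le> (1 - \<epsilon> / 8) * \<kappa>" using \<epsilon> by (intro mult_right_mono) auto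
      then have "7 / 8 * \<kappa> \<le> energy A v" using v(2) by (rule order_trans[OF _ less_imp_le])
      then have "7 / 8 * (\<kappa> * \<epsilon>\<^sup>2) \<le> energy A v * \<epsilon>\<^sup>2"
        by (simp only: mult.assoc[symmetric]) (rule mult_right_mono, auto)
      moreover have "7 / 8 * (128 * real l * (F / r)) \<le> 7 / 8 * (\<kappa> * \<epsilon>\<^sup>2)"
        by (intro mult_left_mono variance_bound) simp
      ultimately have "7 / 8 * (128 * real l * (F / r)) \<le> energy A v * \<epsilon>\<^sup>2"
        by (rule order_trans[rotated])
      then have "3 * real l * (32 * (F / r)) \<le> energy A v * \<epsilon>\<^sup>2"
      proof (rule order_trans[rotated])
        have "96 * (real l * (F / r)) \<le> 112 * (real l * (F / r))"
          using cpos by (intro mult_right_mono mult_nonneg_nonneg) auto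
        then show "3 * real l * (32 * (F / r)) \<le> 7 / 8 * (128 * real l * (F / r))"
          by (simp add: mult.commute mult.left_commute)
      qed
      then have "3 * real l \<le> energy A v * \<epsilon>\<^sup>2 / (32 * (F / r))"
        using cpos by (subst pos_le_divide_eq) auto
      also have "\<dots> = energy A v * (\<epsilon> / 4)\<^sup>2 / (2 * (F / r))"
        by (simp add: power2_eq_square)
      finally show ?thesis by simp
    qed
    finally show ?thesis using exp_le_fail by simp
  qed
  have U: "expect (\<lambda>T. of_bool (?U T)) \<le> \<delta> / 8"
  proof -
    have "expect (\<lambda>T. of_bool (?U T)) \<le> real d * exp (- (3 * real l))"
    proof (rule sampled_gram_upper_tail)
      show "(\<Sum>i\<in>I. (ip d (a i) x)\<^sup>2) \<le> \<kappa> * ip d x x" for x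
        using energy_le_spectral_norm[of A x] by (simp add: energy_eq)
      show "ip d (a i) (a i) / q i \<le> F / r" if "i \<in> I" "q i < 1" for i
        using small_rows[OF that] .
    qed (use q_pos \<kappa>_pos \<epsilon> cpos variance_bound l_ge_1 in auto)
    then show ?thesis using exp_le_fail by simp
  qed
  have "expect (\<lambda>T. of_bool (\<not> good v T)) = expect (\<lambda>T. of_bool (?A T \<or> ?B T \<or> ?U T))"
    by (intro subset_expect_cong) (auto simp: good_def)
  also have "\<dots> \<le> expect (\<lambda>T. of_bool (?A T)) + expect (\<lambda>T. of_bool (?B T \<or> ?U T))"
    by (rule expect_of_bool_disj)
  also have "expect (\<lambda>T. of_bool (?B T \<or> ?U T)) \<le> expect (\<lambda>T. of_bool (?B T)) + expect (\<lambda>T. of_bool (?U T))"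
    by (rule expect_of_bool_disj)
  finally show ?thesis using A B U by linarith
qed

lemma K_ge: "9 * real l / \<epsilon> \<le> real K" and K_le: "real K \<le> 10 * real l / \<epsilon>" and K_pos: "0 < K"
proof -
  have *: "1 \<le> real l / \<epsilon>" using \<epsilon> l_ge_1 by (simp add: le_divide_eq)
  have "real K = of_int \<lceil>9 * real l / \<epsilon>\<rceil>" using \<epsilon> by (simp add: K_def num_iter_def)
  then show ge: "9 * real l / \<epsilon> \<le> real K" and "real K \<le> 10 * real l / \<epsilon>"
    using * by linarith+
  then show "0 < K" using * by (cases K) auto
qed

lemma iteration_bound: "(1 - \<epsilon> / 2) ^ (2 * K) * (4 * real d / \<delta>) \<le> (\<delta> / 4)\<^sup>2"
proof -
  have "(1 - \<epsilon> / 2) ^ (2 * K) \<le> exp (- (\<epsilon> / 2)) ^ (2 * K)"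
    using \<epsilon> exp_ge_add_one_self[of "- (\<epsilon> / 2)"] by (intro power_mono) auto
  also have "\<dots> = exp (- (\<epsilon> * real K))" by (simp flip: exp_of_nat_mult)
  also have "\<dots> \<le> exp (- (3 * (3 * real l)))"
    using K_ge \<epsilon> by (simp add: divide_le_eq mult.commute)
  also have "\<dots> = exp (- (3 * real l)) ^ 3" by (simp flip: exp_of_nat_mult)
  also have "\<dots> \<le> (\<delta> / (8 * real d)) ^ 3"
    using exp_le_fail(1) d by (intro power_mono) (auto simp: field_simps)
  finally have "(1 - \<epsilon> / 2) ^ (2 * K) * (4 * real d / \<delta>) \<le> (\<delta> / (8 * real d)) ^ 3 * (4 * real d / \<delta>)"
    using \<delta> by (intro mult_right_mono) auto
  also have "\<dots> = (\<delta> / 4)\<^sup>2 * (1 / (8 * (real d)\<^sup>2))"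
    using \<delta> d by (simp add: power2_eq_square power3_eq_cube field_simps)
  also have "\<dots> \<le> (\<delta> / 4)\<^sup>2 * 1"
  proof (intro mult_left_mono)
    have "1 \<le> (real d)\<^sup>2" using d by simp
    then show "1 / (8 * (real d)\<^sup>2) \<le> 1" by (simp add: divide_le_eq)
  qed simp
  finally show ?thesis by simp
qed

lemma good_success:
  assumes v: "ip d v v = 1" "(1 - \<epsilon> / 8) * \<kappa> < energy A v" and T: "T \<subseteq> I" and good: "good v T"
  shows "1 - \<delta> / 2 \<le> measure normal_tape {g \<in> space normal_tape.
    (1 - \<epsilon>) * \<kappa> \<le> output (capped T) g \<and> output (capped T) g \<le> (1 + \<epsilon>) * \<kappa>}"
proof -
  let ?\<alpha> = "(1 - \<epsilon> / 4) * ((1 - \<epsilon> / 8) * \<kappa>)"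
  have "(\<Sum>i\<in>T. real (row_count i)) \<le> 3 * (real d * r)"
    using good d by (simp add: good_def sum_divide_distrib[symmetric] pos_less_divide_eq algebra_simps)
  then have cap: "capped T = T" by (simp add: capped_def)
  have \<alpha>_pos: "0 < ?\<alpha>" using \<epsilon> \<kappa>_pos by simp
  have "?\<alpha> \<le> (1 - \<epsilon> / 4) * energy A v" using v \<epsilon> by (intro mult_left_mono) auto
  also have "\<dots> \<le> ip d v (S T v)"
    using good by (simp add: good_def ip_gram power2_eq_square)
  finally have \<alpha>: "?\<alpha> \<le> ip d v (S T v)" .
  have "(1 - \<epsilon>) * \<kappa> \<le> ((1 - \<epsilon> / 2) * ((1 - \<epsilon> / 4) * (1 - \<epsilon> / 8))) * \<kappa>"
  proof (rule mult_right_mono)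
    have "1 - \<epsilon> * (3 / 8) \<le> (1 - \<epsilon> / 4) * (1 - \<epsilon> / 8)" by (simp add: algebra_simps)
    then have "(1 - \<epsilon> / 2) * (1 - \<epsilon> * (3 / 8)) \<le> (1 - \<epsilon> / 2) * ((1 - \<epsilon> / 4) * (1 - \<epsilon> / 8))"
      using \<epsilon> by (intro mult_left_mono) auto
    moreover have "1 - \<epsilon> \<le> (1 - \<epsilon> / 2) * (1 - \<epsilon> * (3 / 8))" using \<epsilon> by (simp add: algebra_simps)
    ultimately show "1 - \<epsilon> \<le> (1 - \<epsilon> / 2) * ((1 - \<epsilon> / 4) * (1 - \<epsilon> / 8))" by simp
  qed (use \<kappa>_pos in simp)
  then have low: "(1 - \<epsilon>) * \<kappa> \<le> (1 - \<epsilon> / 2) * ?\<alpha>" by (simp only: mult.assoc)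
  have "1 - \<delta> / 2 \<le> measure normal_tape {g \<in> space normal_tape.
    (1 - \<epsilon> / 2) * ?\<alpha> \<le> output T g \<and> output T g \<le> (1 + \<epsilon>) * \<kappa>}"
    unfolding output_def
  proof (rule random_start_power_method[where v = v])
    show "inj_on (last_index C N) J" unfolding J_def by (rule inj_on_last_index)
    show "0 \<le> 1 / q i" if "i \<in> T" for i using q_pos[of i] T that by auto
    show "ip d y (S T y) \<le> (1 + \<epsilon>) * \<kappa> * ip d y y" for y using good by (simp add: good_def)
  qed (use v \<alpha> \<alpha>_pos J_subset col_zero \<delta> d K_pos \<epsilon> iteration_bound in auto)
  also have "\<dots> \<le> measure normal_tape {g \<in> space normal_tape.
    (1 - \<epsilon>) * \<kappa> \<le> output (capped T) g \<and> output (capped T) g \<le> (1 + \<epsilon>) * \<kappa>}"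
    unfolding cap
  proof (rule finite_measure.finite_measure_mono)
    show "finite_measure normal_tape" using prob_space_normal_tape by (rule prob_space.finite_measure)
    show "{g \<in> space normal_tape. (1 - \<epsilon>) * \<kappa> \<le> output T g \<and> output T g \<le> (1 + \<epsilon>) * \<kappa>} \<in> sets normal_tape"
      unfolding output_def by measurable
  qed (use low in auto)
  finally show ?thesis .
qed

lemma success_probability:
  "1 - \<delta> \<le> measure tape_space {\<omega> \<in> space tape_space.
    (1 - \<epsilon>) * \<kappa> \<le> output (capped (select (fst \<omega>))) (snd \<omega>) \<and>
    output (capped (select (fst \<omega>))) (snd \<omega>) \<le> (1 + \<epsilon>) * \<kappa>}"
proof -
  let ?U = "uniform_measure lborel {0..1::real}"
  let ?UT = "\<Pi>\<^sub>M k \<in> (UNIV :: nat set). ?U"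
  let ?P = "\<lambda>T g. (1 - \<epsilon>) * \<kappa> \<le> output (capped T) g \<and> output (capped T) g \<le> (1 + \<epsilon>) * \<kappa>"
  have "(1 - \<epsilon> / 8) * \<kappa> < \<kappa>" "0 \<le> (1 - \<epsilon> / 8) * \<kappa>" using \<epsilon> \<kappa>_pos by auto
  then obtain v where v: "ip d v v = 1" "(1 - \<epsilon> / 8) * \<kappa> < energy A v"
    using spectral_norm_approx[of A "(1 - \<epsilon> / 8) * \<kappa>"] d by auto
  have U: "prob_space ?U" by (intro prob_space_uniform_measure) auto
  let ?X = "\<lambda>i. {x. x * F < r * row_norm2 es i}"
  have X: "?X i \<in> sets ?U" "measure ?U (?X i) = q i" if "i \<in> I" for i
    using measure_uniform_scaled_less[OF F_pos, of "r * row_norm2 es i"] r_pos row_norm2_pos[OF that]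
    by (auto simp: q_def)
  have inj: "inj_on (last_index R N) I" unfolding I_def by (rule inj_on_last_index)
  have weight: "subset_weight I (\<lambda>i. measure ?U (?X i)) T = subset_weight I q T" if "T \<subseteq> I" for T
    unfolding subset_weight_def using that X(2) by (auto intro!: arg_cong2[where f = times] prod.cong simp: subset_iff)
  have "1 - 3 * \<delta> / 8 - \<delta> / 2 \<le> measure (?UT \<Otimes>\<^sub>M normal_tape)
    {\<omega> \<in> space (?UT \<Otimes>\<^sub>M normal_tape). ?P (select (fst \<omega>)) (snd \<omega>)}"
  proof (rule measure_pair_random_subset[where sel = select and P = ?P and Good = "good v" and q = q and I = I])
    show "prob_space ?UT" by (intro prob_space_PiM U)
    show "prob_space normal_tape" by (rule prob_space_normal_tape)
    show "random_subset I q" by (rule random_subset_axioms)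
    show "select u \<subseteq> I" for u by (auto simp: select_def)
    fix T assume T: "T \<subseteq> I"
    show "{u \<in> space ?UT. select u = T} \<in> sets ?UT"
      unfolding select_def using measure_random_subset(1)[OF U finite_I inj T X(1)] by simp
    show "measure ?UT {u \<in> space ?UT. select u = T} = subset_weight I q T"
      unfolding select_def using measure_random_subset(2)[OF U finite_I inj T X(1)] weight[OF T] by simp
    show "{g \<in> space normal_tape. ?P T g} \<in> sets normal_tape"
      unfolding output_def by measurable
    show "1 - \<delta> / 2 \<le> measure normal_tape {g \<in> space normal_tape. ?P T g}" if "good v T"
      using v T that by (rule good_success)
  next
    show "expect (\<lambda>T. of_bool (\<not> good v T)) \<le> 3 * \<delta> / 8" using v by (rule expect_not_good)
  qed (use \<delta> in auto)
  then show ?thesis unfolding tape_space_def using \<delta> by simp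
qed

lemma sampled_entries_eq:
  "set (sampled_entries d es \<epsilon> \<delta> u) = {k. k < N \<and> R k \<in> capped (select u)}"
  "distinct (sampled_entries d es \<epsilon> \<delta> u)"
  "real (length (sampled_entries d es \<epsilon> \<delta> u)) \<le> 3 * (real d * r)"
  "length (sampled_entries d es \<epsilon> \<delta> u) \<le> N"
proof -
  let ?f = "\<lambda>k. latest R u N (R k) * F < r * row_norm2 es (R k)"
  let ?ks = "filter ?f [0..<N]"
  have f: "?f k \<longleftrightarrow> R k \<in> select u" if "k < N" for k
    using that by (auto simp: select_def I_def latest_last_index)
  have set: "set ?ks = {k. k < N \<and> R k \<in> select u}" using f by auto
  have fin: "finite (select u)" using finite_I by (auto simp: select_def)
  have "length ?ks = card (set ?ks)" by (rule distinct_card[symmetric]) simp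
  also have "set ?ks = (\<Union>i\<in>select u. {k. k < N \<and> R k = i})" unfolding set by auto
  also have "card \<dots> = (\<Sum>i\<in>select u. row_count i)"
    unfolding row_count_def using fin by (intro card_UN_disjoint) auto
  finally have len: "length ?ks = (\<Sum>i\<in>select u. row_count i)" .
  have eq: "sampled_entries d es \<epsilon> \<delta> u = (if 3 * (real d * r) < real (length ?ks) then [] else ?ks)"
    by (simp only: sampled_entries_def r_def Let_def)
  show "set (sampled_entries d es \<epsilon> \<delta> u) = {k. k < N \<and> R k \<in> capped (select u)}"
    using set unfolding eq capped_def len by auto
  show "distinct (sampled_entries d es \<epsilon> \<delta> u)" unfolding eq by simp
  show "real (length (sampled_entries d es \<epsilon> \<delta> u)) \<le> 3 * (real d * r)"
    unfolding eq using r_pos by auto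
  have "length ?ks \<le> length [0..<N]" by (rule length_filter_le)
  then show "length (sampled_entries d es \<epsilon> \<delta> u) \<le> N" unfolding eq by auto
qed

lemma capped_select_subset: "capped (select u) \<subseteq> I"
  by (auto simp: capped_def select_def)

lemma start_eq: "latest C g N = start g"
  by (auto simp: fun_eq_iff start_vec_def J_def latest_last_index latest_outside)

lemma norm_prog_output:
  "wp \<omega> norm_prog (init_state n d es \<epsilon> \<delta>) (\<lambda>t s.
    t \<le> 1000 * (N + 1) + 1000 * (l + 1) + 1000 * (K + 1) * (length (sampled_entries d es \<epsilon> \<delta> (fst \<omega>)) + 1) \<and>
    estimate s = output (capped (select (fst \<omega>))) (snd \<omega>))"
proof -
  let ?T = "capped (select (fst \<omega>))"
  have W: "scaled_val d es \<epsilon> \<delta> k = 1 / q (R k) * V k" if "k < N" for k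
    using that inverse_q[of "R k"] by (simp add: scaled_val_def r_def I_def)
  have w: "0 \<le> 1 / q i" if "i \<in> ?T" for i using q_pos[of i] capped_select_subset that by (auto intro: less_imp_le)
  have T: "?T \<subseteq> {..<n}" using capped_select_subset I_subset by blast
  let ?ks = "sampled_entries d es \<epsilon> \<delta> (fst \<omega>)" and ?W = "scaled_val d es \<epsilon> \<delta>" and ?x = "start (snd \<omega>)"
  let ?step = "pow_step R C V ?W ?ks" and ?form = "pow_form R C V ?W ?ks"
  have ratio: "?form ((?step ^^ (K - 1)) ?x) ((?step ^^ K) ?x) / ?form ((?step ^^ (K - 1)) ?x) ((?step ^^ (K - 1)) ?x)
    = output ?T (snd \<omega>)"
    unfolding output_def
    by (rule pow_ratio_eq_moment_ratio[OF T _ sampled_entries_eq(2,1) w K_pos]) (use W in auto)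
  show ?thesis
    using wp_norm_prog[OF \<epsilon>(1), of \<omega> n d es \<delta>, folded l_def, folded K_def,
        unfolded start_eq ratio] d N K_pos
    by (simp add: add.assoc)
qed

lemma running_time:
  assumes ks: "real m \<le> 3 * (real d * r)" "m \<le> N"
    and t: "t \<le> 1000 * (N + 1) + 1000 * (l + 1) + 1000 * (K + 1) * (m + 1)"
  shows "real t \<le> 200000000 * (real N + tau N d \<epsilon> \<delta>)"
proof -
  define L where "L = ln (real d / (\<epsilon> * \<delta>))"
  define M where "M = min (real N) (3 * (real d * r))"
  have L: "real l \<le> 3 * L"
  proof -
    have "2 ^ (l - 1) < real d / (\<epsilon> * \<delta>)"
      using l_ge_1 less_ceil_log2[of "l - 1" "real d / (\<epsilon> * \<delta>)"] by (simp add: l_def log_factor_def)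
    then have "ln (2 ^ (l - 1)) < L"
      unfolding L_def using ratio_bounds by (subst ln_less_cancel_iff) auto
    then have "real (l - 1) * ln 2 < L" by (simp add: ln_realpow)
    moreover have "ln 2 \<le> L"
      unfolding L_def using ratio_bounds by (subst ln_le_cancel_iff) auto
    ultimately have "real l * ln 2 \<le> 2 * L"
      using l_ge_1 by (simp add: of_nat_diff algebra_simps)
    moreover have "real l * (2 / 3) \<le> real l * ln 2"
      using ln2_ge_two_thirds by (intro mult_left_mono) auto
    ultimately show ?thesis by simp
  qed
  have L0: "0 \<le> L" using L l_ge_1 by simp
  have Le: "1 \<le> real l / \<epsilon>" using \<epsilon> l_ge_1 by (simp add: le_divide_eq)
  have K1: "real K + 1 \<le> 33 * (L / \<epsilon>)"
  proof -
    have "real K + 1 \<le> 11 * (real l / \<epsilon>)" using K_le Le by simp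
    also have "real l / \<epsilon> \<le> 3 * L / \<epsilon>" using L \<epsilon> by (intro divide_right_mono) auto
    finally show ?thesis by simp
  qed
  have l1: "real l + 1 \<le> real K + 1"
  proof -
    have "real l * 1 \<le> 9 * real l * (1 / \<epsilon>)" using \<epsilon> by (intro mult_mono) (auto simp: le_divide_eq)
    then show ?thesis using K_ge by simp
  qed
  have dr: "1 \<le> real d * r" using d r_ge l_ge_1 mult_mono[of 1 "real d" 1 r] by simp
  have "1 \<le> real N" using N by (cases es) auto
  then have M: "real m \<le> M" "1 \<le> M" using ks dr by (auto simp: M_def)
  have r_le: "3 * (real d * r) \<le> 1152 * ((real d)\<^sup>2 / \<epsilon>\<^sup>2 * L)"
  proof -
    have "3 * (real d * r) = 384 * ((real d)\<^sup>2 / \<epsilon>\<^sup>2 * real l)"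
      by (simp add: r_eq power2_eq_square)
    also have "\<dots> \<le> 384 * ((real d)\<^sup>2 / \<epsilon>\<^sup>2 * (3 * L))"
      using L by (intro mult_left_mono) auto
    finally show ?thesis by simp
  qed
  have tau: "L / \<epsilon> * M \<le> 1152 * tau N d \<epsilon> \<delta>"
  proof -
    have Le0: "0 \<le> L / \<epsilon>" using L0 \<epsilon> by simp
    have 1: "L / \<epsilon> * M \<le> 1152 * (real N / \<epsilon> * L)"
    proof -
      have "L / \<epsilon> * M \<le> L / \<epsilon> * real N" using Le0 by (intro mult_left_mono) (auto simp: M_def)
      also have "\<dots> = 1 * (real N / \<epsilon> * L)" by simp
      also have "\<dots> \<le> 1152 * (real N / \<epsilon> * L)" using L0 \<epsilon> by (intro mult_right_mono) auto
      finally show ?thesis .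
    qed
    have "L / \<epsilon> * M \<le> L / \<epsilon> * (1152 * ((real d)\<^sup>2 / \<epsilon>\<^sup>2 * L))"
      using Le0 r_le by (intro mult_left_mono) (auto simp: M_def)
    also have "\<dots> = 1152 * ((real d)\<^sup>2 / \<epsilon> ^ 3 * L\<^sup>2)"
      using \<epsilon> by (simp add: power2_eq_square power3_eq_cube field_simps)
    finally show ?thesis using 1 unfolding tau_def L_def[symmetric] by (simp add: min_def)
  qed
  have "real t \<le> 1000 * (real N + 1) + 1000 * (real l + 1) + 1000 * (real K + 1) * (real m + 1)"
    using t by (simp add: of_nat_le_iff[of t, symmetric, where 'a = real] algebra_simps)
  also have "\<dots> \<le> 2000 * real N + 1000 * ((real K + 1) * M) + 1000 * (real K + 1) * (2 * M)"
  proof (intro add_mono)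
    show "1000 * (real N + 1) \<le> 2000 * real N" using \<open>1 \<le> real N\<close> by simp
    have "(real l + 1) * 1 \<le> (real K + 1) * M" using l1 M by (intro mult_mono) auto
    then have "real l + 1 \<le> (real K + 1) * M" by (simp only: mult_1_right)
    then show "1000 * (real l + 1) \<le> 1000 * ((real K + 1) * M)" by (rule mult_left_mono) simp
    show "1000 * (real K + 1) * (real m + 1) \<le> 1000 * (real K + 1) * (2 * M)"
      using M by (intro mult_left_mono) auto
  qed
  also have "\<dots> = 2000 * real N + 3000 * ((real K + 1) * M)" by simp
  also have "(real K + 1) * M \<le> 33 * (L / \<epsilon>) * M" using K1 M by (intro mult_right_mono) auto
  also have "33 * (L / \<epsilon>) * M \<le> 33 * (1152 * tau N d \<epsilon> \<delta>)" using tau by simp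
  also have "2000 * real N + 3000 * (33 * (1152 * tau N d \<epsilon> \<delta>)) \<le> 200000000 * (real N + tau N d \<epsilon> \<delta>)"
  proof -
    have "0 \<le> L / \<epsilon> * M" using L0 \<epsilon> M by (intro mult_nonneg_nonneg) auto
    then have "0 \<le> tau N d \<epsilon> \<delta>" using tau by simp
    then show ?thesis by simp
  qed
  finally show ?thesis by simp
qed

end

lemma (in sparse_matrix) trivial_case:
  assumes d: "0 < d" and triv: "d = 1 \<or> length es = 0" and \<epsilon>: "0 < \<epsilon>" "\<epsilon> < 1" and \<delta>: "0 < \<delta>" "\<delta> < 1"
  shows "wp \<omega> norm_prog (init_state n d es \<epsilon> \<delta>) (\<lambda>t s.
    real t \<le> 200000000 * (max 1 (real (length es)) + tau (length es) d \<epsilon> \<delta>) \<and>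
    estimate s = (spectral_norm A)\<^sup>2)"
proof -
  have "(spectral_norm A)\<^sup>2 \<le> frob2 es" using d by (rule spectral_norm_le_frob2)
  moreover have "frob2 es \<le> (spectral_norm A)\<^sup>2"
    using triv frob2_le by (auto simp: frob2_def)
  ultimately have eq: "frob2 es = (spectral_norm A)\<^sup>2" by simp
  have "\<epsilon> * \<delta> \<le> 1" using \<epsilon> \<delta> by (simp add: mult_le_one)
  then have "0 \<le> ln (real d / (\<epsilon> * \<delta>))"
    using d \<epsilon> \<delta> by (intro ln_ge_zero) (auto simp: pos_le_divide_eq)
  then have tau: "0 \<le> tau (length es) d \<epsilon> \<delta>" using \<epsilon> by (simp add: tau_def)
  show ?thesis
  proof (rule wp_mono[OF wp_norm_prog[OF \<epsilon>(1), of \<omega> n d es \<delta>]])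
    fix t s
    assume *: "t \<le> 1000 * (length es + 1) + (if 1 < d \<and> 0 < length es
        then 1000 * (log_factor d \<epsilon> \<delta> + 1) + 1000 * (num_iter \<epsilon> (log_factor d \<epsilon> \<delta>) + 1) *
          (length (sampled_entries d es \<epsilon> \<delta> (fst \<omega>)) + 1) else 0) \<and>
      estimate s = (if 1 < d \<and> 0 < length es \<and> 0 < num_iter \<epsilon> (log_factor d \<epsilon> \<delta>)
        then pow_form R C V (scaled_val d es \<epsilon> \<delta>) (sampled_entries d es \<epsilon> \<delta> (fst \<omega>))
            ((pow_step R C V (scaled_val d es \<epsilon> \<delta>) (sampled_entries d es \<epsilon> \<delta> (fst \<omega>)) ^^ (num_iter \<epsilon> (log_factor d \<epsilon> \<delta>) - 1))
              (latest C (snd \<omega>) (length es)))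
            ((pow_step R C V (scaled_val d es \<epsilon> \<delta>) (sampled_entries d es \<epsilon> \<delta> (fst \<omega>)) ^^ num_iter \<epsilon> (log_factor d \<epsilon> \<delta>))
              (latest C (snd \<omega>) (length es))) /
          pow_form R C V (scaled_val d es \<epsilon> \<delta>) (sampled_entries d es \<epsilon> \<delta> (fst \<omega>))
            ((pow_step R C V (scaled_val d es \<epsilon> \<delta>) (sampled_entries d es \<epsilon> \<delta> (fst \<omega>)) ^^ (num_iter \<epsilon> (log_factor d \<epsilon> \<delta>) - 1))
              (latest C (snd \<omega>) (length es)))
            ((pow_step R C V (scaled_val d es \<epsilon> \<delta>) (sampled_entries d es \<epsilon> \<delta> (fst \<omega>)) ^^ (num_iter \<epsilon> (log_factor d \<epsilon> \<delta>) - 1))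
              (latest C (snd \<omega>) (length es)))
        else frob2 es)"
    have "\<not> (1 < d \<and> 0 < length es)" using triv by auto
    then have "t \<le> 1000 * (length es + 1)" "estimate s = (spectral_norm A)\<^sup>2" using * eq by auto
    moreover from this have "real t \<le> 1000 * (real (length es) + 1)"
      by (simp add: of_nat_le_iff[of t, symmetric, where 'a = real])
    ultimately show "real t \<le> 200000000 * (max 1 (real (length es)) + tau (length es) d \<epsilon> \<delta>) \<and>
      estimate s = (spectral_norm A)\<^sup>2" using tau by (auto simp: max_def)
  qed
qed

lemma wp_iff_exec:
  assumes "wp \<omega> c s (\<lambda>t s'. estimate s' = e)"
  shows "(\<exists>t s'. exec \<omega> c s t s' \<and> lo \<le> estimate s' \<and> estimate s' \<le> hi) \<longleftrightarrow> lo \<le> e \<and> e \<le> hi"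
  using assms exec_deterministic unfolding wp_def by metis

theorem theorem1:
  shows "\<exists>(P :: com) (C :: real). C > 0 \<and>
    (\<forall>(n :: nat) (d :: nat) (A :: real mat) (es :: (nat \<times> nat \<times> real) list)
        (\<epsilon> :: real) (\<delta> :: real).
      A \<in> carrier_mat n d \<longrightarrow> 1 \<le> d \<longrightarrow> d \<le> n \<longrightarrow> entry_list A es \<longrightarrow>
      \<epsilon> \<in> {0<..<1} \<longrightarrow> \<delta> \<in> {0<..<1} \<longrightarrow>
      (\<forall>\<omega> \<in> space tape_space. \<exists>t s. exec \<omega> P (init_state n d es \<epsilon> \<delta>) t s \<and>
         real t \<le> C * (max 1 (real (nnz A)) + tau (nnz A) d \<epsilon> \<delta>)) \<and>
      measure tape_space {\<omega> \<in> space tape_space.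
         \<exists>t s. exec \<omega> P (init_state n d es \<epsilon> \<delta>) t s \<and>
           (1 - \<epsilon>) * (spectral_norm A)\<^sup>2 \<le> estimate s \<and>
           estimate s \<le> (1 + \<epsilon>) * (spectral_norm A)\<^sup>2} \<ge> 1 - \<delta>)"
proof (intro exI[of _ norm_prog] exI[of _ "200000000 :: real"] conjI allI impI ballI)
  fix n d A es and \<epsilon> \<delta> :: real
  assume A: "A \<in> carrier_mat n d" and d: "1 \<le> d" and "entry_list A es"
    and "\<epsilon> \<in> {0<..<1}" and "\<delta> \<in> {0<..<1}"
  then interpret sparse_matrix A n d es by unfold_locales
  have \<epsilon>: "0 < \<epsilon>" "\<epsilon> < 1" and \<delta>: "0 < \<delta>" "\<delta> < 1"
    using \<open>\<epsilon> \<in> {0<..<1}\<close> \<open>\<delta> \<in> {0<..<1}\<close> by auto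
  let ?s = "init_state n d es \<epsilon> \<delta>" and ?\<kappa> = "(spectral_norm A)\<^sup>2"
  let ?T = "200000000 * (max 1 (real (nnz A)) + tau (nnz A) d \<epsilon> \<delta>)"
  note nnz = length_entry_list[OF es, symmetric]
  interpret tape: prob_space tape_space by (rule prob_space_tape_space)
  have "\<exists>out. (\<forall>\<omega>. wp \<omega> norm_prog ?s (\<lambda>t s. real t \<le> ?T \<and> estimate s = out \<omega>)) \<and>
    1 - \<delta> \<le> measure tape_space {\<omega> \<in> space tape_space. (1 - \<epsilon>) * ?\<kappa> \<le> out \<omega> \<and> out \<omega> \<le> (1 + \<epsilon>) * ?\<kappa>}"
  proof (cases "1 < d \<and> 0 < length es")
    case True
    then interpret sparse_sampling A n d es \<epsilon> \<delta> using \<epsilon> \<delta> by unfold_locales auto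
    have "wp \<omega> norm_prog ?s (\<lambda>t s. real t \<le> ?T \<and> estimate s = output (capped (select (fst \<omega>))) (snd \<omega>))" for \<omega>
    proof (rule wp_mono[OF norm_prog_output])
      fix t s
      assume *: "t \<le> 1000 * (N + 1) + 1000 * (l + 1) + 1000 * (K + 1) * (length (sampled_entries d es \<epsilon> \<delta> (fst \<omega>)) + 1) \<and>
        estimate s = output (capped (select (fst \<omega>))) (snd \<omega>)"
      have "real t \<le> 200000000 * (real N + tau N d \<epsilon> \<delta>)"
        using * by (intro running_time[OF sampled_entries_eq(3,4)]) auto
      then show "real t \<le> ?T \<and> estimate s = output (capped (select (fst \<omega>))) (snd \<omega>)"
        using * True unfolding nnz by (auto simp: max_def)
    qed
    then show ?thesis using success_probability by (intro exI conjI) auto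
  next
    case False
    then have triv: "d = 1 \<or> length es = 0" using d by auto
    have "(1 - \<epsilon>) * ?\<kappa> \<le> ?\<kappa>" "?\<kappa> \<le> (1 + \<epsilon>) * ?\<kappa>"
      using \<epsilon> by (auto simp: algebra_simps)
    then have "{\<omega> \<in> space tape_space. (1 - \<epsilon>) * ?\<kappa> \<le> ?\<kappa> \<and> ?\<kappa> \<le> (1 + \<epsilon>) * ?\<kappa>} = space tape_space"
      by auto
    then show ?thesis
      using trivial_case[OF _ triv \<epsilon> \<delta>] d \<delta> unfolding nnz
      by (intro exI[of _ "\<lambda>_. ?\<kappa>"]) (auto simp: tape.prob_space)
  qed
  then obtain out where run: "\<And>\<omega>. wp \<omega> norm_prog ?s (\<lambda>t s. real t \<le> ?T \<and> estimate s = out \<omega>)"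
    and prob: "1 - \<delta> \<le> measure tape_space {\<omega> \<in> space tape_space. (1 - \<epsilon>) * ?\<kappa> \<le> out \<omega> \<and> out \<omega> \<le> (1 + \<epsilon>) * ?\<kappa>}"
    by blast
  show "\<exists>t s. exec \<omega> norm_prog ?s t s \<and> real t \<le> ?T" for \<omega>
    using run[of \<omega>] unfolding wp_def by blast
  have "wp \<omega> norm_prog ?s (\<lambda>t s. estimate s = out \<omega>)" for \<omega>
    by (rule wp_mono[OF run]) auto
  note iff = wp_iff_exec[OF this]
  show "1 - \<delta> \<le> measure tape_space {\<omega> \<in> space tape_space. \<exists>t s. exec \<omega> norm_prog ?s t s \<and>
      (1 - \<epsilon>) * ?\<kappa> \<le> estimate s \<and> estimate s \<le> (1 + \<epsilon>) * ?\<kappa>}"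
    unfolding iff by (rule prob)
qed simp

end
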